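(* Let $\sigma=\{\sigma_i\mid i\in I\}$ be a partition of the set $\mathbb{P}$ of all primes and let $G$ be a finite $\sigma$-full group. Then any two of the following conditions are equivalent: (i) Every subgroup of $G$ is $H_\sigma$-normally embedded in $G$. (ii) $G=D\rtimes M$ is an $H\sigma E$-group, where $D$ $(=G^{\mathfrak N_\sigma})$ is a cyclic group of square-free order and $M$ is a Dedekind group. (iii) $G=D\rtimes M$, where $D$ is a cyclic $\sigma$-Hall subgroup of $G$ of square-free order with $|\sigma(D)|=|\pi(D)|$ and $M$ is a Dedekind group.
   Context: All groups are finite. $\pi(n)$ is the set of primes dividing $n$, $\pi(G)=\pi(|G|)$. $\sigma=\{\sigma_i\mid i\in I\}$ is a partition of $\mathbb P$; $\sigma(n)=\{\sigma_i\mid \sigma_i\cap\pi(n)\neq\emptyset\}$ and $\sigma(G)=\sigma(|G|)$. A group is $\sigma$-primary if it is a $\sigma_i$-group for some $i$. A Dedekind group is a group all of whose subgroups are normal. A set $\mathcal H$ of subgroups of $G$ is a complete Hall $\sigma$-set of $G$ if every member of $\mathcal H\setminus\{1\}$ is a Hall $\sigma_i$-subgroup of $G$ for some $i$ and $\mathcal H$ contains exactly one Hall $\sigma_i$-subgroup of $G$ for every $\sigma_i\in\sigma(G)$. $G$ is $\sigma$-full if it possesses a complete Hall $\sigma$-set. A subgroup $A$ of $G$ is a $\sigma$-Hall subgroup of $G$ if $\sigma(|A|)\cap\sigma(|G:A|)=\emptyset$. $A$ is $H_\sigma$-normally embedded in $G$ if $A$ is a $\sigma$-Hall subgroup of some normal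 subgroup of $G$. A group is $\sigma$-nilpotent if it is a direct product of $\sigma$-primary groups. $G^{\mathfrak N_\sigma}$ is the intersection of all normal subgroups $N$ of $G$ with $G/N$ $\sigma$-nilpotent. A group has a Sylow tower if it has a normal series $1=G_0<G_1<\cdots<G_t=G$ such that each $|G_i/G_{i-1}|$ is the order of some Sylow subgroup of $G$. A chief factor $H/K$ of $G$ is $\sigma$-central in $G$ if $(H/K)\rtimes(G/C_G(H/K))$ is $\sigma$-primary, and $\sigma$-eccentric otherwise. $G$ is an $H\sigma E$-group if: (a) $G=D\rtimes M$, where $D=G^{\mathfrak N_\sigma}$ is a $\sigma$-Hall subgroup of $G$ and $|\sigma(D)|=|\pi(D)|$; (b) $D$ has a Sylow tower and every chief factor of $G$ below $D$ is $\sigma$-eccentric; (c) $M$ acts irreducibly on every $M$-invariant Sylow subgroup of $D$. In "$G=D\rtimes M$ is an $H\sigma E$-group", $D$ and $M$ are the subgroups appearing in (a)–(c). *)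

theory Defs
  imports
    "HOL-Algebra.Product_Groups"
    "HOL-Computational_Algebra.Squarefree"
    "HOL-Library.Disjoint_Sets"
begin

text \<open>
  A partition \<open>\<sigma> = {\<sigma>\<^sub>i | i \<in> I}\<close> of the primes is the set of its (nonempty) classes.
  Subgroups are carrier subsets, the subgroup \<open>A\<close> of \<open>G\<close> viewed as a group is
  \<open>G\<lparr>carrier := A\<rparr>\<close>, and the section \<open>H/K\<close> is \<open>(G\<lparr>carrier := H\<rparr>) Mod K\<close>.
  The definitions are meant for finite groups.
\<close>

definition prime_partition :: "nat set set \<Rightarrow> bool" where
  "prime_partition \<sigma> \<longleftrightarrow> partition_on {p. prime p} \<sigma>"

definition sigma_of :: "nat set set \<Rightarrow> nat \<Rightarrow> nat set set" where
  "sigma_of \<sigma> n = {S \<in> \<sigma>. S \<inter> prime_factors n \<noteq> {}}"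

definition sigma_primary :: "nat set set \<Rightarrow> ('a, 'b) monoid_scheme \<Rightarrow> bool" where
  "sigma_primary \<sigma> G \<longleftrightarrow> (\<exists>S\<in>\<sigma>. prime_factors (order G) \<subseteq> S)"

definition dedekind_group :: "('a, 'b) monoid_scheme \<Rightarrow> bool" where
  "dedekind_group G \<longleftrightarrow> group G \<and> (\<forall>H. subgroup H G \<longrightarrow> H \<lhd> G)"

definition hall_subgroup :: "nat set \<Rightarrow> ('a, 'b) monoid_scheme \<Rightarrow> 'a set \<Rightarrow> bool" where
  "hall_subgroup S G H \<longleftrightarrow> subgroup H G \<and> prime_factors (card H) \<subseteq> S
     \<and> prime_factors (card (rcosets\<^bsub>G\<^esub> H)) \<inter> S = {}"

definition complete_hall_sigma_set ::
  "nat set set \<Rightarrow> ('a, 'b) monoid_scheme \<Rightarrow> 'a set set \<Rightarrow> bool" where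
  "complete_hall_sigma_set \<sigma> G \<H> \<longleftrightarrow>
     (\<forall>H\<in>\<H>. subgroup H G)
     \<and> (\<forall>H\<in>\<H> - {{\<one>\<^bsub>G\<^esub>}}. \<exists>S\<in>\<sigma>. hall_subgroup S G H)
     \<and> (\<forall>S\<in>sigma_of \<sigma> (order G). \<exists>!H. H \<in> \<H> \<and> hall_subgroup S G H)"

definition sigma_full :: "nat set set \<Rightarrow> ('a, 'b) monoid_scheme \<Rightarrow> bool" where
  "sigma_full \<sigma> G \<longleftrightarrow> (\<exists>\<H>. complete_hall_sigma_set \<sigma> G \<H>)"

definition sigma_hall :: "nat set set \<Rightarrow> ('a, 'b) monoid_scheme \<Rightarrow> 'a set \<Rightarrow> bool" where
  "sigma_hall \<sigma> G A \<longleftrightarrow> subgroup A G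
     \<and> sigma_of \<sigma> (card A) \<inter> sigma_of \<sigma> (card (rcosets\<^bsub>G\<^esub> A)) = {}"

definition H_sigma_normally_embedded ::
  "nat set set \<Rightarrow> ('a, 'b) monoid_scheme \<Rightarrow> 'a set \<Rightarrow> bool" where
  "H_sigma_normally_embedded \<sigma> G A \<longleftrightarrow> (\<exists>N. N \<lhd> G \<and> sigma_hall \<sigma> (G\<lparr>carrier := N\<rparr>) A)"

text \<open>
  The factors of a direct product isomorphic to \<open>G\<close> embed into \<open>G\<close>, so nothing is lost by
  taking them over the element type of \<open>G\<close>. The empty index set gives the trivial group.
\<close>

definition sigma_nilpotent :: "nat set set \<Rightarrow> ('a, 'b) monoid_scheme \<Rightarrow> bool" where
  "sigma_nilpotent \<sigma> G \<longleftrightarrow>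
     (\<exists>(I :: nat set) (F :: nat \<Rightarrow> 'a monoid). finite I
        \<and> (\<forall>i\<in>I. group (F i) \<and> sigma_primary \<sigma> (F i))
        \<and> G \<cong> product_group I F)"

definition sigma_nilpotent_residual ::
  "nat set set \<Rightarrow> ('a, 'b) monoid_scheme \<Rightarrow> 'a set" where
  "sigma_nilpotent_residual \<sigma> G = \<Inter>{N. N \<lhd> G \<and> sigma_nilpotent \<sigma> (G Mod N)}"

definition sylow_subgroup :: "nat \<Rightarrow> ('a, 'b) monoid_scheme \<Rightarrow> 'a set \<Rightarrow> bool" where
  "sylow_subgroup p G P \<longleftrightarrow>
     prime p \<and> subgroup P G \<and> card P = p ^ multiplicity p (order G)"

definition has_sylow_tower :: "('a, 'b) monoid_scheme \<Rightarrow> bool" where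
  "has_sylow_tower G \<longleftrightarrow>
     (\<exists>(t :: nat) N. N 0 = {\<one>\<^bsub>G\<^esub>} \<and> N t = carrier G
        \<and> (\<forall>i\<le>t. N i \<lhd> G)
        \<and> (\<forall>i<t. N i \<subset> N (Suc i)
             \<and> (\<exists>p P. sylow_subgroup p G P
                  \<and> order ((G\<lparr>carrier := N (Suc i)\<rparr>) Mod N i) = card P)))"

definition chief_factor :: "('a, 'b) monoid_scheme \<Rightarrow> 'a set \<Rightarrow> 'a set \<Rightarrow> bool" where
  "chief_factor G H K \<longleftrightarrow> H \<lhd> G \<and> K \<lhd> G \<and> K \<subset> H
     \<and> (\<forall>L. L \<lhd> G \<and> K \<subseteq> L \<and> L \<subseteq> H \<longrightarrow> L = K \<or> L = H)"

definition centralizer_section ::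
  "('a, 'b) monoid_scheme \<Rightarrow> 'a set \<Rightarrow> 'a set \<Rightarrow> 'a set" where
  "centralizer_section G H K = {g \<in> carrier G.
     \<forall>X \<in> carrier ((G\<lparr>carrier := H\<rparr>) Mod K). g <#\<^bsub>G\<^esub> X #>\<^bsub>G\<^esub> (inv\<^bsub>G\<^esub> g) = X}"

definition semidirect_product ::
  "('a, 'c) monoid_scheme \<Rightarrow> ('b, 'd) monoid_scheme \<Rightarrow> ('b \<Rightarrow> 'a \<Rightarrow> 'a) \<Rightarrow> ('a \<times> 'b) monoid"
  where
  "semidirect_product N Q \<phi> =
     \<lparr>carrier = carrier N \<times> carrier Q,
      monoid.mult = (\<lambda>(n, q) (n', q'). (n \<otimes>\<^bsub>N\<^esub> \<phi> q n', q \<otimes>\<^bsub>Q\<^esub> q')),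
      one = (\<one>\<^bsub>N\<^esub>, \<one>\<^bsub>Q\<^esub>)\<rparr>"

text \<open>
  The action of a coset \<open>Q\<close> of \<open>C\<^sub>G(H/K)\<close> on a coset \<open>X\<close> of \<open>K\<close> in \<open>H\<close> by conjugation:
  all \<open>g \<in> Q\<close> give the same coset \<open>g X g\<inverse>\<close>, so their union is that coset.
\<close>

definition section_conj ::
  "('a, 'b) monoid_scheme \<Rightarrow> 'a set \<Rightarrow> 'a set \<Rightarrow> 'a set" where
  "section_conj G Q X = (\<Union>g\<in>Q. g <#\<^bsub>G\<^esub> X #>\<^bsub>G\<^esub> (inv\<^bsub>G\<^esub> g))"

definition sigma_central ::
  "nat set set \<Rightarrow> ('a, 'b) monoid_scheme \<Rightarrow> 'a set \<Rightarrow> 'a set \<Rightarrow> bool" where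
  "sigma_central \<sigma> G H K \<longleftrightarrow>
     sigma_primary \<sigma> (semidirect_product ((G\<lparr>carrier := H\<rparr>) Mod K)
       (G Mod centralizer_section G H K) (section_conj G))"

abbreviation sigma_eccentric ::
  "nat set set \<Rightarrow> ('a, 'b) monoid_scheme \<Rightarrow> 'a set \<Rightarrow> 'a set \<Rightarrow> bool" where
  "sigma_eccentric \<sigma> G H K \<equiv> \<not> sigma_central \<sigma> G H K"

definition internal_semidirect ::
  "('a, 'b) monoid_scheme \<Rightarrow> 'a set \<Rightarrow> 'a set \<Rightarrow> bool" where
  "internal_semidirect G D M \<longleftrightarrow> D \<lhd> G \<and> subgroup M G
     \<and> D <#>\<^bsub>G\<^esub> M = carrier G \<and> D \<inter> M = {\<one>\<^bsub>G\<^esub>}"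

definition conj_invariant ::
  "('a, 'b) monoid_scheme \<Rightarrow> 'a set \<Rightarrow> 'a set \<Rightarrow> bool" where
  "conj_invariant G M P \<longleftrightarrow> (\<forall>m\<in>M. m <#\<^bsub>G\<^esub> P #>\<^bsub>G\<^esub> (inv\<^bsub>G\<^esub> m) = P)"

definition acts_irreducibly ::
  "('a, 'b) monoid_scheme \<Rightarrow> 'a set \<Rightarrow> 'a set \<Rightarrow> bool" where
  "acts_irreducibly G M P \<longleftrightarrow> P \<noteq> {\<one>\<^bsub>G\<^esub>}
     \<and> (\<forall>Q. subgroup Q G \<and> Q \<subseteq> P \<and> conj_invariant G M Q \<longrightarrow> Q = {\<one>\<^bsub>G\<^esub>} \<or> Q = P)"

definition H_sigma_E_group ::
  "nat set set \<Rightarrow> ('a, 'b) monoid_scheme \<Rightarrow> 'a set \<Rightarrow> 'a set \<Rightarrow> bool" where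
  "H_sigma_E_group \<sigma> G D M \<longleftrightarrow>
     (internal_semidirect G D M
       \<and> D = sigma_nilpotent_residual \<sigma> G
       \<and> sigma_hall \<sigma> G D
       \<and> card (sigma_of \<sigma> (card D)) = card (prime_factors (card D)))
     \<and> (has_sylow_tower (G\<lparr>carrier := D\<rparr>)
       \<and> (\<forall>H K. chief_factor G H K \<and> H \<subseteq> D \<longrightarrow> sigma_eccentric \<sigma> G H K))
     \<and> (\<forall>p \<in> prime_factors (card D). \<forall>P.
          sylow_subgroup p (G\<lparr>carrier := D\<rparr>) P \<and> conj_invariant G M P
            \<longrightarrow> acts_irreducibly G M P)"

end

(*
  Write the classes as a relation on primes and call q isolated in n if q^2 does not divide n and
  q is the only prime divisor of n in its class.  Then (iii) says that G = D M with M Dedekind and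
  D cyclic, all of whose prime divisors are isolated in |G|.  Given this, every subgroup A is
  sigma-Hall in DA, which is normal because G/D is Dedekind; this is (iii) => (i).

  For (i) => (ii), the condition (i) passes to subgroups, so one can induct on |G|.  For the largest
  prime p dividing |G| a Sylow p-subgroup P is normal: in a minimal counterexample every proper
  normal subgroup is central, every Sylow subgroup outside the centre is cyclic, and the transfer
  into one of them shows that G is abelian.  Subgroups of P are then normal in G.  Either all
  p'-elements centralise P, and then G = P x X and P joins the Dedekind factor of X; or |P| = p,
  G = P X, and P joins the cyclic factor of X.  The induction also yields that no nontrivial element
  of D is centralised by M.  Hence D is generated by commutators of elements of prime order, and
  this gives both that D is the sigma-nilpotent residual and that its chief factors are
  sigma-eccentric.
*)
theory Submission
  imports
    Defs
    "HOL-Algebra.Multiplicative_Group"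
    "HOL-Algebra.Sylow"
    "HOL-Number_Theory.Residues"
begin

section \<open>Subgroups of a finite group\<close>

text \<open>All that is known of a normal subgroup N in which A is sigma-Hall is arithmetic, so the
  proof keeps choosing A such that |N : A| controls N. If A is a nontrivial subgroup of a p-group P,
  then N \<inter> P = A. Larger choices of A make |N| prime to a suitable prime, against the
  presence of a nontrivial commutator. The largest prime p is taken because it divides no
  s^(j-1)(s-1) with a prime s < p: a p-element that normalizes a cyclic s-group centralizes it. This
  is what makes the proper normal subgroups of a minimal counterexample central. A noncentral
  subgroup A of a Sylow s-subgroup S then has only the whole group as N, so A = S; hence S = <x>
  with x^s central, and the transfer into S can be evaluated directly. Later only commutators [m,x]
  with x of prime order in D have to be followed: as |D| is squarefree, a subgroup of D containing
  all its elements of prime order is D.\<close>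

locale fin_group = group +
  assumes fin: "finite (carrier G)"
begin

text \<open>Both groups are subsets of one ambient group, so chains of subgroups and inductions on
  |H| never change the operations.\<close>

definition normal_in :: "'a set \<Rightarrow> 'a set \<Rightarrow> bool" where
  "normal_in H N \<longleftrightarrow> subgroup N G \<and> N \<subseteq> H \<and> (\<forall>h\<in>H. \<forall>n\<in>N. h \<otimes> n \<otimes> inv h \<in> N)"

text \<open>Natural exponents suffice because elements have finite order; \<open>cyc_eq\<close>
  identifies this set with the subgroup generated by x.\<close>

definition cyc :: "'a \<Rightarrow> 'a set" where
  "cyc x = range (\<lambda>n::nat. x [^] n)"

lemma sub_fin: "subgroup H G \<Longrightarrow> finite H"
  using finite_subset[OF subgroup.subset fin] .

lemma sub_card_pos: "subgroup H G \<Longrightarrow> 0 < card H"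
  by (metis card_gt_0_iff empty_iff sub_fin subgroup.one_closed)

lemma card_rcosets_in:
  assumes "subgroup H G" "subgroup S G" "S \<subseteq> H"
  shows "card ((\<lambda>c. S #> c) ` H) * card S = card H"
proof -
  interpret K: group "G\<lparr>carrier := H\<rparr>" by (rule subgroup_imp_group[OF assms(1)])
  have S: "subgroup S (G\<lparr>carrier := H\<rparr>)" using assms subgroup_incl by blast
  have "rcosets\<^bsub>G\<lparr>carrier := H\<rparr>\<^esub> S = (\<lambda>c. S #> c) ` H"
    by (auto simp: RCOSETS_def r_coset_def)
  with K.lagrange[OF S] show ?thesis by (simp add: order_def)
qed

lemma sub_card_dvd:
  assumes "subgroup A G" "subgroup B G" "A \<subseteq> B"
  shows "card A dvd card B"
  using card_rcosets_in[OF assms(2,1,3)] by (metis dvd_triv_right)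

lemma idx_eq:
  assumes "subgroup H G" "subgroup S G" "S \<subseteq> H"
  shows "card ((\<lambda>c. S #> c) ` H) = card H div card S"
  using card_rcosets_in[OF assms] sub_card_pos[OF assms(2)] by (metis nonzero_mult_div_cancel_right not_gr_zero)

lemma idx_mult:
  assumes "subgroup A G" "subgroup B G" "A \<subseteq> B"
  shows "card A * (card B div card A) = card B"
  using sub_card_dvd[OF assms] by simp

text \<open>The quotient K/N has order |K : N|, and this exponent kills the coset of x.\<close>

lemma normal_in_pow_index:
  assumes "normal_in K N" "subgroup K G" "x \<in> K"
  shows "x [^] (card K div card N) \<in> N"
proof -
  interpret K: group "G\<lparr>carrier := K\<rparr>" by (rule subgroup_imp_group[OF assms(2)])
  have N: "N \<lhd> G\<lparr>carrier := K\<rparr>"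
    using assms unfolding normal_in_def K.normal_inv_iff
    by (auto simp: subgroup_incl m_inv_consistent)
  interpret N: normal N "G\<lparr>carrier := K\<rparr>" by (rule N)
  let ?Q = "(G\<lparr>carrier := K\<rparr>) Mod N"
  interpret Q: group ?Q by (rule N.factorgroup_is_group)
  have oQ: "order ?Q = card K div card N"
    using K.lagrange[of N] N.subgroup_axioms sub_card_pos[of N] assms(1)
    by (simp add: order_def FactGroup_def normal_in_def) (metis nonzero_mult_div_cancel_right not_gr_zero)
  have "(N #>\<^bsub>G\<lparr>carrier := K\<rparr>\<^esub> x) \<in> carrier ?Q"
    using assms(3) by (auto simp: FactGroup_def RCOSETS_def)
  from Q.pow_order_eq_1[OF this]
  have 1: "(N #>\<^bsub>G\<lparr>carrier := K\<rparr>\<^esub> x) [^]\<^bsub>?Q\<^esub> (card K div card N) = N"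
    by (simp add: oQ)
  interpret hom: group_hom "G\<lparr>carrier := K\<rparr>" ?Q "\<lambda>a. N #>\<^bsub>G\<lparr>carrier := K\<rparr>\<^esub> a"
    by (unfold_locales) (rule N.r_coset_hom_Mod)
  have "N #>\<^bsub>G\<lparr>carrier := K\<rparr>\<^esub> (x [^]\<^bsub>G\<lparr>carrier := K\<rparr>\<^esub> (card K div card N)) = N"
    using 1 assms(3) hom.hom_nat_pow[of x "card K div card N"] by simp
  moreover have "x [^]\<^bsub>G\<lparr>carrier := K\<rparr>\<^esub> (card K div card N) \<in> carrier (G\<lparr>carrier := K\<rparr>)"
    using K.nat_pow_closed[of x] assms(3) by simp
  ultimately have "x [^]\<^bsub>G\<lparr>carrier := K\<rparr>\<^esub> (card K div card N) \<in> N"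
    using K.rcos_self[OF _ N.subgroup_axioms] by metis
  then show ?thesis by (simp flip: nat_pow_consistent)
qed

lemma sub_nat_pow: "subgroup S G \<Longrightarrow> x \<in> S \<Longrightarrow> x [^] (n::nat) \<in> S"
  by (induction n) (auto simp: subgroup.one_closed subgroup.m_closed)

text \<open>Bezout gives m a = n b + 1, so x is x^(ma) times the inverse of x^(nb).\<close>

lemma pow_coprime_in:
  assumes S: "subgroup S G" and x: "x \<in> carrier G" and "x [^] (m::nat) \<in> S" "x [^] (n::nat) \<in> S" "coprime m n"
  shows "x \<in> S"
proof (cases "m = 0")
  case True
  then show ?thesis using assms by simp
next
  case False
  then obtain a b where ab: "m * a = n * b + 1"
    using bezout_nat[of m n] \<open>coprime m n\<close> by auto
  have "x [^] (m * a) = x [^] (n * b) \<otimes> x" unfolding ab by simp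
  moreover have "x [^] (m * a) \<in> S" "x [^] (n * b) \<in> S"
    using sub_nat_pow[OF S] assms(3,4) x by (auto simp flip: nat_pow_pow)
  ultimately show ?thesis
    by (metis S inv_solve_left nat_pow_closed subgroup.m_closed subgroup.m_inv_closed x)
qed

lemma pow_split:
  assumes x: "x \<in> carrier G" and 1: "x [^] (m * n :: nat) = \<one>" and "coprime m n" "m > 0" "n > 0"
  obtains i j :: nat where "x = x [^] i \<otimes> x [^] j" "(x [^] i) [^] m = \<one>" "(x [^] j) [^] n = \<one>"
proof -
  obtain a b where ab: "m * a = n * b + 1"
    using bezout_nat[of m n] assms by auto
  \<comment> \<open>\<open>?i\<close> stands for -n b: exponents are natural numbers, and
    \<open>m * n - 1\<close> acts as -1 because x^(mn) = 1. Thus \<open>?i + ?j\<close> is 1 modulo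
    m n.\<close>
  let ?i = "n * b * (m * n - 1)" and ?j = "m * a"
  have e: "?i + ?j = (m * n) * (n * b) + 1"
  proof -
    obtain k where "m * n = Suc k" using assms by (metis gr0_implies_Suc nat_0_less_mult_iff)
    then show ?thesis using ab by (simp add: algebra_simps)
  qed
  have "x [^] (?i + ?j) = (x [^] (m * n)) [^] (n * b) \<otimes> x"
    unfolding e using x by (simp add: nat_pow_pow)
  also have "\<dots> = x" using x 1 by simp
  finally have "x = x [^] ?i \<otimes> x [^] ?j" using x by (simp add: nat_pow_mult)
  moreover have "(x [^] ?i) [^] m = \<one>"
  proof -
    have "(x [^] ?i) [^] m = (x [^] (m * n)) [^] (b * (m * n - 1))"
      using x by (simp only: nat_pow_pow) (simp add: mult_ac)
    then show ?thesis using 1 by simp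
  qed
  moreover have "(x [^] ?j) [^] n = \<one>"
  proof -
    have "(x [^] ?j) [^] n = (x [^] (m * n)) [^] a"
      using x by (simp only: nat_pow_pow) (simp add: mult_ac)
    then show ?thesis using 1 by simp
  qed
  ultimately show ?thesis using that by blast
qed

lemma cyc_eq: "x \<in> carrier G \<Longrightarrow> cyc x = generate G {x}"
  using generate_pow_on_finite_carrier[OF fin] by (auto simp: cyc_def)

lemma cyc_subgroup: "x \<in> carrier G \<Longrightarrow> subgroup (cyc x) G"
  by (simp add: cyc_eq generate_is_subgroup)

lemma cyc_card: "x \<in> carrier G \<Longrightarrow> card (cyc x) = ord x"
  by (simp add: cyc_eq generate_pow_card)

lemma cyc_self: "x \<in> carrier G \<Longrightarrow> x \<in> cyc x"
  unfolding cyc_def by (metis nat_pow_eone rangeI)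

lemma cyc_sub: "subgroup S G \<Longrightarrow> x \<in> S \<Longrightarrow> cyc x \<subseteq> S"
  using sub_nat_pow by (auto simp: cyc_def)

lemma ord_pos: "x \<in> carrier G \<Longrightarrow> 0 < ord x"
  using ord_ge_1[OF fin] by fastforce

lemma ord_dvd_sub: "subgroup S G \<Longrightarrow> x \<in> S \<Longrightarrow> ord x dvd card S"
  by (metis cyc_card cyc_sub cyc_subgroup sub_card_dvd subgroup.mem_carrier)

lemma pow_card_sub: "subgroup S G \<Longrightarrow> x \<in> S \<Longrightarrow> x [^] card S = \<one>"
  by (metis ord_dvd_sub pow_eq_id subgroup.mem_carrier)

text \<open>If x^|S| = 1, then x^|K:S| lies in S by normality, and the two exponents are coprime.
  Describing S by orders alone makes it invariant under every conjugation that preserves K.\<close>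

lemma normal_hall_eq:
  assumes "normal_in K S" "subgroup K G" "coprime (card S) (card K div card S)"
  shows "S = {x \<in> K. x [^] card S = \<one>}"
proof -
  have S: "subgroup S G" "S \<subseteq> K" using assms by (auto simp: normal_in_def)
  have "x \<in> S" if "x \<in> K" "x [^] card S = \<one>" for x
    using pow_coprime_in[OF S(1), of x "card S" "card K div card S"] that
      normal_in_pow_index[OF assms(1,2) that(1)] assms S subgroup.one_closed[OF S(1)]
    by (metis subgroup.mem_carrier)
  then show ?thesis using pow_card_sub S by auto
qed

lemma inv_cancel:
  "\<lbrakk>a \<in> carrier G; b \<in> carrier G\<rbrakk> \<Longrightarrow> a \<otimes> (inv a \<otimes> b) = b"
  "\<lbrakk>a \<in> carrier G; b \<in> carrier G\<rbrakk> \<Longrightarrow> inv a \<otimes> (a \<otimes> b) = b"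
  by (simp_all flip: m_assoc)

lemma conj_closed: "\<lbrakk>g \<in> carrier G; x \<in> carrier G\<rbrakk> \<Longrightarrow> g \<otimes> x \<otimes> inv g \<in> carrier G" by simp

lemma conj_mult:
  "\<lbrakk>g \<in> carrier G; x \<in> carrier G; y \<in> carrier G\<rbrakk> \<Longrightarrow>
     g \<otimes> (x \<otimes> y) \<otimes> inv g = (g \<otimes> x \<otimes> inv g) \<otimes> (g \<otimes> y \<otimes> inv g)"
  by (simp add: m_assoc inv_solve_left)

lemma conj_pow:
  "\<lbrakk>g \<in> carrier G; x \<in> carrier G\<rbrakk> \<Longrightarrow> g \<otimes> x [^] (n::nat) \<otimes> inv g = (g \<otimes> x \<otimes> inv g) [^] n"
proof (induction n)
  case (Suc n)
  then show ?case by (simp add: conj_mult nat_pow_closed)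
qed simp

lemma conj_eq_iff:
  "\<lbrakk>g \<in> carrier G; x \<in> carrier G\<rbrakk> \<Longrightarrow> g \<otimes> x \<otimes> inv g = x \<longleftrightarrow> g \<otimes> x = x \<otimes> g"
  by (metis inv_solve_right m_closed)

text \<open>Conjugation by elements of H preserves K and element orders, and S is determined inside
  K by orders. This lifts normality found by induction in a smaller group.\<close>

lemma normal_in_trans_hall:
  assumes "normal_in K S" "normal_in H K" "subgroup H G" "coprime (card S) (card K div card S)"
  shows "normal_in H S"
proof -
  have K: "subgroup K G" "K \<subseteq> H" and S: "subgroup S G" "S \<subseteq> K"
    using assms by (auto simp: normal_in_def)
  note eq = normal_hall_eq[OF assms(1) K(1) assms(4)]
  have "h \<otimes> n \<otimes> inv h \<in> S" if "h \<in> H" "n \<in> S" for h n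
  proof -
    have c: "h \<in> carrier G" "n \<in> carrier G"
      using that assms(3) S by (auto dest: subgroup.mem_carrier)
    have "h \<otimes> n \<otimes> inv h \<in> K" using that assms(2) S by (auto simp: normal_in_def)
    moreover have "(h \<otimes> n \<otimes> inv h) [^] card S = \<one>"
      using c pow_card_sub[OF S(1) that(2)] by (simp flip: conj_pow)
    ultimately show ?thesis using eq by blast
  qed
  then show ?thesis using S K by (auto simp: normal_in_def)
qed

lemma sylow_exists:
  assumes "prime q" "subgroup H G"
  obtains P where "subgroup P G" "P \<subseteq> H" "card P = q ^ multiplicity q (card H)"
proof -
  interpret K: group "G\<lparr>carrier := H\<rparr>" by (rule subgroup_imp_group[OF assms(2)])
  obtain m where "card H = q ^ multiplicity q (card H) * m"
    using multiplicity_dvd[of q "card H"] by (auto elim: dvdE)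
  then obtain P where "subgroup P (G\<lparr>carrier := H\<rparr>)" "card P = q ^ multiplicity q (card H)"
    using sylow_thm[OF assms(1) K.group_axioms, of "multiplicity q (card H)" m] sub_fin[OF assms(2)]
    by (auto simp: order_def)
  then show ?thesis using that incl_subgroup[OF assms(2)] subgroup.subset by fastforce
qed

lemma ord_pow_prime:
  assumes "x \<in> carrier G" "prime q" "q dvd ord x"
  shows "ord (x [^] (ord x div q)) = q"
proof -
  have "ord x div q \<noteq> 0" using assms ord_pos[OF assms(1)] by (metis dvd_div_eq_0_iff not_gr_zero)
  moreover have "ord x div q dvd ord x" using assms by (metis dvd_div_mult_self dvd_triv_left)
  ultimately show ?thesis using ord_pow[OF assms(1)] assms ord_pos[OF assms(1)]
    by (metis dvd_div_mult_self dvd_mult_div_cancel nonzero_mult_div_cancel_left)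
qed

text \<open>A nontrivial element of a Sylow q-subgroup has q-power order, and a suitable power of it
  has order q.\<close>

lemma cauchy:
  assumes "prime q" "subgroup H G" "q dvd card H"
  obtains x where "x \<in> H" "ord x = q"
proof -
  obtain P where P: "subgroup P G" "P \<subseteq> H" "card P = q ^ multiplicity q (card H)"
    using sylow_exists[OF assms(1,2)] .
  have "multiplicity q (card H) > 0"
    using assms sub_card_pos[OF assms(2)] by (simp add: prime_multiplicity_gt_zero_iff)
  then have "card P \<noteq> 1" using P(3) assms(1) by (metis one_less_power prime_gt_1_nat less_irrefl)
  then have "P \<noteq> {\<one>}" by auto
  then obtain y where y: "y \<in> P" "y \<noteq> \<one>" using P subgroup.one_closed by blast
  have yc: "y \<in> carrier G" using y P subgroup.mem_carrier by metis
  have "ord y dvd q ^ multiplicity q (card H)" using ord_dvd_sub[OF P(1) y(1)] P(3) by simp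
  moreover have "ord y \<noteq> 1" using ord_eq_1 yc y by blast
  ultimately have "q dvd ord y"
    using assms(1) by (metis divides_primepow_nat dvd_triv_left power_Suc power_0 not0_implies_Suc)
  then have "ord (y [^] (ord y div q)) = q" using ord_pow_prime yc assms by blast
  moreover have "y [^] (ord y div q) \<in> H" using sub_nat_pow[OF P(1) y(1)] P(2) by blast
  ultimately show ?thesis using that by blast
qed

end

section \<open>Cosets and products of two subgroups\<close>

lemma card_image_same_kernel:
  assumes "\<And>x y. x \<in> B \<Longrightarrow> y \<in> B \<Longrightarrow> f x = f y \<longleftrightarrow> g x = g y"
  shows "card (f ` B) = card (g ` B)"
proof -
  let ?h = "\<lambda>c. g (inv_into B f c)"
  have 1: "?h (f x) = g x" if "x \<in> B" for x
    using assms[OF inv_into_into[of "f x" f B] that] that f_inv_into_f[of "f x" f B] by auto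
  have "?h ` f ` B = g ` B" using 1 by (auto simp: image_iff)
  moreover have "inj_on ?h (f ` B)" using 1 assms by (auto simp: inj_on_def)
  ultimately show ?thesis using card_image by metis
qed

context fin_group
begin

lemma rcos_eq_iff:
  assumes "subgroup S G" "c \<in> carrier G" "d \<in> carrier G"
  shows "S #> c = S #> d \<longleftrightarrow> c \<otimes> inv d \<in> S"
proof
  assume "S #> c = S #> d"
  then have "c \<in> S #> d" using rcos_self[OF assms(2,1)] by simp
  then show "c \<otimes> inv d \<in> S"
    using assms by (auto simp: r_coset_def m_assoc dest: subgroup.mem_carrier)
next
  assume "c \<otimes> inv d \<in> S"
  then have "c \<in> S #> d"
    using assms by (auto simp: r_coset_def m_assoc intro!: bexI[of _ "c \<otimes> inv d"])
  then show "S #> c = S #> d" using repr_independence assms by metis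
qed

lemma join_subgroup:
  assumes A: "subgroup A G" and B: "subgroup B G"
    and n: "\<And>a b. a \<in> A \<Longrightarrow> b \<in> B \<Longrightarrow> b \<otimes> a \<otimes> inv b \<in> A"
  shows "subgroup (A <#> B) G"
proof (rule subgroupI)
  note m = subgroup.mem_carrier[OF A] subgroup.mem_carrier[OF B]
  show "A <#> B \<subseteq> carrier G" using m by (auto simp: set_mult_def)
  show "A <#> B \<noteq> {}" using subgroup.one_closed[OF A] subgroup.one_closed[OF B] by (auto simp: set_mult_def)
  show "inv x \<in> A <#> B" if x: "x \<in> A <#> B" for x
  proof -
    obtain a b where ab: "x = a \<otimes> b" "a \<in> A" "b \<in> B" using x by (auto simp: set_mult_def)
    have "inv x = (inv b \<otimes> inv a \<otimes> inv (inv b)) \<otimes> inv b"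
      using ab m by (simp add: m_assoc inv_mult_group)
    then show ?thesis using n[of "inv a" "inv b"] ab subgroup.m_inv_closed[OF A] subgroup.m_inv_closed[OF B]
      by (auto simp: set_mult_def)
  qed
  show "x \<otimes> y \<in> A <#> B" if x: "x \<in> A <#> B" and y: "y \<in> A <#> B" for x y
  proof -
    obtain a b where ab: "x = a \<otimes> b" "a \<in> A" "b \<in> B" using x by (auto simp: set_mult_def)
    obtain c d where cd: "y = c \<otimes> d" "c \<in> A" "d \<in> B" using y by (auto simp: set_mult_def)
    have "x \<otimes> y = (a \<otimes> (b \<otimes> c \<otimes> inv b)) \<otimes> (b \<otimes> d)"
      using ab cd m by (simp add: m_assoc inv_cancel)
    moreover have "a \<otimes> (b \<otimes> c \<otimes> inv b) \<in> A" "b \<otimes> d \<in> B"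
      using n[OF cd(2) ab(3)] ab cd subgroup.m_closed[OF A] subgroup.m_closed[OF B] by auto
    ultimately show ?thesis unfolding set_mult_def by blast
  qed
qed

lemma join_sup:
  assumes A: "subgroup A G" and B: "subgroup B G"
  shows "A \<subseteq> A <#> B" "B \<subseteq> A <#> B"
proof -
  note m = subgroup.mem_carrier[OF A] subgroup.mem_carrier[OF B]
  show "A \<subseteq> A <#> B"
    using subgroup.one_closed[OF B] m by (force simp: set_mult_def)
  show "B \<subseteq> A <#> B"
    using subgroup.one_closed[OF A] m by (force simp: set_mult_def)
qed

lemma join_sub:
  assumes "subgroup H G" "A \<subseteq> H" "B \<subseteq> H"
  shows "A <#> B \<subseteq> H"
  using assms subgroup.m_closed[OF assms(1)] by (auto simp: set_mult_def)

text \<open>Cosets of A in AB have representatives in B, and two elements of B share a coset of A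
  exactly when they share a coset of A \<inter> B; Lagrange is then applied twice.\<close>

lemma join_card:
  assumes A: "subgroup A G" and B: "subgroup B G" and AB: "subgroup (A <#> B) G"
  shows "card (A <#> B) * card (A \<inter> B) = card A * card B"
proof -
  note m = subgroup.mem_carrier[OF A] subgroup.mem_carrier[OF B]
  have I: "subgroup (A \<inter> B) G" using subgroups_Inter_pair A B by blast
  have "(\<lambda>c. A #> c) ` (A <#> B) = (\<lambda>c. A #> c) ` B"
  proof
    show "(\<lambda>c. A #> c) ` B \<subseteq> (\<lambda>c. A #> c) ` (A <#> B)"
      using join_sup[OF A B] by blast
    have "A #> (a \<otimes> b) = A #> b" if "a \<in> A" "b \<in> B" for a b
      using that m by (simp add: rcos_eq_iff[OF A] m_assoc)
    then show "(\<lambda>c. A #> c) ` (A <#> B) \<subseteq> (\<lambda>c. A #> c) ` B"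
      by (auto simp: set_mult_def)
  qed
  then have 1: "card ((\<lambda>c. A #> c) ` B) * card A = card (A <#> B)"
    using card_rcosets_in[OF AB A] join_sup[OF A B] by simp
  have "card ((\<lambda>c. A #> c) ` B) = card ((\<lambda>c. (A \<inter> B) #> c) ` B)"
    by (rule card_image_same_kernel)
       (auto simp: m rcos_eq_iff[OF A] rcos_eq_iff[OF I] subgroup.m_closed[OF B] subgroup.m_inv_closed[OF B])
  then have "card ((\<lambda>c. A #> c) ` B) * card (A \<inter> B) = card B"
    using card_rcosets_in[OF B I] by simp
  then show ?thesis using 1 by (metis mult.assoc mult.commute)
qed

end

section \<open>Products over the cosets of an abelian subgroup\<close>

locale abelian_transversal = fin_group +
  fixes H S
  assumes H: "subgroup H G" and S: "subgroup S G" and SH: "S \<subseteq> H"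
    and abelian: "\<And>x y. x \<in> S \<Longrightarrow> y \<in> S \<Longrightarrow> x \<otimes> y = y \<otimes> x"
begin

abbreviation Q where "Q \<equiv> (\<lambda>c. S #> c) ` H"
text \<open>Since S is abelian, \<open>A\<close> is a commutative group and \<open>finprod\<close>
  over the cosets is independent of their order. Both the crossed homomorphism and the transfer are
  such products.\<close>

abbreviation A where "A \<equiv> G\<lparr>carrier := S\<rparr>"

definition t where "t C = (SOME c. c \<in> H \<and> C = S #> c)"

lemma A_comm: "comm_group A"
  using abelian subgroup_imp_group[OF S] by (intro group.group_comm_groupI) auto

sublocale A: comm_group A by (rule A_comm)

lemma t_mem: "C \<in> Q \<Longrightarrow> t C \<in> H \<and> S #> t C = C"
  unfolding t_def by (rule someI2_ex) auto

lemma t_carr [simp]: "C \<in> Q \<Longrightarrow> t C \<in> carrier G"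
  using t_mem subgroup.mem_carrier[OF H] by blast

lemma Q_shift: "C \<in> Q \<Longrightarrow> h \<in> H \<Longrightarrow> C #> h \<in> Q"
  using subgroup.m_closed[OF H] subgroup.mem_carrier[OF H] subgroup.subset[OF S]
  by (auto simp: coset_mult_assoc)

lemma Q_assoc: "C \<in> Q \<Longrightarrow> g \<in> H \<Longrightarrow> h \<in> H \<Longrightarrow> (C #> g) #> h = C #> (g \<otimes> h)"
  using subgroup.m_closed[OF H] subgroup.mem_carrier[OF H] subgroup.subset[OF S]
  by (auto simp: coset_mult_assoc m_assoc)

lemma Q_one: "C \<in> Q \<Longrightarrow> C #> \<one> = C"
  using subgroup.mem_carrier[OF H] subgroup.subset[OF S] by (auto simp: coset_mult_assoc)

lemma Q_fin: "finite Q" using sub_fin[OF H] by simp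

lemma Q_card: "card Q = card H div card S" by (rule idx_eq[OF H S SH])

lemma t_shift: "C \<in> Q \<Longrightarrow> g \<in> H \<Longrightarrow> t C \<otimes> g \<otimes> inv (t (C #> g)) \<in> S"
  using t_mem[of C] t_mem[OF Q_shift, of C g] subgroup.mem_carrier[OF H] subgroup.subset[OF S]
  by (simp add: flip: rcos_eq_iff[OF S] coset_mult_assoc)

lemma Q_bij: "h \<in> H \<Longrightarrow> bij_betw (\<lambda>C. C #> h) Q Q"
  by (rule bij_betwI[of _ _ _ "\<lambda>C. C #> inv h"])
     (use subgroup.m_inv_closed[OF H] subgroup.mem_carrier[OF H] in \<open>auto simp: Q_shift Q_assoc Q_one simp del: image_iff\<close>)

text \<open>Right translation by h permutes the cosets. This reindexing is what makes the transfer
  multiplicative, and \<open>crossed\<close> multiplicative up to conjugation.\<close>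

lemma finprod_shift:
  assumes "h \<in> H" "f \<in> Q \<rightarrow> S"
  shows "finprod A (\<lambda>C. f (C #> h)) Q = finprod A f Q"
  using A.finprod_reindex[of f "\<lambda>C. C #> h" Q] Q_bij[OF assms(1)] assms(2)
  by (auto simp: bij_betw_def)

section \<open>Schur--Zassenhaus and transfer\<close>

lemma S_pow [simp]: "x [^]\<^bsub>A\<^esub> (n::nat) = x [^] n"
  by (simp flip: nat_pow_consistent)

lemma S_carr: "x \<in> S \<Longrightarrow> x \<in> carrier G" using subgroup.mem_carrier[OF S] .
lemma H_carr: "x \<in> H \<Longrightarrow> x \<in> carrier G" using subgroup.mem_carrier[OF H] .

lemma finprod_mult:
  "f \<in> B \<rightarrow> S \<Longrightarrow> g \<in> B \<rightarrow> S \<Longrightarrow>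
     finprod A (\<lambda>C. f C \<otimes> g C) B = finprod A f B \<otimes> finprod A g B"
  using A.finprod_multf[of f B g] by simp

lemma finprod_S: "f \<in> B \<rightarrow> S \<Longrightarrow> finprod A f B \<in> S"
  using A.finprod_closed[of f B] by simp

text \<open>With n u = |S| v + 1 the root is a^u, since a^|S| = 1. For n = 0 coprimality forces S to
  be trivial.\<close>

lemma coprime_power_root:
  assumes "coprime n (card S)" "a \<in> S"
  obtains r where "r \<in> S" "r [^] (n::nat) = a"
proof (cases "n = 0")
  case True
  then have "card S = 1" using assms by simp
  then show ?thesis using that[of a] assms True subgroup.one_closed[OF S]
    by (metis card_1_singletonE nat_pow_0 singletonD)
next
  case False
  then obtain u v where uv: "n * u = card S * v + 1"
    using bezout_nat[of n "card S"] assms by auto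
  have c: "a \<in> carrier G" using S_carr assms by simp
  have "(a [^] u) [^] n = a [^] (card S * v + 1)"
    unfolding nat_pow_pow[OF c] mult.commute[of u n] uv ..
  also have "\<dots> = (a [^] card S) [^] v \<otimes> a" using c by (simp only: nat_pow_pow) simp
  also have "\<dots> = a" using pow_card_sub[OF S assms(2)] c by simp
  finally show ?thesis using that sub_nat_pow[OF S assms(2)] by blast
qed

lemma coprime_power_trivial:
  assumes "coprime n (card S)" "a \<in> S" "a [^] (n::nat) = \<one>"
  shows "a = \<one>"
proof -
  have "a \<in> {\<one>}"
    using pow_coprime_in[OF triv_subgroup, of a n "card S"] assms S_carr pow_card_sub[OF S assms(2)] by simp
  then show ?thesis by simp
qed

text \<open>
  Schur--Zassenhaus for an abelian normal Hall subgroup: \<open>crossed\<close> is a crossed homomorphism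
  that restricts to a power map on \<open>S\<close>, and the complement is its kernel.
\<close>

definition crossed where
  "crossed g = finprod A (\<lambda>C. inv (t (C #> g)) \<otimes> t C \<otimes> g) Q"

lemma finprod_conj:
  assumes n: "\<And>h s. h \<in> H \<Longrightarrow> s \<in> S \<Longrightarrow> h \<otimes> s \<otimes> inv h \<in> S"
    and h: "h \<in> H" and "f \<in> B \<rightarrow> S"
  shows "finprod A (\<lambda>C. h \<otimes> f C \<otimes> inv h) B = h \<otimes> finprod A f B \<otimes> inv h"
  using assms(3)
proof (induction B rule: infinite_finite_induct)
  case (infinite B)
  then show ?case using H_carr h by simp
next
  case empty
  then show ?case using H_carr h by simp
next
  case (insert b B)
  then have "f \<in> B \<rightarrow> S" "f b \<in> S" by auto
  moreover from this have "finprod A f B \<in> S" using A.finprod_closed[of f B] by simp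
  ultimately show ?case using insert n h S_carr H_carr
    by (simp add: Pi_def conj_mult)
qed

lemma crossed_closed:
  assumes n: "\<And>h s. h \<in> H \<Longrightarrow> s \<in> S \<Longrightarrow> h \<otimes> s \<otimes> inv h \<in> S"
    and "C \<in> Q" "g \<in> H"
  shows "inv (t (C #> g)) \<otimes> t C \<otimes> g \<in> S"
proof -
  let ?u = "t (C #> g)"
  have u: "?u \<in> H" "inv ?u \<in> H" using t_mem[OF Q_shift[OF assms(2,3)]] subgroup.m_inv_closed[OF H] by auto
  have "inv ?u \<otimes> (t C \<otimes> g \<otimes> inv ?u) \<otimes> inv (inv ?u) \<in> S"
    using n[OF u(2) t_shift[OF assms(2,3)]] .
  then show ?thesis using u H_carr assms by (simp add: m_assoc)
qed

text \<open>Factor by factor, t(Cgh)^-1 t(C) g h is the product of t(Cgh)^-1 t(Cg) h and the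
  conjugate by h^-1 of t(Cg)^-1 t(C) g; the factors of the first kind are reindexed along C ->
  Cg.\<close>

lemma crossed_mult:
  assumes n: "\<And>h s. h \<in> H \<Longrightarrow> s \<in> S \<Longrightarrow> h \<otimes> s \<otimes> inv h \<in> S"
    and g: "g \<in> H" and h: "h \<in> H"
  shows "crossed (g \<otimes> h) = crossed h \<otimes> (inv h \<otimes> crossed g \<otimes> h)"
proof -
  have ih: "inv h \<in> H" using h subgroup.m_inv_closed[OF H] by auto
  let ?e = "\<lambda>C g. inv (t (C #> g)) \<otimes> t C \<otimes> g"
  have "crossed (g \<otimes> h) = finprod A (\<lambda>C. ?e (C #> g) h \<otimes> (inv h \<otimes> ?e C g \<otimes> inv (inv h))) Q"
    unfolding crossed_def
  proof (rule A.finprod_cong')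
    fix C assume C: "C \<in> Q"
    have "t (C #> g) \<in> carrier G" "t (C #> (g \<otimes> h)) \<in> carrier G" "t C \<in> carrier G"
      using C g h t_carr Q_shift subgroup.m_closed[OF H] by metis+
    then show "?e C (g \<otimes> h) = ?e (C #> g) h \<otimes> (inv h \<otimes> ?e C g \<otimes> inv (inv h))"
      using C g h H_carr by (simp add: Q_assoc m_assoc inv_cancel)
  next
    show "(\<lambda>C. ?e (C #> g) h \<otimes> (inv h \<otimes> ?e C g \<otimes> inv (inv h))) \<in> Q \<rightarrow> carrier A"
      using crossed_closed[OF n] Q_shift g h n[OF ih] subgroup.m_closed[OF S] by auto
  qed simp
  also have "\<dots> = finprod A (\<lambda>C. ?e (C #> g) h) Q \<otimes> finprod A (\<lambda>C. inv h \<otimes> ?e C g \<otimes> inv (inv h)) Q"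
    using crossed_closed[OF n] Q_shift g h n[OF ih]
    by (intro finprod_mult) auto
  also have "finprod A (\<lambda>C. ?e (C #> g) h) Q = crossed h"
    unfolding crossed_def using finprod_shift[OF g, of "\<lambda>C. ?e C h"] crossed_closed[OF n] h by auto
  also have "finprod A (\<lambda>C. inv h \<otimes> ?e C g \<otimes> inv (inv h)) Q = inv h \<otimes> crossed g \<otimes> inv (inv h)"
    unfolding crossed_def using finprod_conj[OF n ih, of "\<lambda>C. ?e C g" Q] crossed_closed[OF n] g by auto
  finally show ?thesis using H_carr h by simp
qed

lemma Q_fix: "C \<in> Q \<Longrightarrow> g \<in> H \<Longrightarrow> C #> g = C \<longleftrightarrow> t C \<otimes> g \<otimes> inv (t C) \<in> S"
  using t_mem[of C] H_carr subgroup.subset[OF S] rcos_eq_iff[OF S, of "t C \<otimes> g" "t C"]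
  by (simp flip: coset_mult_assoc)

text \<open>S is normalized by H, so r in S fixes every coset and each factor reduces to r.\<close>

lemma crossed_pow:
  assumes n: "\<And>h s. h \<in> H \<Longrightarrow> s \<in> S \<Longrightarrow> h \<otimes> s \<otimes> inv h \<in> S" and r: "r \<in> S"
  shows "crossed r = r [^] card Q"
proof -
  have "crossed r = finprod A (\<lambda>C. r) Q"
    unfolding crossed_def
  proof (rule A.finprod_cong')
    fix C assume C: "C \<in> Q"
    then have "C #> r = C" using Q_fix[of C r] n[of "t C" r] t_mem[of C] r SH by auto
    then show "inv (t (C #> r)) \<otimes> t C \<otimes> r = r" using C r S_carr by simp
  qed (use r in auto)
  also have "\<dots> = r [^] card Q" using A.finprod_const[of r Q] r by simp
  finally show ?thesis .
qed

lemma schur_zassenhaus: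
  assumes n: "\<And>h s. h \<in> H \<Longrightarrow> s \<in> S \<Longrightarrow> h \<otimes> s \<otimes> inv h \<in> S"
    and cop: "coprime (card S) (card H div card S)"
  shows "\<exists>X. subgroup X G \<and> X \<subseteq> H \<and> S \<inter> X = {\<one>} \<and> S <#> X = H"
proof -
  have cQ: "coprime (card Q) (card S)" using cop Q_card by (simp add: coprime_commute)
  let ?X = "{g \<in> H. crossed g = \<one>}"
  have szS: "crossed g \<in> S" if "g \<in> H" for g
    unfolding crossed_def using A.finprod_closed[of "\<lambda>C. inv (t (C #> g)) \<otimes> t C \<otimes> g" Q] crossed_closed[OF n _ that] by auto
  have X: "subgroup ?X G"
  proof (rule subgroupI)
    show "?X \<subseteq> carrier G" using H_carr by auto
    have "crossed \<one> = \<one>" using crossed_pow[OF n subgroup.one_closed[OF S]] by simp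
    then have one: "\<one> \<in> ?X" using subgroup.one_closed[OF H] by simp
    then show "?X \<noteq> {}" by blast
    show "a \<otimes> b \<in> ?X" if "a \<in> ?X" "b \<in> ?X" for a b
      using that crossed_mult[OF n, of a b] subgroup.m_closed[OF H] H_carr by auto
    show "inv a \<in> ?X" if a: "a \<in> ?X" for a
    proof -
      have ia: "inv a \<in> H" using a subgroup.m_inv_closed[OF H] by auto
      have "crossed (a \<otimes> inv a) = crossed (inv a) \<otimes> (a \<otimes> crossed a \<otimes> inv a)"
        using crossed_mult[OF n, of a "inv a"] a ia H_carr by simp
      then have "\<one> = crossed (inv a)" using a H_carr one szS[OF ia] S_carr by (simp add: r_inv)
      then show ?thesis using ia by simp
    qed
  qed
  have "S \<inter> ?X = {\<one>}"
    using coprime_power_trivial[OF cQ] crossed_pow[OF n] subgroup.one_closed[OF X] subgroup.one_closed[OF S] by auto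
  moreover have "H \<subseteq> S <#> ?X"
  proof
    fix g assume g: "g \<in> H"
    define h where "h = inv g"
    have h: "h \<in> H" using g h_def subgroup.m_inv_closed[OF H] by simp
    \<comment> \<open>As \<open>crossed r = r [^] card Q\<close>, this r cancels the value at h, so
      \<open>h \<otimes> r\<close> lies in the kernel. Starting from \<open>h = inv g\<close> puts
      the element of S on the left in the factorization of g.\<close>
    obtain r where r: "r \<in> S" "r [^] card Q = inv (crossed h)"
      using coprime_power_root[OF cQ, of "inv (crossed h)"] szS[OF h] subgroup.m_inv_closed[OF S] by blast
    have "inv r \<otimes> crossed h \<otimes> r = crossed h"
      using abelian[OF szS[OF h] r(1)] S_carr szS[OF h] r by (simp add: m_assoc inv_cancel)
    then have "crossed (h \<otimes> r) = \<one>"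
      using crossed_mult[OF n h, of r] crossed_pow[OF n r(1)] r SH szS[OF h] S_carr by auto
    then have "h \<otimes> r \<in> ?X" using h r SH subgroup.m_closed[OF H] by auto
    then have "inv (h \<otimes> r) \<in> ?X" by (rule subgroup.m_inv_closed[OF X])
    moreover have "g = r \<otimes> inv (h \<otimes> r)"
      using g r H_carr S_carr by (simp add: h_def inv_mult_group inv_cancel)
    ultimately show "g \<in> S <#> ?X" using r unfolding set_mult_def by blast
  qed
  moreover have "S <#> ?X \<subseteq> H" using join_sub[OF H SH, of ?X] by auto
  ultimately show ?thesis using X by blast
qed

section \<open>The transfer into an abelian subgroup\<close>

definition transfer where
  "transfer g = finprod A (\<lambda>C. t C \<otimes> g \<otimes> inv (t (C #> g))) Q"

lemma transfer_closed: "g \<in> H \<Longrightarrow> transfer g \<in> S"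
  unfolding transfer_def using A.finprod_closed[of "\<lambda>C. t C \<otimes> g \<otimes> inv (t (C #> g))" Q] t_shift by auto

text \<open>Inserting t(Cg)^-1 t(Cg) splits the factor of g h at C into the factor of g at C and the
  factor of h at Cg; the latter are reindexed.\<close>

lemma transfer_mult:
  assumes g: "g \<in> H" and h: "h \<in> H"
  shows "transfer (g \<otimes> h) = transfer g \<otimes> transfer h"
proof -
  let ?e = "\<lambda>C g. t C \<otimes> g \<otimes> inv (t (C #> g))"
  have "transfer (g \<otimes> h) = finprod A (\<lambda>C. ?e C g \<otimes> ?e (C #> g) h) Q"
    unfolding transfer_def
  proof (rule A.finprod_cong')
    fix C assume C: "C \<in> Q"
    have "t (C #> g) \<in> carrier G" "t (C #> (g \<otimes> h)) \<in> carrier G" "t C \<in> carrier G"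
      using C g h t_carr Q_shift subgroup.m_closed[OF H] by metis+
    then show "?e C (g \<otimes> h) = ?e C g \<otimes> ?e (C #> g) h"
      using C g h H_carr by (simp add: Q_assoc m_assoc inv_cancel)
  next
    show "(\<lambda>C. ?e C g \<otimes> ?e (C #> g) h) \<in> Q \<rightarrow> carrier A"
      using t_shift Q_shift g h subgroup.m_closed[OF S] by auto
  qed simp
  also have "\<dots> = finprod A (\<lambda>C. ?e C g) Q \<otimes> finprod A (\<lambda>C. ?e (C #> g) h) Q"
    using t_shift Q_shift g h by (intro finprod_mult) auto
  also have "finprod A (\<lambda>C. ?e (C #> g) h) Q = transfer h"
    unfolding transfer_def using finprod_shift[OF g, of "\<lambda>C. ?e C h"] t_shift h by auto
  finally show ?thesis by (simp add: transfer_def)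
qed

lemma transfer_pow:
  assumes "g \<in> H"
  shows "transfer (g [^] (n::nat)) = transfer g [^] n"
proof (induction n)
  case 0
  have "transfer \<one> \<otimes> transfer \<one> = transfer \<one>"
    using transfer_mult[of \<one> \<one>] subgroup.one_closed[OF H] by simp
  then show ?case using transfer_closed[of \<one>] subgroup.one_closed[OF H] S_carr by simp
next
  case (Suc n)
  then show ?case using transfer_mult[of "g [^] n" g] sub_nat_pow[OF H] assms by simp
qed

text \<open>Consecutive factors along C, Cx, Cx^2, ... cancel at the representatives. The product
  runs over exponents, so the identity holds before the cosets are known to be distinct.\<close>

lemma orbit_telescope:
  assumes C: "C \<in> Q" and x: "x \<in> H"
  shows "finprod A (\<lambda>i. t (C #> x [^] i) \<otimes> x \<otimes> inv (t (C #> x [^] i #> x))) {..<n::nat}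
    = t C \<otimes> x [^] n \<otimes> inv (t (C #> x [^] n))"
proof (induction n)
  case 0
  then show ?case using C t_carr[OF C] by (simp add: Q_one)
next
  case (Suc n)
  have p: "x [^] i \<in> H" for i :: nat using sub_nat_pow[OF H x] .
  have q: "C #> x [^] i \<in> Q" for i :: nat using Q_shift[OF C p] .
  have eq: "C #> x [^] i #> x = C #> x [^] Suc i" for i :: nat
    using Q_assoc[OF C p x] by simp
  have m: "(\<lambda>i. t (C #> x [^] i) \<otimes> x \<otimes> inv (t (C #> x [^] i #> x))) \<in> B \<rightarrow> S" for B :: "nat set"
    using t_shift[OF q x] by auto
  have "finprod A (\<lambda>i. t (C #> x [^] i) \<otimes> x \<otimes> inv (t (C #> x [^] i #> x))) {..<Suc n}
    = (t (C #> x [^] n) \<otimes> x \<otimes> inv (t (C #> x [^] n #> x)))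
      \<otimes> finprod A (\<lambda>i. t (C #> x [^] i) \<otimes> x \<otimes> inv (t (C #> x [^] i #> x))) {..<n}"
    using A.finprod_insert[of "{..<n}" n "\<lambda>i. t (C #> x [^] i) \<otimes> x \<otimes> inv (t (C #> x [^] i #> x))"]
      m[of "{..<n}"] t_shift[OF q x] by (simp add: lessThan_Suc)
  \<comment> \<open>The recursion of \<open>finprod\<close> puts the newest factor first;
    commutativity of S moves it to the end, where it cancels.\<close>
  also have "\<dots> = finprod A (\<lambda>i. t (C #> x [^] i) \<otimes> x \<otimes> inv (t (C #> x [^] i #> x))) {..<n}
      \<otimes> (t (C #> x [^] n) \<otimes> x \<otimes> inv (t (C #> x [^] n #> x)))"
    using abelian[OF t_shift[OF q x]] finprod_S[OF m] by simp
  also have "\<dots> = (t C \<otimes> x [^] n \<otimes> inv (t (C #> x [^] n))) \<otimes> (t (C #> x [^] n) \<otimes> x \<otimes> inv (t (C #> x [^] Suc n)))"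
    by (simp only: Suc flip: eq)
  also have "\<dots> = t C \<otimes> x [^] Suc n \<otimes> inv (t (C #> x [^] Suc n))"
    using t_carr[OF C] t_carr[OF q[of n]] t_carr[OF q[of "Suc n"]] H_carr[OF x]
    by (simp add: m_assoc inv_cancel del: t_carr)
  finally show ?case .
qed

text \<open>
  The transfer of \<open>x \<in> S\<close> is a product over the orbits of \<open>x\<close> on the cosets. As \<open>x\<^sup>s\<close> is central,
  the orbits have length 1 or \<open>s\<close>, and an orbit of length \<open>l\<close> contributes \<open>x\<^sup>l\<close>.
\<close>

lemma transfer_prime_power_central:
  fixes s :: nat
  assumes x: "x \<in> S" and s: "prime s"
    and cen: "\<And>h. h \<in> H \<Longrightarrow> h \<otimes> x [^] s = x [^] s \<otimes> h"
    and nor: "\<And>h. h \<in> H \<Longrightarrow> h \<otimes> x \<otimes> inv h \<in> S \<Longrightarrow> h \<otimes> x = x \<otimes> h"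
  shows "transfer x = x [^] card Q"
proof -
  have xH: "x \<in> H" using x SH by blast
  have xc: "x \<in> carrier G" using S_carr x .
  have p: "x [^] i \<in> H" for i :: nat using sub_nat_pow[OF H xH] .
  let ?e = "\<lambda>C. t C \<otimes> x \<otimes> inv (t (C #> x))"
  have per: "C #> x [^] s = C" if "C \<in> Q" for C
  proof -
    have "t C \<otimes> x [^] s \<otimes> inv (t C) = x [^] s"
      using cen[of "t C"] t_mem[OF that] H_carr[of "t C"] xc conj_eq_iff[of "t C" "x [^] s"] by simp
    then show ?thesis using Q_fix[OF that p] sub_nat_pow[OF S x] by simp
  qed
  have eq: "C #> x [^] i #> x = C #> x [^] Suc i" if "C \<in> Q" for i :: nat and C
    using Q_assoc[OF that p xH] by simp
  have inj: "C = C'" if "C \<in> Q" "C' \<in> Q" "C #> x = C' #> x" for C C'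
    using Q_bij[OF xH] that by (auto simp: bij_betw_def inj_on_def)
  \<comment> \<open>Stated for every set of cosets stable under translation by x, so that one orbit
    at a time can be removed.\<close>
  have claim: "finprod A ?e F = x [^] card F" if "F \<subseteq> Q" "\<forall>C\<in>F. C #> x \<in> F" for F
    using that
  proof (induction "card F" arbitrary: F rule: less_induct)
    case less
    have fF: "finite F" using less.prems Q_fin finite_subset by blast
    show ?case
    proof (cases "F = {}")
      case False
      then obtain C where C: "C \<in> F" by blast
      then have CQ: "C \<in> Q" using less.prems by blast
      have iF: "C #> x [^] i \<in> F" for i :: nat
        by (induction i) (use C Q_one[OF CQ] eq[OF CQ] less.prems in \<open>auto simp del: nat_pow_Suc simp flip: eq[OF CQ]\<close>)
      \<comment> \<open>P is the orbit of C. The last property, closure under predecessors, keeps F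
        - P stable under translation.\<close>
      obtain P where P: "P \<subseteq> F" "C \<in> P" "finprod A ?e P = x [^] card P"
        "\<And>D. D \<in> Q \<Longrightarrow> D #> x \<in> P \<Longrightarrow> D \<in> P"
      proof (cases "C #> x = C")
        case True
        have "C \<in> Q \<Longrightarrow> t C \<otimes> x = x \<otimes> t C"
          using nor[of "t C"] Q_fix[OF CQ xH] True t_mem[OF CQ] by blast
        then have "?e C = x" unfolding True using CQ xc by (simp add: m_assoc)
        then have "finprod A ?e {C} = x [^] card {C}"
          using A.finprod_insert[of "{}" C ?e] x xc by simp
        moreover have "D \<in> {C}" if "D \<in> Q" "D #> x \<in> {C}" for D
          using inj[OF that(1) CQ] that True by simp
        ultimately show ?thesis using that[of "{C}"] C by blast
      next
        case False
        let ?o = "\<lambda>i::nat. C #> x [^] i"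
        have c: "t C \<in> carrier G" using CQ by simp
        \<comment> \<open>A period k strictly between 0 and s is coprime to s; as x^s also fixes C,
          Bezout would make x itself fix C.\<close>
        have nfix: "?o k \<noteq> C" if k: "0 < k" "k < s" for k
        proof
          assume "?o k = C"
          then have "(t C \<otimes> x \<otimes> inv t C) [^] k \<in> S"
            using Q_fix[OF CQ p] c xc by (simp add: conj_pow)
          moreover have "(t C \<otimes> x \<otimes> inv t C) [^] s \<in> S"
            using Q_fix[OF CQ p] per[OF CQ] c xc by (simp flip: conj_pow)
          moreover have "coprime k s"
            using k s by (metis coprime_commute nat_dvd_not_less prime_imp_coprime)
          ultimately have "t C \<otimes> x \<otimes> inv t C \<in> S"
            using pow_coprime_in[OF S] c xc by blast
          then show False using False Q_fix[OF CQ xH] by simp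
        qed
        have io: "inj_on ?o {..<s}"
        proof (rule linorder_inj_onI)
          fix i j assume ij: "i < j" "i \<in> {..<s}" "j \<in> {..<s}"
          show "?o i \<noteq> ?o j"
          proof
            assume a: "?o i = ?o j"
            \<comment> \<open>Shifting a coincidence at i and j by s - j turns it into the period s
              - (j - i) of C.\<close>
            have "?o (i + k) = ?o (j + k)" for k
            proof (induction k)
              case (Suc k)
              have "?o (m + Suc k) = ?o (m + k) #> x" for m by (simp only: add_Suc_right eq[OF CQ])
              then show ?case using Suc by simp
            qed (use a in simp)
            from this[of "s - j"] ij have "?o (s - (j - i)) = ?o s"
              by (simp add: algebra_simps)
            moreover have "0 < s - (j - i)" "s - (j - i) < s" using ij by auto
            ultimately show False using nfix[of "s - (j - i)"] per[OF CQ] by metis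
          qed
        qed auto
        let ?O = "?o ` {..<s}"
        have m: "?e (?o i) \<in> S" for i using t_shift[OF Q_shift[OF CQ p] xH] .
        have "finprod A ?e ?O = finprod A (\<lambda>i. ?e (?o i)) {..<s}"
          using A.finprod_reindex[OF _ io, of ?e] m by auto
        also have "\<dots> = x [^] s"
          unfolding orbit_telescope[OF CQ xH] per[OF CQ]
          using cen[of "t C"] t_mem[OF CQ] c xc by (simp add: m_assoc)
        finally have "finprod A ?e ?O = x [^] card ?O" using card_image[OF io] by simp
        moreover have "D \<in> ?O" if D: "D \<in> Q" "D #> x \<in> ?O" for D
        proof -
          obtain i where i: "i < s" "D #> x = ?o i" using D by auto
          show ?thesis
          proof (cases i)
            case 0
            then have "D #> x = ?o (s - 1) #> x"
              using i per[OF CQ] eq[OF CQ, of "s - 1"] prime_gt_0_nat[OF s] Q_one[OF CQ] by simp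
            then have "D = ?o (s - 1)" using inj[OF D(1) Q_shift[OF CQ p]] by blast
            then show ?thesis using prime_gt_0_nat[OF s] by auto
          next
            case (Suc k)
            then have "D #> x = ?o k #> x" using i eq[OF CQ, of k] by simp
            then have "D = ?o k" using inj[OF D(1) Q_shift[OF CQ p]] by blast
            then show ?thesis using i Suc by auto
          qed
        qed
        moreover have "C \<in> ?O" by (rule image_eqI[of _ _ 0]) (use prime_gt_0_nat[OF s] Q_one[OF CQ] in auto)
        ultimately show ?thesis using that[of ?O] iF by blast
      qed
      have fO: "finite P" using P fF finite_subset by blast
      have "card (F - P) < card F" using P(2) C fF by (intro psubset_card_mono) auto
      moreover have "\<forall>D\<in>F - P. D #> x \<in> F - P" using P(4) less.prems by blast
      ultimately have "finprod A ?e (F - P) = x [^] card (F - P)"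
        using less.hyps less.prems by blast
      moreover have "finprod A ?e ((F - P) \<union> P) = finprod A ?e (F - P) \<otimes>\<^bsub>A\<^esub> finprod A ?e P"
        using less.prems P(1) t_shift xH fF fO by (intro A.finprod_Un_disjoint) auto
      moreover have "card F = card (F - P) + card P"
        using P(1) fF fO by (metis card_Diff_subset card_mono le_add_diff_inverse2)
      ultimately show ?thesis using P(1,3) xc by (simp add: Un_absorb2 nat_pow_mult)
    qed simp
  qed
  show ?thesis unfolding transfer_def using Q_shift[OF _ xH] by (intro claim ballI) auto
qed

text \<open>A special case of Burnside's normal complement theorem. On S the transfer is the power
  map y -> y^|H:S|, which is bijective because |S| and |H : S| are coprime. Hence the kernel meets S
  trivially, and every h differs from a kernel element by an element of S.\<close>

lemma burnside_complement:
  fixes s :: nat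
  assumes x: "x \<in> S" and s: "prime s" and gen: "S = cyc x"
    and cen: "\<And>h. h \<in> H \<Longrightarrow> h \<otimes> x [^] s = x [^] s \<otimes> h"
    and nor: "\<And>h. h \<in> H \<Longrightarrow> h \<otimes> x \<otimes> inv h \<in> S \<Longrightarrow> h \<otimes> x = x \<otimes> h"
    and cop: "coprime (card S) (card H div card S)"
  shows "\<exists>K. normal_in H K \<and> K \<inter> S = {\<one>} \<and> K <#> S = H"
proof -
  have cQ: "coprime (card Q) (card S)" using cop Q_card by (simp add: coprime_commute)
  have xH: "x \<in> H" and xc: "x \<in> carrier G" using x SH S_carr by auto
  have trS: "transfer y = y [^] card Q" if y: "y \<in> S" for y
  proof -
    obtain i :: nat where "y = x [^] i" using y gen by (auto simp: cyc_def)
    then show ?thesis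
      using transfer_pow[OF xH] transfer_prime_power_central[OF x s cen nor] xc by (simp add: nat_pow_pow mult.commute)
  qed
  let ?K = "{h \<in> H. transfer h = \<one>}"
  have one: "\<one> \<in> ?K" using trS[of \<one>] subgroup.one_closed[OF S] subgroup.one_closed[OF H] by simp
  have inv: "transfer (inv h) = inv (transfer h)" if "h \<in> H" for h
  proof -
    have "transfer (inv h) \<otimes> transfer h = \<one>"
      using transfer_mult[of "inv h" h] that one subgroup.m_inv_closed[OF H] H_carr by simp
    then show ?thesis using transfer_closed subgroup.m_inv_closed[OF H] that S_carr
      by (metis inv_equality)
  qed
  have K: "subgroup ?K G"
  proof (rule subgroupI)
    show "?K \<subseteq> carrier G" using H_carr by auto
    show "?K \<noteq> {}" using one by blast
    show "a \<otimes> b \<in> ?K" if "a \<in> ?K" "b \<in> ?K" for a b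
      using that transfer_mult subgroup.m_closed[OF H] by auto
    show "inv a \<in> ?K" if "a \<in> ?K" for a
      using that inv subgroup.m_inv_closed[OF H] by auto
  qed
  have "h \<otimes> k \<otimes> inv h \<in> ?K" if "h \<in> H" "k \<in> ?K" for h k
    using that transfer_mult inv subgroup.m_inv_closed[OF H] subgroup.m_closed[OF H] transfer_closed S_carr by auto
  then have "normal_in H ?K" using K by (auto simp: normal_in_def)
  moreover have "?K \<inter> S = {\<one>}"
    using coprime_power_trivial[OF cQ] trS subgroup.one_closed[OF K] subgroup.one_closed[OF S] by auto
  moreover have "H \<subseteq> ?K <#> S"
  proof
    fix h assume h: "h \<in> H"
    obtain r where r: "r \<in> S" "r [^] card Q = transfer h"
      using coprime_power_root[OF cQ transfer_closed[OF h]] .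
    then have "transfer (h \<otimes> inv r) = \<one>"
      using transfer_mult[of h "inv r"] h SH inv[of r] trS[OF r(1)] transfer_closed[OF h] S_carr subgroup.m_inv_closed[OF H, of r]
      by auto
    moreover have "h \<otimes> inv r \<in> H" using h r SH subgroup.m_closed[OF H] subgroup.m_inv_closed[OF H] by auto
    moreover have "h = (h \<otimes> inv r) \<otimes> r" using h r H_carr S_carr by (simp add: m_assoc)
    ultimately show "h \<in> ?K <#> S" using r(1) unfolding set_mult_def by blast
  qed
  moreover have "?K <#> S \<subseteq> H" using join_sub[OF H _ SH, of ?K] by auto
  ultimately show ?thesis by blast
qed

end

context fin_group
begin

lemma abelian_transversalI:
  assumes "subgroup H G" "subgroup S G" "S \<subseteq> H" "\<And>x y. x \<in> S \<Longrightarrow> y \<in> S \<Longrightarrow> x \<otimes> y = y \<otimes> x"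
  shows "abelian_transversal G H S"
  using assms by (intro abelian_transversal.intro fin_group_axioms abelian_transversal_axioms.intro)

lemma abelian_normal_hall_complement:
  assumes "subgroup H G" "normal_in H S" "\<And>x y. x \<in> S \<Longrightarrow> y \<in> S \<Longrightarrow> x \<otimes> y = y \<otimes> x"
    and "coprime (card S) (card H div card S)"
  obtains X where "subgroup X G" "X \<subseteq> H" "S \<inter> X = {\<one>}" "S <#> X = H"
  using abelian_transversal.schur_zassenhaus[OF abelian_transversalI] assms
  unfolding normal_in_def by blast

lemmas cyclic_hall_normal_complement =
  abelian_transversal.burnside_complement[OF abelian_transversalI]

end

section \<open>Sylow subgroups\<close>

lemma greatest_prime_divisor:
  assumes "(n::nat) \<noteq> 0" "n \<noteq> 1"
  obtains p where "prime p" "p dvd n" "\<And>r. prime r \<Longrightarrow> r dvd n \<Longrightarrow> r \<le> p"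
proof -
  let ?S = "prime_factors n"
  obtain q where "prime q" "q dvd n" using prime_factor_nat[OF assms(2)] by blast
  then have "q \<in> ?S" using assms(1) by (simp add: in_prime_factors_iff)
  then have "Max ?S \<in> ?S" by (intro Max_in) auto
  moreover have "r \<le> Max ?S" if "prime r" "r dvd n" for r
    using that assms(1) by (intro Max_ge) (auto simp: in_prime_factors_iff)
  ultimately show ?thesis using that[of "Max ?S"] by (auto simp: in_prime_factors_iff)
qed

context fin_group
begin

lemma cyc_one [simp]: "cyc \<one> = {\<one>}"
  by (auto simp: cyc_def)

lemma cyc_comm: "x \<in> carrier G \<Longrightarrow> y \<in> cyc x \<Longrightarrow> z \<in> cyc x \<Longrightarrow> y \<otimes> z = z \<otimes> y"
  by (auto simp: cyc_def nat_pow_mult add.commute)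

lemma commutes_cyc:
  "x \<in> carrier G \<Longrightarrow> h \<in> carrier G \<Longrightarrow> h \<otimes> x = x \<otimes> h \<Longrightarrow> y \<in> cyc x \<Longrightarrow> h \<otimes> y = y \<otimes> h"
  unfolding cyc_def using conj_eq_iff[of h x] conj_eq_iff[of h y] conj_pow[of h x] by auto

lemma normal_in_Int:
  assumes "normal_in H N" "normal_in H K"
  shows "normal_in H (N \<inter> K)"
  using assms subgroups_Inter_pair unfolding normal_in_def by blast

lemma normal_in_restrict:
  "normal_in H N \<Longrightarrow> N \<subseteq> K \<Longrightarrow> K \<subseteq> H \<Longrightarrow> normal_in K N"
  unfolding normal_in_def by blast

lemma normal_in_inter_sub:
  assumes "normal_in H N" "subgroup K G" "K \<subseteq> H"
  shows "normal_in K (N \<inter> K)"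
proof -
  have "h \<otimes> n \<otimes> inv h \<in> K" if "h \<in> K" "n \<in> K" for h n
    using that by (intro subgroup.m_closed[OF assms(2)] subgroup.m_inv_closed[OF assms(2)])
  then show ?thesis using assms subgroups_Inter_pair[of N K] unfolding normal_in_def by blast
qed

lemma idx_dvd1:
  assumes "subgroup A G" "subgroup B G" "subgroup C G" "A \<subseteq> B" "B \<subseteq> C"
  shows "card B div card A dvd card C div card A"
  using sub_card_dvd[OF assms(1,2,4)] sub_card_dvd[OF assms(2,3,5)]
  by (meson div_dvd_div dvd_trans)

lemma idx_trans:
  assumes "subgroup A G" "subgroup B G" "subgroup C G" "A \<subseteq> B" "B \<subseteq> C"
  shows "card C div card A = (card C div card B) * (card B div card A)"
  using sub_card_dvd[OF assms(1,2,4)] sub_card_dvd[OF assms(2,3,5)]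
  by (simp add: div_mult_swap dvd_div_mult)

lemma sub_card_one: "subgroup A G \<Longrightarrow> card A = 1 \<Longrightarrow> A = {\<one>}"
  by (metis card_1_singletonE singletonD subgroup.one_closed)

lemma sub_card_eq: "subgroup A G \<Longrightarrow> subgroup B G \<Longrightarrow> A \<subseteq> B \<Longrightarrow> card A = card B \<Longrightarrow> A = B"
  using card_subset_eq sub_fin by blast

text \<open>The condition on the index, in place of an exact exponent, passes at once to every
  subgroup between P and H.\<close>

definition sylow_in :: "nat \<Rightarrow> 'a set \<Rightarrow> 'a set \<Rightarrow> bool" where
  "sylow_in p H P \<longleftrightarrow> subgroup P G \<and> P \<subseteq> H \<and> (\<exists>k. card P = p ^ k) \<and> \<not> p dvd card H div card P"

lemma sylow_in_exists:
  assumes "prime p" "subgroup H G"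
  obtains P where "sylow_in p H P"
proof -
  obtain P where P: "subgroup P G" "P \<subseteq> H" "card P = p ^ multiplicity p (card H)"
    using sylow_exists[OF assms] .
  have "\<not> p dvd card H div p ^ multiplicity p (card H)"
    using multiplicity_decompose[of "card H" p] sub_card_pos[OF assms(2)] prime_gt_1_nat[OF assms(1)] by simp
  then have "sylow_in p H P" unfolding sylow_in_def using P by auto
  then show ?thesis by (rule that)
qed

lemma sylow_in_coprime: "sylow_in p H P \<Longrightarrow> prime p \<Longrightarrow> coprime (card P) (card H div card P)"
  unfolding sylow_in_def by (metis coprime_power_left_iff prime_imp_coprime)

lemma sylow_in_sub:
  assumes "sylow_in p H P" "subgroup H G" "subgroup N G" "P \<subseteq> N" "N \<subseteq> H"
  shows "sylow_in p N P"
  using assms idx_dvd1[of P N H] dvd_trans unfolding sylow_in_def by metis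

text \<open>|A| divides |H| = |P| |H : P| and is prime to the second factor. Only orders are
  compared; conjugacy of Sylow subgroups does not enter.\<close>

lemma sylow_in_max:
  assumes "sylow_in p H P" "prime p" "subgroup H G" "subgroup A G" "A \<subseteq> H" "card A = p ^ j"
  shows "card A dvd card P"
proof -
  have P: "subgroup P G" "P \<subseteq> H" "\<not> p dvd card H div card P" using assms by (auto simp: sylow_in_def)
  have "card A dvd card P * (card H div card P)"
    unfolding idx_mult[OF P(1) assms(3) P(2)] by (rule sub_card_dvd[OF assms(4,3,5)])
  moreover have "coprime (card A) (card H div card P)"
    unfolding assms(6) using prime_imp_coprime[OF assms(2) P(3)] by simp
  ultimately show ?thesis using coprime_dvd_mult_left_iff by blast
qed

lemma sylow_in_split:
  assumes "sylow_in p H P" "prime p" and H: "subgroup H G" and h: "h \<in> H"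
  obtains i j :: nat where "h = h [^] i \<otimes> h [^] j" "(h [^] i) [^] card P = \<one>"
    "(h [^] j) [^] (card H div card P) = \<one>"
proof -
  let ?r = "card H div card P"
  have P: "subgroup P G" "P \<subseteq> H" using assms by (auto simp: sylow_in_def)
  have cr: "card P * ?r = card H" using idx_mult[OF P(1) H P(2)] .
  then have "card P > 0" "?r > 0" using sub_card_pos[OF H] by (metis nat_0_less_mult_iff)+
  moreover have "h [^] (card P * ?r) = \<one>" unfolding cr using pow_card_sub[OF H h] .
  ultimately show ?thesis
    using pow_split[OF subgroup.mem_carrier[OF H h] _ sylow_in_coprime[OF assms(1,2)]] that by blast
qed

lemma pgroup_dvd: "prime p \<Longrightarrow> (d::nat) dvd p ^ k \<Longrightarrow> \<exists>j. d = p ^ j"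
  using divides_primepow_nat by blast

lemma sylow_in_maximal:
  assumes "sylow_in p H P" "prime p" "subgroup H G" "subgroup J G" "P \<subseteq> J" "J \<subseteq> H" "card J dvd p ^ n"
  shows "J = P"
proof -
  have P: "subgroup P G" using assms by (auto simp: sylow_in_def)
  obtain i where "card J = p ^ i" using pgroup_dvd[OF assms(2,7)] by blast
  then have "card J dvd card P" using sylow_in_max[OF assms(1,2,3,4,6)] by blast
  then show ?thesis using sub_card_dvd[OF P assms(4,5)] sub_card_eq[OF P assms(4,5)] dvd_antisym by blast
qed

text \<open>A normalizes P, so PA is a p-group containing P, and P is maximal among the p-subgroups
  of H.\<close>

lemma sylow_in_absorb:
  assumes "sylow_in p H P" "prime p" "subgroup H G" "subgroup A G" "A \<subseteq> H" "card A dvd p ^ j"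
    and n: "\<And>x a. x \<in> P \<Longrightarrow> a \<in> A \<Longrightarrow> a \<otimes> x \<otimes> inv a \<in> P"
  shows "A \<subseteq> P"
proof -
  have P: "subgroup P G" "P \<subseteq> H" using assms by (auto simp: sylow_in_def)
  obtain k where k: "card P = p ^ k" using assms by (auto simp: sylow_in_def)
  have J: "subgroup (P <#> A) G" using join_subgroup[OF P(1) assms(4) n] .
  have "card (P <#> A) dvd p ^ k * p ^ j"
    using join_card[OF P(1) assms(4) J] assms(6) unfolding k by (metis dvd_triv_left dvd_trans mult_dvd_mono dvd_refl)
  then have "P <#> A = P"
    using sylow_in_maximal[OF assms(1,2,3) J _ join_sub[OF assms(3) P(2) assms(5)], of "k + j"]
      join_sup[OF P(1) assms(4)] by (simp add: power_add)
  then show ?thesis using join_sup[OF P(1) assms(4)] by blast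
qed

text \<open>KP is a subgroup because K is normal, and it is a p-group containing P.\<close>

lemma sylow_in_contains_normal:
  assumes "sylow_in p H P" "prime p" "subgroup H G" "normal_in H K" "card K dvd p ^ j"
  shows "K \<subseteq> P"
proof -
  have P: "subgroup P G" "P \<subseteq> H" using assms by (auto simp: sylow_in_def)
  have K: "subgroup K G" "K \<subseteq> H" using assms by (auto simp: normal_in_def)
  obtain k where k: "card P = p ^ k" using assms by (auto simp: sylow_in_def)
  have J: "subgroup (K <#> P) G"
    using join_subgroup[OF K(1) P(1)] assms(4) P(2) unfolding normal_in_def by blast
  have "card (K <#> P) dvd p ^ j * p ^ k"
    using join_card[OF K(1) P(1) J] assms(5) unfolding k by (metis dvd_triv_left dvd_trans mult_dvd_mono dvd_refl)
  then have "K <#> P = P"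
    using sylow_in_maximal[OF assms(1,2,3) J _ join_sub[OF assms(3) K(2) P(2)], of "j + k"]
      join_sup[OF K(1) P(1)] by (simp add: power_add)
  then show ?thesis using join_sup[OF K(1) P(1)] by blast
qed

text \<open>The order of k modulo n divides m and, by Euler, \<open>totient n\<close>; these are
  coprime.\<close>

lemma power_one_coprime_cong:
  fixes k m n :: nat
  assumes "coprime k n" "[k ^ m = 1] (mod n)" "coprime m (totient n)"
  shows "[k = 1] (mod n)"
proof (cases "m = 0")
  case True
  then have "totient n = 1" using assms by simp
  then show ?thesis using euler_theorem[OF assms(1)] by simp
next
  case False
  then obtain a b where ab: "m * a = totient n * b + 1"
    using bezout_nat[of m "totient n"] assms(3) by auto
  have 1: "[k ^ (m * a) = 1] (mod n)" unfolding power_mult using cong_pow[OF assms(2), of a] by simp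
  have "[k ^ (totient n * b) = 1] (mod n)"
    unfolding power_mult using cong_pow[OF euler_theorem[OF assms(1)], of b] by simp
  then have "[k ^ (totient n * b) * k = 1 * k] (mod n)" by (rule cong_scalar_right)
  then have "[k ^ (m * a) = k] (mod n)" unfolding ab by (simp add: mult.commute)
  from cong_trans[OF cong_sym[OF this] 1] show ?thesis .
qed

lemma ord_conj: "g \<in> carrier G \<Longrightarrow> x \<in> carrier G \<Longrightarrow> ord (g \<otimes> x \<otimes> inv g) = ord x"
proof -
  assume g: "g \<in> carrier G" and x: "x \<in> carrier G"
  have "g \<otimes> y \<otimes> inv g = \<one> \<longleftrightarrow> y = \<one>" if "y \<in> carrier G" for y
    using g that by (metis inv_closed inv_comm m_closed r_cancel_one' r_one l_cancel_one r_inv inv_solve_right)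
  then show ?thesis
    unfolding ord_unique[OF conj_closed[OF g x]]
    using g x by (simp add: pow_eq_id flip: conj_pow)
qed

text \<open>Conjugation by g acts on \<open>cyc x\<close> as a power map. The order of this
  automorphism divides m, since g^m commutes with x, and also \<open>totient (ord x)\<close>, the
  order of the automorphism group.\<close>

lemma cyclic_aut_trivial:
  assumes g: "g \<in> carrier G" and x: "x \<in> carrier G" and c: "g \<otimes> x \<otimes> inv g \<in> cyc x"
    and m: "g [^] (m::nat) \<otimes> x = x \<otimes> g [^] m" and cop: "coprime m (totient (group.ord G x))"
  shows "g \<otimes> x = x \<otimes> g"
proof -
  obtain k :: nat where k: "g \<otimes> x \<otimes> inv g = x [^] k" using c by (auto simp: cyc_def)
  have it: "g [^] j \<otimes> x \<otimes> inv (g [^] j) = x [^] (k ^ j)" for j :: nat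
  proof (induction j)
    case 0
    then show ?case using g x by simp
  next
    case (Suc j)
    have "g [^] Suc j \<otimes> x \<otimes> inv (g [^] Suc j) = g \<otimes> (g [^] j \<otimes> x \<otimes> inv (g [^] j)) \<otimes> inv g"
      using g x by (simp only: nat_pow_Suc2) (simp add: inv_mult_group m_assoc)
    also have "\<dots> = (x [^] k) [^] (k ^ j)" unfolding Suc k[symmetric] using conj_pow g x by simp
    finally show ?case using x by (simp add: nat_pow_pow)
  qed
  have eqn: "x [^] a = x \<longleftrightarrow> [a = 1] (mod ord x)" for a :: nat
  proof -
    have "x [^] a = x \<longleftrightarrow> int (ord x) dvd int 1 - int a"
      using int_pow_eq[OF x, of "int a" 1] x by (simp add: int_pow_int)
    also have "\<dots> \<longleftrightarrow> [a = 1] (mod ord x)"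
      by (metis cong_iff_dvd_diff cong_int_iff cong_sym_eq)
    finally show ?thesis .
  qed
  have "x [^] (k ^ m) = x" using it[of m] m g x conj_eq_iff[of "g [^] m" x] by simp
  then have 1: "[k ^ m = 1] (mod ord x)" using eqn by simp
  have "ord (x [^] k) = ord x"
    unfolding k[symmetric] by (rule ord_conj[OF g x])
  then have "coprime k (ord x)" using pow_ord_eq_ord_iff[OF fin x] by simp
  then have "[k = 1] (mod ord x)" using power_one_coprime_cong 1 cop by blast
  then show ?thesis using eqn k conj_eq_iff g x by metis
qed

lemma normal_in_one: "subgroup H G \<Longrightarrow> normal_in H {\<one>}"
  by (auto simp: normal_in_def triv_subgroup subgroup.one_closed dest: subgroup.mem_carrier)

lemma commute_inv:
  "\<lbrakk>a \<in> carrier G; x \<in> carrier G; a \<otimes> x = x \<otimes> a\<rbrakk> \<Longrightarrow> inv a \<otimes> x = x \<otimes> inv a"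
  using conj_eq_iff[of "inv a" x] by (simp add: m_assoc inv_solve_left')

lemma commute_mult:
  "\<lbrakk>a \<in> carrier G; b \<in> carrier G; x \<in> carrier G; a \<otimes> x = x \<otimes> a; b \<otimes> x = x \<otimes> b\<rbrakk>
     \<Longrightarrow> (a \<otimes> b) \<otimes> x = x \<otimes> (a \<otimes> b)"
  by (metis m_assoc)

text \<open>This is the kernel of the conjugation action of H on \<open>cyc x\<close>: what commutes
  with x commutes with all powers of x, in particular with the conjugates of x.\<close>

lemma normal_in_centralizer:
  assumes H: "subgroup H G" and x: "x \<in> carrier G" and n: "\<And>h. h \<in> H \<Longrightarrow> h \<otimes> x \<otimes> inv h \<in> cyc x"
  shows "normal_in H {h \<in> H. h \<otimes> x = x \<otimes> h}"
proof -
  note c = subgroup.mem_carrier[OF H]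
  let ?C = "{h \<in> H. h \<otimes> x = x \<otimes> h}"
  have "subgroup ?C G"
  proof (rule subgroupI)
    show "?C \<subseteq> carrier G" using c by auto
    show "?C \<noteq> {}" using subgroup.one_closed[OF H] x by force
    show "inv a \<in> ?C" if "a \<in> ?C" for a
      using that commute_inv[of a x] c[of a] x subgroup.m_inv_closed[OF H, of a] by simp
    show "a \<otimes> b \<in> ?C" if "a \<in> ?C" "b \<in> ?C" for a b
      using that commute_mult[of a b x] c[of a] c[of b] x subgroup.m_closed[OF H, of a b] by simp
  qed
  moreover have "g \<otimes> k \<otimes> inv g \<in> ?C" if g: "g \<in> H" and k: "k \<in> ?C" for g k
  proof -
    let ?y = "inv g \<otimes> x \<otimes> g"
    have gc: "g \<in> carrier G" "k \<in> carrier G" using g k c by auto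
    have "?y \<in> cyc x" using n[of "inv g"] subgroup.m_inv_closed[OF H g] gc by simp
    then have ky: "k \<otimes> ?y = ?y \<otimes> k" using commutes_cyc[OF x gc(2)] k by blast
    have "g \<otimes> k \<otimes> inv g \<otimes> x = g \<otimes> (k \<otimes> ?y) \<otimes> inv g" using gc x by (simp add: m_assoc)
    also have "\<dots> = x \<otimes> (g \<otimes> k \<otimes> inv g)" unfolding ky using gc x by (simp add: m_assoc inv_cancel)
    finally show ?thesis
      using g k subgroup.m_closed[OF H] subgroup.m_inv_closed[OF H] by simp
  qed
  ultimately show ?thesis by (auto simp: normal_in_def)
qed

lemma normal_in_centre:
  assumes H: "subgroup H G"
  shows "normal_in H {z \<in> H. \<forall>h\<in>H. h \<otimes> z = z \<otimes> h}"
proof -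
  note c = subgroup.mem_carrier[OF H]
  let ?C = "{z \<in> H. \<forall>h\<in>H. h \<otimes> z = z \<otimes> h}"
  have "subgroup ?C G"
  proof (rule subgroupI)
    show "?C \<subseteq> carrier G" using c by auto
    show "?C \<noteq> {}" using subgroup.one_closed[OF H] c by force
    show "inv a \<in> ?C" if "a \<in> ?C" for a
      using that commute_inv[of a, symmetric] c subgroup.m_inv_closed[OF H, of a] by simp
    show "a \<otimes> b \<in> ?C" if a: "a \<in> ?C" and b: "b \<in> ?C" for a b
    proof -
      have ab: "a \<in> H" "b \<in> H" "a \<in> carrier G" "b \<in> carrier G" using a b c by auto
      have "h \<otimes> (a \<otimes> b) = (a \<otimes> b) \<otimes> h" if h: "h \<in> H" for h
      proof -
        have "a \<otimes> h = h \<otimes> a" "b \<otimes> h = h \<otimes> b" using a b h by auto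
        then show ?thesis using commute_mult[OF ab(3,4) c[OF h]] by simp
      qed
      then show ?thesis using subgroup.m_closed[OF H ab(1,2)] by simp
    qed
  qed
  moreover have "g \<otimes> k \<otimes> inv g = k" if "g \<in> H" "k \<in> ?C" for g k
    using that c conj_eq_iff[of g k] by auto
  ultimately show ?thesis by (auto simp: normal_in_def)
qed

text \<open>For j > 0 the totient is s^(j-1)(s - 1), and a prime p > s divides neither factor. With
  \<open>cyclic_aut_trivial\<close>, a p-element normalizing a cyclic s-group with s < p centralizes
  it.\<close>

lemma totient_prime_power_coprime:
  assumes "prime p" "prime s" "s < p"
  shows "coprime (p ^ i) (totient (s ^ j))"
proof (cases j)
  case (Suc n)
  have "\<not> p dvd s ^ n * (s - 1)"
    using assms by (metis dvd_imp_le less_imp_diff_less linorder_not_less prime_dvd_mult_iff prime_dvd_power primes_dvd_imp_eq zero_less_diff prime_gt_1_nat nat_neq_iff)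
  then have "coprime p (totient (s ^ Suc n))"
    using prime_imp_coprime[OF assms(1)] assms(2) by (simp only: totient_prime_power_Suc)
  then show ?thesis using Suc by simp
qed simp

end

section \<open>Embedded subgroups and the Sylow subgroup for the largest prime\<close>

locale sigma_group = fin_group +
  fixes same :: "nat \<Rightarrow> nat \<Rightarrow> bool"
  assumes same_refl: "prime p \<Longrightarrow> same p p"
    and same_sym: "same p q \<Longrightarrow> same q p"
    and same_trans: "same p q \<Longrightarrow> same q r \<Longrightarrow> same p r"
begin

text \<open>N is the witness that A is sigma-Hall in a normal subgroup of H. Classes enter only
  through the relation \<open>same\<close> on primes, so the group theory does not depend on how
  they are represented.\<close>

definition emb_via :: "'a set \<Rightarrow> 'a set \<Rightarrow> 'a set \<Rightarrow> bool" where
  "emb_via H N A \<longleftrightarrow> normal_in H N \<and> A \<subseteq> N \<and>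
     (\<forall>p q. prime p \<longrightarrow> prime q \<longrightarrow> p dvd card A \<longrightarrow> q dvd card N div card A \<longrightarrow> \<not> same p q)"

definition all_emb :: "'a set \<Rightarrow> bool" where
  "all_emb H \<longleftrightarrow> (\<forall>A. subgroup A G \<longrightarrow> A \<subseteq> H \<longrightarrow> (\<exists>N. emb_via H N A))"

lemma emb_via_prime:
  "emb_via H N A \<Longrightarrow> prime p \<Longrightarrow> p dvd card A \<Longrightarrow> \<not> p dvd card N div card A"
  unfolding emb_via_def using same_refl by blast

text \<open>If N is a witness in H, then N \<inter> K is one in K, because |N \<inter> K : A|
  divides |N : A|.\<close>

lemma all_emb_sub:
  assumes "all_emb H" "subgroup K G" "K \<subseteq> H"
  shows "all_emb K"
  unfolding all_emb_def
proof (intro allI impI)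
  fix A assume A: "subgroup A G" "A \<subseteq> K"
  then obtain N where N: "emb_via H N A" using assms unfolding all_emb_def by blast
  then have n: "normal_in H N" "subgroup N G" "A \<subseteq> N" by (auto simp: emb_via_def normal_in_def)
  have i: "subgroup (N \<inter> K) G" using n(2) assms(2) subgroups_Inter_pair by blast
  have "card (N \<inter> K) div card A dvd card N div card A"
    using idx_dvd1[OF A(1) i n(2)] n(3) A(2) by blast
  then have "emb_via K (N \<inter> K) A"
    using N normal_in_inter_sub[OF n(1) assms(2,3)] n(3) A(2) unfolding emb_via_def
    by (meson Int_subset_iff dvd_trans)
  then show "\<exists>N. emb_via K N A" by blast
qed

text \<open>The index |N \<inter> P : A| is a power of p and divides |N : A|, which is prime to p
  because p divides |A|; so it is 1.\<close>

lemma emb_psub_Int: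
  assumes "emb_via H N A" "prime p" "subgroup A G" "subgroup P G" "A \<subseteq> P" "card P = p ^ k" "A \<noteq> {\<one>}"
  shows "N \<inter> P = A"
proof -
  have N: "subgroup N G" "A \<subseteq> N" using assms by (auto simp: emb_via_def normal_in_def)
  have i: "subgroup (N \<inter> P) G" using N(1) assms(4) subgroups_Inter_pair by blast
  have sub: "A \<subseteq> N \<inter> P" using N(2) assms(5) by blast
  obtain j where j: "card A = p ^ j"
    using pgroup_dvd[OF assms(2)] sub_card_dvd[OF assms(3,4,5)] assms(6) by metis
  have "card A \<noteq> 1" using sub_card_one[OF assms(3)] assms(7) by blast
  then have "p dvd card A" using j by (cases j) auto
  then have np: "\<not> p dvd card N div card A" using emb_via_prime[OF assms(1,2)] by blast
  have "card (N \<inter> P) div card A dvd card N div card A" using idx_dvd1[OF assms(3) i N(1) sub] by blast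
  then have np2: "\<not> p dvd card (N \<inter> P) div card A" using np dvd_trans by blast
  have "card (N \<inter> P) div card A dvd p ^ k"
    using sub_card_dvd[OF i assms(4)] assms(6) sub_card_dvd[OF assms(3) i sub]
    by (metis Int_lower2 dvd_trans dvd_div_mult_self dvd_triv_left)
  then obtain i where "card (N \<inter> P) div card A = p ^ i" using pgroup_dvd[OF assms(2)] by blast
  then have "card (N \<inter> P) div card A = 1" using np2 by (cases i) auto
  then have "card (N \<inter> P) = card A" using sub_card_dvd[OF assms(3) i sub] by (metis dvd_div_mult_self mult_1)
  then show ?thesis using sub_card_eq[OF assms(3) i sub] by simp
qed

text \<open>By \<open>emb_psub_Int\<close> a nontrivial \<open>cyc x\<close> is the intersection of
  its witness with K, hence of two normal subgroups.\<close>

lemma normal_psub_cyc: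
  assumes "all_emb H" "subgroup H G" "normal_in H K" "prime s" "card K = s ^ k" "x \<in> K"
  shows "normal_in H (cyc x)"
proof (cases "x = \<one>")
  case True
  then show ?thesis using normal_in_one[OF assms(2)] by simp
next
  case False
  have K: "subgroup K G" "K \<subseteq> H" using assms by (auto simp: normal_in_def)
  have xc: "x \<in> carrier G" using K assms(6) subgroup.mem_carrier by metis
  note c = cyc_subgroup[OF xc] cyc_sub[OF K(1) assms(6)]
  obtain N where N: "emb_via H N (cyc x)"
    using assms(1) c K unfolding all_emb_def by blast
  have "cyc x \<noteq> {\<one>}" using cyc_self[OF xc] False by auto
  then have "N \<inter> K = cyc x" using emb_psub_Int[OF N assms(4) c(1) K(1) c(2) assms(5)] by blast
  then show ?thesis using normal_in_Int[of H N K] N assms(3) by (simp add: emb_via_def)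
qed

text \<open>
  In a minimal counterexample the normal closure of \<open>P\<close> is \<open>H\<close>. Hence \<open>P\<close> is cyclic and every proper
  normal subgroup is central. For the least prime \<open>s\<close> dividing \<open>|H : Z(H)|\<close>, a Sylow \<open>s\<close>-subgroup \<open>S\<close>
  is cyclic with \<open>S\<^sup>s\<close> central and central in its normalizer, so the kernel of the transfer into \<open>S\<close> is
  a proper normal complement, and \<open>H\<close> is abelian.
\<close>

lemma sylow_largest_normal:
  assumes "all_emb H" "subgroup H G" "prime p" "\<And>q. prime q \<Longrightarrow> q dvd card H \<Longrightarrow> q \<le> p" "sylow_in p H P"
  shows "normal_in H P"
  using assms
proof (induction "card H" arbitrary: H p P rule: less_induct)
  case less
  note emb = less.prems(1) and H = less.prems(2) and p = less.prems(3) and pmax = less.prems(4) and syl = less.prems(5)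
  note Hc = subgroup.mem_carrier[OF H]
  have P: "subgroup P G" "P \<subseteq> H" using syl by (auto simp: sylow_in_def)
  obtain k where k: "card P = p ^ k" using syl by (auto simp: sylow_in_def)
  \<comment> \<open>The induction gives normality in N; a normal Sylow subgroup is a Hall subgroup,
    so normality lifts to H. The prime q is arbitrary because the largest prime dividing |N| may
    differ from p.\<close>
  have IH: "normal_in H Q"
    if "normal_in H N" "N \<noteq> H" "prime q" "\<And>r. prime r \<Longrightarrow> r dvd card N \<Longrightarrow> r \<le> q" "sylow_in q N Q" for N q Q
  proof -
    have N: "subgroup N G" "N \<subseteq> H" using that by (auto simp: normal_in_def)
    then have "card N < card H" using that sub_fin[OF H] by (simp add: psubset_card_mono psubsetI)
    then have "normal_in N Q"
      using less.hyps all_emb_sub[OF emb N] N that by blast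
    then show ?thesis using normal_in_trans_hall[OF _ that(1) H] sylow_in_coprime that by blast
  qed
  have IHp: "normal_in H A" if "normal_in H N" "N \<noteq> H" "sylow_in p N A" for N A
    using IH[OF that(1,2) p _ that(3)] pmax sub_card_dvd[OF _ H] that(1) dvd_trans
    unfolding normal_in_def by blast
  show ?case
  proof (rule ccontr)
    assume nn: "\<not> normal_in H P"
    \<comment> \<open>The witness N meets P exactly in A, so N is proper and A is a Sylow p-subgroup
      of N.\<close>
    have psub: "normal_in H A" if A: "subgroup A G" "A \<subseteq> P" "A \<noteq> P" for A
    proof (cases "A = {\<one>}")
      case True
      then show ?thesis using normal_in_one[OF H] by simp
    next
      case False
      obtain N where N: "emb_via H N A" using emb A P unfolding all_emb_def by blast
      have NP: "N \<inter> P = A" using emb_psub_Int[OF N p A(1) P(1) A(2) k False] .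
      have Nn: "normal_in H N" "A \<subseteq> N" using N by (auto simp: emb_via_def)
      have "N \<noteq> H" using NP P A by blast
      obtain j where j: "card A = p ^ j"
        using pgroup_dvd[OF p] sub_card_dvd[OF A(1) P(1) A(2)] k by metis
      have "card A \<noteq> 1" using sub_card_one[OF A(1)] False by blast
      then have "p dvd card A" using j by (cases j) auto
      then have "sylow_in p N A" using emb_via_prime[OF N p] A Nn(2) j by (auto simp: sylow_in_def)
      then show ?thesis using IHp[OF Nn(1) \<open>N \<noteq> H\<close>] by blast
    qed
    \<comment> \<open>If no element generated P, every \<open>cyc x\<close> with x in P would be
      proper in P, hence normal in H, and P would be normal.\<close>
    obtain x0 where x0: "x0 \<in> P" "cyc x0 = P"
    proof (rule ccontr)
      assume "\<not> thesis"
      then have ncyc: "\<And>x. x \<in> P \<Longrightarrow> cyc x \<noteq> P" using that by blast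
      have "h \<otimes> x \<otimes> inv h \<in> P" if "h \<in> H" "x \<in> P" for h x
      proof -
        have xc: "x \<in> carrier G" using that P subgroup.mem_carrier by metis
        then have "normal_in H (cyc x)"
          using psub[OF cyc_subgroup cyc_sub[OF P(1)] ncyc] that by blast
        then show ?thesis using that cyc_self[OF xc] cyc_sub[OF P(1) that(2)] unfolding normal_in_def by blast
      qed
      then show False using nn P by (auto simp: normal_in_def)
    qed
    have x0c: "x0 \<in> carrier G" using x0 P subgroup.mem_carrier by metis
    have ncl: "N = H" if "normal_in H N" "P \<subseteq> N" for N
    proof (rule ccontr)
      assume "N \<noteq> H"
      moreover have "sylow_in p N P" using sylow_in_sub[OF syl H] that by (auto simp: normal_in_def)
      ultimately show False using IHp[OF that(1)] nn by blast
    qed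
    \<comment> \<open>The centralizer of x is normal in H because \<open>cyc x\<close> is. It
      contains P: for s = p since x lies in the abelian group P, for s < p and nontrivial x since
      |P| is coprime to \<open>totient (ord x)\<close>. Then \<open>ncl\<close> makes it all of
      H.\<close>
    have pcen: "h \<otimes> x = x \<otimes> h"
      if K: "normal_in H K" and s: "prime s" and i: "card K = s ^ i" and x: "x \<in> K" and h: "h \<in> H" for K s i x h
    proof -
      have Ks: "subgroup K G" "K \<subseteq> H" using K by (auto simp: normal_in_def)
      have xc: "x \<in> carrier G" using x Ks subgroup.mem_carrier by metis
      have nx: "normal_in H (cyc x)" using normal_psub_cyc[OF emb H K s i x] .
      then have nx': "\<And>h. h \<in> H \<Longrightarrow> h \<otimes> x \<otimes> inv h \<in> cyc x"
        using cyc_self[OF xc] unfolding normal_in_def by blast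
      let ?C = "{h \<in> H. h \<otimes> x = x \<otimes> h}"
      have "P \<subseteq> ?C"
      proof (cases "s = p")
        case True
        then have "x \<in> P" using sylow_in_contains_normal[OF syl p H K, of i] i x by auto
        then show ?thesis using cyc_comm[OF x0c] x0 P by blast
      next
        case False
        obtain j where j: "ord x = s ^ j"
          using pgroup_dvd[OF s] ord_dvd_sub[OF Ks(1) x] i by metis
        have "s < p" if "x \<noteq> \<one>"
        proof -
          have "j \<noteq> 0" using j that ord_eq_1[OF xc] by (cases j) auto
          then have "s dvd card H" using j ord_dvd_sub[OF H, of x] x Ks by (metis dvd_power dvd_trans gr0I subsetD)
          then show ?thesis using pmax s False by (simp add: le_neq_implies_less)
        qed
        then have cop: "x = \<one> \<or> coprime (card P) (totient (ord x))"
          unfolding j k using totient_prime_power_coprime[OF p s] by blast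
        have "y \<otimes> x = x \<otimes> y" if y: "y \<in> P" for y
        proof (cases "x = \<one>")
          case False
          have yc: "y \<in> carrier G" using y P Hc by blast
          have "y [^] card P = \<one>" using pow_card_sub[OF P(1) y] .
          then show ?thesis using cyclic_aut_trivial[OF yc xc nx', of "card P"] y P(2) cop False xc by auto
        qed (use y P Hc in auto)
        then show ?thesis using P by blast
      qed
      then have "?C = H" using ncl[OF normal_in_centralizer[OF H xc nx']] by blast
      then show ?thesis using h by blast
    qed
    \<comment> \<open>Induction on |K|. The Sylow subgroup Q for the largest prime of |K| is normal
      in H, hence central. Its complement X is then normal and Hall in K, hence normal in H, and
      central by induction; and K = QX.\<close>
    have ncen: "\<forall>x\<in>K. \<forall>h\<in>H. h \<otimes> x = x \<otimes> h" if "normal_in H K" "K \<noteq> H" for K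
      using that
    proof (induction "card K" arbitrary: K rule: less_induct)
      case (less K)
      have K: "subgroup K G" "K \<subseteq> H" using less.prems by (auto simp: normal_in_def)
      show ?case
      proof (cases "K = {\<one>}")
        case True
        then show ?thesis using Hc by simp
      next
        case False
        then have c1: "card K \<noteq> 1" using sub_card_one[OF K(1)] by blast
        then obtain q where q: "prime q" "q dvd card K" and qmax: "\<And>r. prime r \<Longrightarrow> r dvd card K \<Longrightarrow> r \<le> q"
          using greatest_prime_divisor[of "card K"] sub_card_pos[OF K(1)] by auto
        obtain Q where Q: "sylow_in q K Q" using sylow_in_exists[OF q(1) K(1)] .
        have Qs: "subgroup Q G" "Q \<subseteq> K" using Q by (auto simp: sylow_in_def)
        obtain i where i: "card Q = q ^ i" using Q by (auto simp: sylow_in_def)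
        have Qn: "normal_in H Q" using IH[OF less.prems q(1) qmax Q] by blast
        have Qcen: "\<And>x h. x \<in> Q \<Longrightarrow> h \<in> H \<Longrightarrow> h \<otimes> x = x \<otimes> h" using pcen[OF Qn q(1) i] by blast
        have "normal_in K Q" using normal_in_restrict[OF Qn Qs(2) K(2)] .
        then obtain X where X: "subgroup X G" "X \<subseteq> K" "Q \<inter> X = {\<one>}" "Q <#> X = K"
          using abelian_normal_hall_complement[OF K(1) _ _ sylow_in_coprime[OF Q q(1)]] Qcen Qs K by blast
        have cX: "card K = card Q * card X"
          using join_card[OF Qs(1) X(1)] X K(1) by simp
        have Q0: "card Q > 0" using sub_card_pos[OF Qs(1)] .
        have X0: "card X > 0" using sub_card_pos[OF X(1)] .
        have nX: "normal_in K X"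
          unfolding normal_in_def
        proof (intro conjI ballI)
          fix h n assume h: "h \<in> K" and n: "n \<in> X"
          obtain a b where ab: "h = a \<otimes> b" "a \<in> Q" "b \<in> X" using h X(4) unfolding set_mult_def by blast
          have c: "a \<in> carrier G" "b \<in> carrier G" "n \<in> carrier G"
            using ab n X(1) Qs(1) subgroup.mem_carrier by metis+
          have bX: "b \<otimes> n \<otimes> inv b \<in> X"
            using ab n X(1) by (meson subgroup.m_closed subgroup.m_inv_closed)
          then have "(b \<otimes> n \<otimes> inv b) \<otimes> a = a \<otimes> (b \<otimes> n \<otimes> inv b)"
            using Qcen[OF ab(2)] X(2) K(2) by blast
          then have "a \<otimes> (b \<otimes> n \<otimes> inv b) \<otimes> inv a = b \<otimes> n \<otimes> inv b"
            using conj_eq_iff[of a "b \<otimes> n \<otimes> inv b"] c by simp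
          moreover have "h \<otimes> n \<otimes> inv h = a \<otimes> (b \<otimes> n \<otimes> inv b) \<otimes> inv a"
            unfolding ab(1) using c by (simp add: m_assoc inv_mult_group)
          ultimately show "h \<otimes> n \<otimes> inv h \<in> X" using bX by simp
        qed (use X in auto)
        have "coprime (card X) (card K div card X)"
          using sylow_in_coprime[OF Q q(1)] cX Q0 X0 by (simp add: coprime_commute)
        then have "normal_in H X" using normal_in_trans_hall[OF nX less.prems(1) H] by blast
        moreover have "card X < card K"
        proof -
          have "q dvd card Q"
            using q Q idx_mult[OF Qs(1) K(1) Qs(2)] unfolding sylow_in_def by (metis prime_dvd_mult_iff)
          then have "1 < card Q" using q(1) Q0 by (metis dvd_imp_le less_le_trans prime_gt_1_nat)
          then show ?thesis using cX X0 by simp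
        qed
        moreover have "X \<noteq> H" using X(2) K(2) less.prems(2) by blast
        ultimately have Xcen: "\<forall>x\<in>X. \<forall>h\<in>H. h \<otimes> x = x \<otimes> h" using less.hyps by blast
        show ?thesis
        proof (intro ballI)
          fix x h assume x: "x \<in> K" and h: "h \<in> H"
          obtain a b where ab: "x = a \<otimes> b" "a \<in> Q" "b \<in> X" using x X(4) unfolding set_mult_def by blast
          have c: "a \<in> carrier G" "b \<in> carrier G" "h \<in> carrier G"
            using ab h H X(1) Qs(1) subgroup.mem_carrier by metis+
          show "h \<otimes> x = x \<otimes> h"
            unfolding ab(1) using Qcen[OF ab(2) h] Xcen ab(3) h c by (metis m_assoc)
        qed
      qed
    qed
    let ?Z = "{z \<in> H. \<forall>h\<in>H. h \<otimes> z = z \<otimes> h}"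
    have Zn: "normal_in H ?Z" using normal_in_centre[OF H] .
    then have Z: "subgroup ?Z G" "?Z \<subseteq> H" by (auto simp: normal_in_def)
    have ZH: "?Z \<noteq> H"
    proof
      assume "?Z = H"
      then have "h \<otimes> x \<otimes> inv h = x" if "h \<in> H" "x \<in> P" for h x
        using that P(2) Hc conj_eq_iff[of h x] by blast
      then show False using nn P by (auto simp: normal_in_def)
    qed
    let ?n = "card H div card ?Z"
    have nZ: "card ?Z * ?n = card H" using idx_mult[OF Z(1) H Z(2)] .
    have n0: "?n \<noteq> 0" using nZ sub_card_pos[OF H] by (metis less_irrefl mult_0_right)
    have n1: "?n \<noteq> 1" using nZ ZH sub_card_eq[OF Z(1) H Z(2)] by auto
    \<comment> \<open>Minimality is used in \<open>nor\<close>: every other prime dividing |H :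
      Z(H)| exceeds s and so does not divide \<open>totient (s ^ k)\<close>.\<close>
    define s where "s = (LEAST s. prime s \<and> s dvd ?n)"
    have "\<exists>s. prime s \<and> s dvd ?n" using prime_factor_nat[OF n1] .
    then have s: "prime s" "s dvd ?n" unfolding s_def by (metis (mono_tags, lifting) LeastI_ex)+
    have smin: "s \<le> t" if "prime t" "t dvd ?n" for t unfolding s_def using that by (simp add: Least_le)
    obtain S where S: "sylow_in s H S" using sylow_in_exists[OF s(1) H] .
    have Ss: "subgroup S G" "S \<subseteq> H" using S by (auto simp: sylow_in_def)
    obtain k where k: "card S = s ^ k" using S by (auto simp: sylow_in_def)
    have "\<not> S \<subseteq> ?Z"
    proof
      assume "S \<subseteq> ?Z"
      from idx_trans[OF Ss(1) Z(1) H this Z(2)]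
      have "?n dvd card H div card S" by (simp only: dvd_triv_left)
      then show False using s(2) S dvd_trans unfolding sylow_in_def by blast
    qed
    then obtain x where x: "x \<in> S" "x \<notin> ?Z" by blast
    have xH: "x \<in> H" using x Ss by blast
    have xc: "x \<in> carrier G" using Hc[OF xH] .
    \<comment> \<open>A noncentral A has a noncentral witness, which is H by \<open>ncen\<close>.
      Then |H : A| is prime to s and A is already a Sylow s-subgroup. Applied to
      \<open>cyc x\<close> this makes S cyclic; applied to \<open>cyc (x [^] s)\<close>, whose order
      is smaller, it shows that x^s is central.\<close>
    have full: "A = S" if A: "subgroup A G" "A \<subseteq> S" "\<not> A \<subseteq> ?Z" for A
    proof -
      obtain N where N: "emb_via H N A" using emb A Ss unfolding all_emb_def by blast
      have "N = H"
      proof (rule ccontr)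
        assume "N \<noteq> H"
        then have "\<forall>x\<in>N. \<forall>h\<in>H. h \<otimes> x = x \<otimes> h" using ncen N by (auto simp: emb_via_def)
        then show False using A N Ss unfolding emb_via_def by blast
      qed
      have "A \<noteq> {\<one>}" using A(3) subgroup.one_closed[OF Z(1)] by blast
      then have c1: "card A \<noteq> 1" using sub_card_one[OF A(1)] by blast
      obtain j where j: "card A = s ^ j"
        using pgroup_dvd[OF s(1)] sub_card_dvd[OF A(1) Ss(1) A(2)] k by metis
      have "s dvd card A" using j c1 by (cases j) auto
      then have "sylow_in s H A"
        using emb_via_prime[OF N s(1)] A Ss j unfolding sylow_in_def \<open>N = H\<close> by blast
      then show ?thesis using sylow_in_maximal[OF _ s(1) H Ss(1) A(2) Ss(2), of k] k by simp
    qed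
    have Sx: "S = cyc x"
      using full[OF cyc_subgroup[OF xc] cyc_sub[OF Ss(1) x(1)]] cyc_self[OF xc] x(2) by blast
    have ox: "ord x = s ^ k" using cyc_card[OF xc] k Sx by simp
    have xs: "x [^] s \<in> ?Z"
    proof (rule ccontr)
      assume a: "x [^] s \<notin> ?Z"
      have pc: "x [^] s \<in> carrier G" using xc by simp
      have "x [^] s \<in> S" using sub_nat_pow[OF Ss(1) x(1)] .
      then have "cyc (x [^] s) = S"
        using full[OF cyc_subgroup[OF pc] cyc_sub[OF Ss(1)]] cyc_self[OF pc] a by blast
      then have "ord (x [^] s) = s ^ k" using cyc_card[OF pc] k by simp
      moreover have "x \<noteq> \<one>" using x(2) subgroup.one_closed[OF Z(1)] by blast
      then have "k \<noteq> 0" using ox ord_eq_1[OF xc] by (cases k) auto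
      then have "s dvd ord x" using ox by (metis dvd_power gr0I)
      then have "ord (x [^] s) = s ^ k div s" using ord_pow[OF xc] ox s(1) by (metis not_prime_0)
      ultimately show False using prime_gt_1_nat[OF s(1)]
        by (metis div_less_dividend less_irrefl zero_less_power zero_less_one less_trans)
    qed
    \<comment> \<open>y is split into its s-part a and its s'-part b, which both normalize S. The
      s-part lies in S by maximality; for the s'-part a power b^m with m prime to
      \<open>totient (ord x)\<close> turns out to be central.\<close>
    have nor: "y \<otimes> x = x \<otimes> y" if y: "y \<in> H" and yx: "y \<otimes> x \<otimes> inv y \<in> S" for y
    proof -
      have yc: "y \<in> carrier G" using Hc[OF y] .
      let ?r = "card H div card S"
      obtain i j :: nat where ij: "y = y [^] i \<otimes> y [^] j" "(y [^] i) [^] card S = \<one>" "(y [^] j) [^] ?r = \<one>"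
        using sylow_in_split[OF S s(1) H y] .
      have conj_S: "y [^] n \<otimes> u \<otimes> inv (y [^] n) \<in> S" if "u \<in> S" for u and n :: nat
        using that
      proof (induction n arbitrary: u)
        case 0
        then show ?case using Ss(1) subgroup.mem_carrier by fastforce
      next
        case (Suc n)
        have uc: "u \<in> carrier G" using Suc(2) Ss(1) subgroup.mem_carrier by metis
        obtain l :: nat where l: "u = x [^] l" using Suc(2) unfolding Sx cyc_def by blast
        have "y \<otimes> u \<otimes> inv y = (y \<otimes> x \<otimes> inv y) [^] l" unfolding l using conj_pow[OF yc xc] .
        then have "y \<otimes> u \<otimes> inv y \<in> S" using sub_nat_pow[OF Ss(1) yx] by simp
        then have "y [^] n \<otimes> (y \<otimes> u \<otimes> inv y) \<otimes> inv (y [^] n) \<in> S" using Suc(1) by blast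
        then show ?case using yc uc by (simp add: m_assoc inv_mult_group)
      qed
      define a where "a = y [^] i"
      define b where "b = y [^] j"
      have ac: "a \<in> carrier G" and bc: "b \<in> carrier G" using yc by (auto simp: a_def b_def)
      have aH: "a \<in> H" and bH: "b \<in> H" using sub_nat_pow[OF H y] by (auto simp: a_def b_def)
      have "cyc a \<subseteq> S"
      proof (rule sylow_in_absorb[OF S s(1) H cyc_subgroup[OF ac] cyc_sub[OF H aH], of k])
        show "card (cyc a) dvd s ^ k"
          using ij(2) unfolding cyc_card[OF ac] k[symmetric] a_def[symmetric] pow_eq_id[OF ac] .
        show "v \<otimes> u \<otimes> inv v \<in> S" if "u \<in> S" "v \<in> cyc a" for u v
          using that(2) conj_S[OF that(1)] yc by (auto simp: cyc_def a_def nat_pow_pow)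
      qed
      then have ax: "a \<otimes> x = x \<otimes> a" using cyc_comm[OF xc] cyc_self[OF ac] cyc_self[OF xc] Sx by blast
      have "\<not> is_unit s" using prime_gt_1_nat[OF s(1)] by simp
      from multiplicity_decompose'[OF n0 this] obtain e m where em: "?n = s ^ e * m" "\<not> s dvd m"
        by blast
      have "(b [^] m) [^] (s ^ e) = b [^] ?n" unfolding em(1) nat_pow_pow[OF bc] mult.commute[of m] ..
      \<comment> \<open>Modulo the centre b^m has s-power order, while its own order divides |H :
        S|, which is prime to s. Hence b^m is central.\<close>
      then have "(b [^] m) [^] (s ^ e) \<in> ?Z" using normal_in_pow_index[OF Zn H bH] by simp
      moreover have "(b [^] m) [^] ?r = \<one>"
      proof -
        have "(b [^] m) [^] ?r = (b [^] ?r) [^] m" unfolding nat_pow_pow[OF bc] mult.commute[of m] ..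
        then show ?thesis using ij(3) by (simp add: b_def)
      qed
      then have "(b [^] m) [^] ?r \<in> ?Z" using subgroup.one_closed[OF Z(1)] by simp
      moreover have "coprime (s ^ e) ?r" using S prime_imp_coprime[OF s(1)] by (auto simp: sylow_in_def)
      ultimately have "b [^] m \<in> ?Z" using pow_coprime_in[OF Z(1), of "b [^] m"] bc by blast
      then have bm: "b [^] m \<otimes> x = x \<otimes> b [^] m" using xH by auto
      have "coprime m (totient (ord x))"
      proof (rule ccontr)
        assume "\<not> coprime m (totient (ord x))"
        then have "gcd m (totient (ord x)) \<noteq> 1" by (simp add: coprime_iff_gcd_eq_1)
        then obtain q where "prime q" "q dvd gcd m (totient (ord x))" using prime_factor_nat by blast
        then have q: "prime q" "q dvd m" "q dvd totient (ord x)" by auto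
        have "s \<le> q" using smin[OF q(1)] q(2) em(1) by simp
        then have "s < q" using q(2) em(2) by (metis le_neq_implies_less)
        then have "coprime (q ^ 1) (totient (s ^ k))" using totient_prime_power_coprime[OF q(1) s(1)] by blast
        then show False using q ox by (metis coprime_absorb_left power_one_right not_prime_unit)
      qed
      moreover have "b \<otimes> x \<otimes> inv b \<in> cyc x" using conj_S[OF x(1)] unfolding b_def Sx .
      ultimately have bx: "b \<otimes> x = x \<otimes> b" using cyclic_aut_trivial[OF bc xc _ bm] by blast
      have "y = a \<otimes> b" using ij(1) by (simp add: a_def b_def)
      then show ?thesis using ax bx ac bc xc by (metis m_assoc)
    qed
    have "\<And>u v. u \<in> S \<Longrightarrow> v \<in> S \<Longrightarrow> u \<otimes> v = v \<otimes> u" using cyc_comm[OF xc] Sx by blast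
    note T = cyclic_hall_normal_complement[OF H Ss this x(1) s(1) Sx _ nor sylow_in_coprime[OF S s(1)]]
    obtain K where K: "normal_in H K" "K \<inter> S = {\<one>}" "K <#> S = H"
      using T xs by auto
    have "x \<noteq> \<one>" using x(2) subgroup.one_closed[OF Z(1)] by blast
    \<comment> \<open>So K is proper and therefore central. As H = KS with S abelian, x is central
      too, contrary to its choice.\<close>
    then have "x \<notin> K" using K(2) x(1) by blast
    then have Kc: "\<forall>x\<in>K. \<forall>h\<in>H. h \<otimes> x = x \<otimes> h" using ncen[OF K(1)] xH by blast
    have "h \<otimes> x = x \<otimes> h" if h: "h \<in> H" for h
    proof -
      obtain u v where uv: "h = u \<otimes> v" "u \<in> K" "v \<in> S" using h K(3) unfolding set_mult_def by blast
      have "u \<in> H" "v \<in> H" using uv K(1) Ss by (auto simp: normal_in_def)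
      then have c: "u \<in> carrier G" "v \<in> carrier G" using Hc by auto
      have "x \<otimes> u = u \<otimes> x" using Kc uv xH by blast
      moreover have "v \<otimes> x = x \<otimes> v" using cyc_comm[OF xc] uv(3) cyc_self[OF xc] Sx by blast
      ultimately show ?thesis unfolding uv(1) using c xc by (metis m_assoc)
    qed
    then show False using x(2) xH by blast
  qed
qed

end

section \<open>Commutators and automorphisms of cyclic groups\<close>

context fin_group
begin

lemma commutator_one_iff:
  "\<lbrakk>g \<in> carrier G; x \<in> carrier G\<rbrakk> \<Longrightarrow> g \<otimes> x \<otimes> inv g \<otimes> inv x = \<one> \<longleftrightarrow> g \<otimes> x = x \<otimes> g"
  using conj_eq_iff[of g x] by (metis conj_closed inv_closed inv_equality inv_inv r_inv)

lemma normal_in_commutator: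
  assumes "normal_in H N" "m \<in> N" "x \<in> H" "subgroup H G"
  shows "m \<otimes> x \<otimes> inv m \<otimes> inv x \<in> N"
proof -
  have N: "subgroup N G" using assms by (simp add: normal_in_def)
  have c: "m \<in> carrier G" "x \<in> carrier G" using assms N subgroup.mem_carrier by metis+
  have "x \<otimes> inv m \<otimes> inv x \<in> N"
    using assms subgroup.m_inv_closed[OF N assms(2)] by (auto simp: normal_in_def)
  then have "m \<otimes> (x \<otimes> inv m \<otimes> inv x) \<in> N" using subgroup.m_closed[OF N assms(2)] by blast
  then show ?thesis using c by (simp add: m_assoc)
qed

lemma coprime_pow_one:
  assumes "x \<in> carrier G" "x [^] (m::nat) = \<one>" "x [^] (n::nat) = \<one>" "coprime m n"
  shows "x = \<one>"
  using pow_coprime_in[OF triv_subgroup, of x m n] assms by simp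

text \<open>The commutator of m and x lies in N by normality and in \<open>cyc x\<close> because m
  conjugates x into it; the two orders are coprime.\<close>

lemma commute_of_coprime_normal:
  assumes N: "normal_in H N" and H: "subgroup H G" and m: "m \<in> N" and x: "x \<in> H"
    and c: "m \<otimes> x \<otimes> inv m \<in> cyc x" and cop: "coprime (ord x) (card N)"
  shows "m \<otimes> x = x \<otimes> m"
proof -
  have Ns: "subgroup N G" using N by (simp add: normal_in_def)
  have mc: "m \<in> carrier G" using m Ns subgroup.mem_carrier by metis
  have xc: "x \<in> carrier G" using x H subgroup.mem_carrier by metis
  let ?c = "m \<otimes> x \<otimes> inv m \<otimes> inv x"
  have "?c \<in> N" by (rule normal_in_commutator[OF N m x H])
  moreover have "?c \<in> cyc x"
    using c cyc_self[OF xc] cyc_subgroup[OF xc] by (meson subgroup.m_closed subgroup.m_inv_closed)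
  ultimately have "?c [^] card N = \<one>" "?c [^] ord x = \<one>"
    using pow_card_sub[OF Ns] pow_card_sub[OF cyc_subgroup[OF xc]] cyc_card[OF xc] by metis+
  then have "?c = \<one>" using coprime_pow_one[of ?c] cop mc xc by (simp add: coprime_commute)
  then show ?thesis using commutator_one_iff mc xc by blast
qed

text \<open>On \<open>cyc d\<close> conjugation by g is a power map, so it keeps every element
  inside the subgroup generated by that element.\<close>

lemma cyclic_normalizer:
  assumes d: "d \<in> carrier G" and g: "g \<in> carrier G" and c: "g \<otimes> d \<otimes> inv g \<in> cyc d" and x: "x \<in> cyc d"
  shows "g \<otimes> x \<otimes> inv g \<in> cyc x"
proof -
  obtain k :: nat where k: "g \<otimes> d \<otimes> inv g = d [^] k" using c by (auto simp: cyc_def)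
  obtain i :: nat where i: "x = d [^] i" using x by (auto simp: cyc_def)
  have "g \<otimes> x \<otimes> inv g = (d [^] k) [^] i" unfolding i k[symmetric] using conj_pow[OF g d] .
  also have "\<dots> = x [^] k" unfolding i nat_pow_pow[OF d] mult.commute[of k] ..
  finally show ?thesis by (auto simp: cyc_def)
qed

lemma cyclic_aut_commute:
  assumes y: "y \<in> carrier G" and g: "g \<in> carrier G" and h: "h \<in> carrier G"
    and gy: "g \<otimes> y \<otimes> inv g \<in> cyc y" and hy: "h \<otimes> y \<otimes> inv h \<in> cyc y"
    and u: "u \<in> cyc y"
  shows "(g \<otimes> h) \<otimes> u \<otimes> inv (g \<otimes> h) = (h \<otimes> g) \<otimes> u \<otimes> inv (h \<otimes> g)"
proof -
  obtain a :: nat where a: "g \<otimes> y \<otimes> inv g = y [^] a" using gy by (auto simp: cyc_def)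
  obtain b :: nat where b: "h \<otimes> y \<otimes> inv h = y [^] b" using hy by (auto simp: cyc_def)
  obtain i :: nat where i: "u = y [^] i" using u by (auto simp: cyc_def)
  have uc: "u \<in> carrier G" using i y by simp
  have ga: "g \<otimes> y [^] n \<otimes> inv g = y [^] (a * n)" for n :: nat
    using conj_pow[OF g y, of n] unfolding a nat_pow_pow[OF y] .
  have hb: "h \<otimes> y [^] n \<otimes> inv h = y [^] (b * n)" for n :: nat
    using conj_pow[OF h y, of n] unfolding b nat_pow_pow[OF y] .
  have "(g \<otimes> h) \<otimes> u \<otimes> inv (g \<otimes> h) = g \<otimes> (h \<otimes> u \<otimes> inv h) \<otimes> inv g"
    using g h uc by (simp add: m_assoc inv_mult_group)
  also have "\<dots> = h \<otimes> (g \<otimes> u \<otimes> inv g) \<otimes> inv h"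
    unfolding i ga hb by (simp add: mult.left_commute)
  also have "\<dots> = (h \<otimes> g) \<otimes> u \<otimes> inv (h \<otimes> g)"
    using g h uc by (simp add: m_assoc inv_mult_group)
  finally show ?thesis .
qed

text \<open>Conjugations by g and h are power maps on \<open>cyc y\<close> and commute there;
  \<open>cyclic_aut_commute\<close> is applied to \<open>?u\<close>, the preimage of y under
  conjugation by h g.\<close>

lemma commutator_centralizes_cyclic:
  assumes y: "y \<in> carrier G" and g: "g \<in> carrier G" and h: "h \<in> carrier G"
    and gy: "g \<otimes> y \<otimes> inv g \<in> cyc y" "inv g \<otimes> y \<otimes> g \<in> cyc y"
    and hy: "h \<otimes> y \<otimes> inv h \<in> cyc y" "inv h \<otimes> y \<otimes> h \<in> cyc y"
  shows "(g \<otimes> h \<otimes> inv g \<otimes> inv h) \<otimes> y = y \<otimes> (g \<otimes> h \<otimes> inv g \<otimes> inv h)"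
proof -
  let ?u = "inv (h \<otimes> g) \<otimes> y \<otimes> (h \<otimes> g)"
  have eq: "?u = inv g \<otimes> (inv h \<otimes> y \<otimes> h) \<otimes> inv (inv g)"
    using y g h by (simp add: m_assoc inv_mult_group)
  have "cyc (inv h \<otimes> y \<otimes> h) \<subseteq> cyc y" using cyc_sub[OF cyc_subgroup[OF y] hy(2)] .
  moreover have "?u \<in> cyc (inv h \<otimes> y \<otimes> h)"
    unfolding eq using cyclic_normalizer[OF y _ _ hy(2), of "inv g"] gy(2) g by simp
  ultimately have "?u \<in> cyc y" by blast
  from cyclic_aut_commute[OF y g h gy(1) hy(1) this]
  have "(g \<otimes> h) \<otimes> ?u \<otimes> inv (g \<otimes> h) = y"
    using y g h by (simp add: m_assoc inv_mult_group inv_cancel)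
  moreover have "(g \<otimes> h) \<otimes> ?u \<otimes> inv (g \<otimes> h)
      = (g \<otimes> h \<otimes> inv g \<otimes> inv h) \<otimes> y \<otimes> inv (g \<otimes> h \<otimes> inv g \<otimes> inv h)"
    using y g h by (simp add: m_assoc inv_mult_group)
  ultimately show ?thesis
    using conj_eq_iff[of "g \<otimes> h \<otimes> inv g \<otimes> inv h" y] y g h by simp
qed

text \<open>|C : P \<inter> C| = |PC : P| divides |H : P|.\<close>

lemma normal_sylow_Int:
  assumes "sylow_in p H P" "prime p" "subgroup H G" "normal_in H P" "subgroup C G" "C \<subseteq> H"
  shows "sylow_in p C (P \<inter> C)"
proof -
  have P: "subgroup P G" "P \<subseteq> H" "\<not> p dvd card H div card P" using assms by (auto simp: sylow_in_def)
  obtain k where k: "card P = p ^ k" using assms by (auto simp: sylow_in_def)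
  have I: "subgroup (P \<inter> C) G" using subgroups_Inter_pair P(1) assms(5) by blast
  have J: "subgroup (P <#> C) G"
    using join_subgroup[OF P(1) assms(5)] assms(4,6) unfolding normal_in_def by blast
  have JH: "P <#> C \<subseteq> H" using join_sub[OF assms(3) P(2) assms(6)] .
  have PJ: "P \<subseteq> P <#> C" using join_sup[OF P(1) assms(5)] by blast
  have "card (P <#> C) * card (P \<inter> C) = card P * card C" using join_card[OF P(1) assms(5) J] .
  then have "card P * (card (P <#> C) div card P) * card (P \<inter> C)
      = card P * (card C div card (P \<inter> C)) * card (P \<inter> C)"
    using idx_mult[OF P(1) J PJ] idx_mult[OF I assms(5)] by (simp add: mult.assoc mult.commute[of _ "card (P \<inter> C)"])
  then have "card C div card (P \<inter> C) = card (P <#> C) div card P"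
    using sub_card_pos[OF P(1)] sub_card_pos[OF I] by simp
  then have "card C div card (P \<inter> C) dvd card H div card P"
    using idx_dvd1[OF P(1) J assms(3) PJ JH] by simp
  then have "\<not> p dvd card C div card (P \<inter> C)" using P(3) dvd_trans by blast
  moreover obtain j where "card (P \<inter> C) = p ^ j"
    using pgroup_dvd[OF assms(2)] sub_card_dvd[OF I P(1)] k by (metis Int_lower1)
  ultimately show ?thesis using I by (auto simp: sylow_in_def)
qed

lemma prime_order_cyc_eq:
  assumes "x \<in> carrier G" "prime (ord x)" "y \<in> cyc x" "y \<noteq> \<one>"
  shows "cyc y = cyc x"
proof -
  have c: "subgroup (cyc x) G" using cyc_subgroup assms by blast
  then have yc: "y \<in> carrier G" using assms subgroup.mem_carrier by metis
  have "ord y dvd ord x" using ord_dvd_sub[OF c assms(3)] cyc_card[OF assms(1)] by simp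
  moreover have "ord y \<noteq> 1" using ord_eq_1 yc assms(4) by blast
  ultimately have "ord y = ord x" using assms(2) by (metis prime_nat_iff)
  then show ?thesis
    using sub_card_eq[OF cyc_subgroup[OF yc] c cyc_sub[OF c assms(3)]] cyc_card yc assms(1) by simp
qed

lemma prime_order_cyc_Int:
  assumes "x \<in> carrier G" "prime (ord x)" "subgroup A G" "x \<notin> A"
  shows "A \<inter> cyc x = {\<one>}"
proof -
  have "y = \<one>" if y: "y \<in> A" "y \<in> cyc x" for y
  proof (rule ccontr)
    assume "y \<noteq> \<one>"
    then have "cyc y = cyc x" using prime_order_cyc_eq assms y by blast
    then show False using cyc_sub[OF assms(3) y(1)] cyc_self[OF assms(1)] assms(4) by blast
  qed
  then show ?thesis using subgroup.one_closed[OF assms(3)] subgroup.one_closed[OF cyc_subgroup[OF assms(1)]] by blast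
qed

text \<open>If a prime q divided |D : E|, Cauchy would give an element of order q in D, hence in E;
  then q would divide both |E| and |D : E|, and q^2 would divide |D|.\<close>

lemma all_prime_order_imp_eq:
  assumes D: "subgroup D G" and E: "subgroup E G" "E \<subseteq> D"
    and sf: "\<And>q. prime q \<Longrightarrow> \<not> q ^ 2 dvd card D"
    and pr: "\<And>x. x \<in> D \<Longrightarrow> prime (ord x) \<Longrightarrow> x \<in> E"
  shows "D = E"
proof (rule ccontr)
  assume "D \<noteq> E"
  let ?n = "card D div card E"
  have nE: "card E * ?n = card D" using idx_mult[OF E(1) D E(2)] .
  have "?n \<noteq> 1" using nE sub_card_eq[OF E(1) D E(2)] \<open>D \<noteq> E\<close> by auto
  then obtain q where q: "prime q" "q dvd ?n" using prime_factor_nat by blast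
  have "q dvd card E * ?n" using q(2) by (rule dvd_mult)
  then have qD: "q dvd card D" using nE by simp
  obtain x where x: "x \<in> D" "ord x = q" using cauchy[OF q(1) D qD] .
  then have "x \<in> E" using pr q(1) by simp
  from ord_dvd_sub[OF E(1) this] have "q dvd card E" unfolding x(2) .
  then have "q * q dvd card E * ?n" using q(2) by (rule mult_dvd_mono)
  then show False using sf[OF q(1)] nE unfolding power2_eq_square by metis
qed

end

section \<open>The structure of groups with all subgroups embedded\<close>

context sigma_group
begin

definition isolated :: "nat \<Rightarrow> nat \<Rightarrow> bool" where
  "isolated n q \<longleftrightarrow> \<not> q ^ 2 dvd n \<and> (\<forall>r. prime r \<longrightarrow> r dvd n \<longrightarrow> same q r \<longrightarrow> r = q)"

text \<open>
  The last but one condition, \<open>C\<^sub>D(M) = 1\<close>, is what singles out the \<open>\<sigma>\<close>-nilpotent residual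
  among the possible subgroups \<open>D\<close>.
\<close>

definition split_cyclic_dedekind :: "'a set \<Rightarrow> 'a set \<Rightarrow> 'a set \<Rightarrow> bool" where
  "split_cyclic_dedekind H D M \<longleftrightarrow> normal_in H D \<and> subgroup M G \<and> D <#> M = H \<and> D \<inter> M = {\<one>}
     \<and> (\<exists>d\<in>carrier G. D = cyc d)
     \<and> (\<forall>q. prime q \<longrightarrow> q dvd card D \<longrightarrow> isolated (card H) q)
     \<and> (\<forall>x\<in>D. (\<forall>m\<in>M. m \<otimes> x = x \<otimes> m) \<longrightarrow> x = \<one>)
     \<and> (\<forall>A. subgroup A G \<longrightarrow> A \<subseteq> M \<longrightarrow> normal_in M A)"

text \<open>The product of \<open>cyc a\<close> and \<open>cyc g\<close> has order divisible by p
  but not by p^2. Its witness N inherits this, so P \<inter> N = \<open>cyc a\<close>, and the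
  commutator lies in both P and N. As a varies, g acts trivially on P modulo every subgroup of order
  p.\<close>

lemma pprime_acts_mod_order_p:
  assumes emb: "all_emb H" and H: "subgroup H G" and p: "prime p" and P: "normal_in H P" "card P = p ^ k"
    and a: "a \<in> P" "ord a = p" and g: "g \<in> H" "coprime (ord g) p" and x: "x \<in> P"
  shows "g \<otimes> x \<otimes> inv g \<otimes> inv x \<in> cyc a"
proof -
  have Ps: "subgroup P G" "P \<subseteq> H" using P by (auto simp: normal_in_def)
  have ac: "a \<in> carrier G" and gc: "g \<in> carrier G" and xc: "x \<in> carrier G"
    using a g x Ps H subgroup.mem_carrier by metis+
  let ?A = "cyc a"
  let ?B = "?A <#> cyc g"
  have A: "subgroup ?A G" "?A \<subseteq> P" "card ?A = p"
    using cyc_subgroup[OF ac] cyc_sub[OF Ps(1) a(1)] cyc_card[OF ac] a(2) by auto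
  have An: "normal_in H ?A" using normal_psub_cyc[OF emb H P(1) p P(2) a(1)] .
  have cg: "subgroup (cyc g) G" "cyc g \<subseteq> H" using cyc_subgroup[OF gc] cyc_sub[OF H g(1)] by auto
  have B: "subgroup ?B G"
    using join_subgroup[OF A(1) cg(1)] An cg(2) unfolding normal_in_def by blast
  have AB: "?A \<subseteq> ?B" "cyc g \<subseteq> ?B" using join_sup[OF A(1) cg(1)] by auto
  have BH: "?B \<subseteq> H" using join_sub[OF H _ cg(2)] A(2) Ps(2) by blast
  obtain N where N: "emb_via H N ?B" using emb B BH unfolding all_emb_def by blast
  have Nn: "normal_in H N" "subgroup N G" "?B \<subseteq> N" using N by (auto simp: emb_via_def normal_in_def)
  have "p dvd card ?B" using sub_card_dvd[OF A(1) B AB(1)] A(3) by simp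
  then have np: "\<not> p dvd card N div card ?B" using emb_via_prime[OF N p] by blast
  have "card ?B dvd p * ord g"
    using join_card[OF A(1) cg(1) B] A(3) cyc_card[OF gc] by (metis dvd_triv_left)
  have np2: "\<not> p * p dvd card N"
  proof
    assume "p * p dvd card N"
    then have "p * p dvd card ?B * (card N div card ?B)" using idx_mult[OF B Nn(2,3)] by simp
    moreover have "coprime (p * p) (card N div card ?B)" using prime_imp_coprime[OF p np] by simp
    ultimately have "p * p dvd card ?B" using coprime_dvd_mult_left_iff by blast
    then have "p * p dvd p * ord g" using \<open>card ?B dvd p * ord g\<close> dvd_trans by blast
    then have "p dvd ord g" using p by simp
    then show False using g(2) p by (metis coprime_absorb_right not_prime_unit)
  qed
  have I: "subgroup (P \<inter> N) G" using subgroups_Inter_pair Ps(1) Nn(2) by blast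
  have AI: "?A \<subseteq> P \<inter> N" using A(2) AB(1) Nn(3) by blast
  obtain j where j: "card (P \<inter> N) = p ^ j"
    using pgroup_dvd[OF p] sub_card_dvd[OF I Ps(1)] P(2) by (metis Int_lower1)
  have "\<not> p * p dvd p ^ j"
    using np2 sub_card_dvd[OF I Nn(2)] j by (metis Int_lower2 dvd_trans)
  then have "j < 2" using le_imp_power_dvd[of 2 j p] by (metis not_less power2_eq_square)
  moreover have "p dvd p ^ j" using sub_card_dvd[OF A(1) I AI] A(3) j by simp
  then have "j \<noteq> 0" using p by (metis not_prime_unit power_0)
  ultimately have "card (P \<inter> N) = p" using j by (simp add: less_2_cases_iff)
  then have PN: "?A = P \<inter> N" using sub_card_eq[OF A(1) I AI] A(3) by simp
  have "g \<in> N" using cyc_self[OF gc] AB(2) Nn(3) by blast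
  then have "g \<otimes> x \<otimes> inv g \<otimes> inv x \<in> N" using normal_in_commutator[OF Nn(1) _ _ H] x Ps(2) by blast
  moreover have "g \<otimes> x \<otimes> inv g \<in> P" using P(1) g x by (auto simp: normal_in_def)
  then have "g \<otimes> x \<otimes> inv g \<otimes> inv x \<in> P"
    using x subgroup.m_closed[OF Ps(1)] subgroup.m_inv_closed[OF Ps(1)] by blast
  ultimately show ?thesis using PN by blast
qed

text \<open>
  The commutator \<open>a\<close> of \<open>g\<close> and \<open>x\<close> is a \<open>p\<close>-element of \<open>\<langle>x\<rangle>\<close> that commutes with \<open>g\<close>, so that
  conjugation by \<open>g\<^sup>n\<close> maps \<open>x\<close> to \<open>a\<^sup>n x\<close>.
\<close>

lemma pprime_commutes_order_ge_p2:
  assumes p: "prime p" and x: "x \<in> carrier G" "p * p dvd ord x" and g: "g \<in> carrier G" "coprime (ord g) p"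
    and c: "g \<otimes> x \<otimes> inv g \<otimes> inv x \<in> cyc (x [^] (ord x div p))"
  shows "g \<otimes> x = x \<otimes> g"
proof -
  let ?m = "ord x div p"
  let ?b = "x [^] ?m"
  define a where "a = g \<otimes> x \<otimes> inv g \<otimes> inv x"
  have px: "p dvd ord x" using x(2) by (metis dvd_mult_left)
  have pm: "p dvd ?m" using x(2) p by (metis dvd_div_iff_mult dvd_mult_left not_prime_0)
  have bc: "?b \<in> carrier G" using x by simp
  have ob: "ord ?b = p" using ord_pow_prime[OF x(1) p px] .
  obtain i :: nat where i: "a = ?b [^] i" using c unfolding a_def cyc_def by blast
  have ac: "a \<in> carrier G" using i bc by simp
  have ap: "a [^] p = \<one>"
    using pow_card_sub[OF cyc_subgroup[OF bc], of a] c cyc_card[OF bc] ob by (simp add: a_def)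
  have gx: "g \<otimes> x \<otimes> inv g = a \<otimes> x" using g x by (simp add: a_def m_assoc)
  have ax: "a \<otimes> x = x \<otimes> a"
    unfolding i nat_pow_pow[OF x(1)] using x by (metis nat_pow_Suc nat_pow_Suc2)
  \<comment> \<open>p divides \<open>?m\<close> because p^2 divides the order of x; hence
    conjugation by g fixes \<open>?b\<close> and with it a.\<close>
  have am: "a [^] ?m = \<one>" using ap pm ac by (metis dvd_trans pow_eq_id)
  have "g \<otimes> ?b \<otimes> inv g = (a \<otimes> x) [^] ?m" unfolding gx[symmetric] using conj_pow g x by blast
  also have "\<dots> = a [^] ?m \<otimes> x [^] ?m" using pow_mult_distrib[OF ax ac x(1)] .
  also have "\<dots> = ?b" using am bc by simp
  finally have "g \<otimes> ?b = ?b \<otimes> g" using conj_eq_iff g bc by blast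
  then have "g \<otimes> a = a \<otimes> g" using commutes_cyc[OF bc g(1), of a] i by (auto simp: cyc_def)
  then have ga: "g \<otimes> a \<otimes> inv g = a" using conj_eq_iff g ac by blast
  have it: "g [^] n \<otimes> x \<otimes> inv (g [^] n) = a [^] n \<otimes> x" for n :: nat
  proof (induction n)
    case (Suc n)
    have "g [^] Suc n \<otimes> x \<otimes> inv (g [^] Suc n) = g \<otimes> (g [^] n \<otimes> x \<otimes> inv (g [^] n)) \<otimes> inv g"
      using g x unfolding nat_pow_Suc2[OF g(1)] by (simp add: m_assoc inv_mult_group)
    also have "\<dots> = (g \<otimes> a [^] n \<otimes> inv g) \<otimes> (g \<otimes> x \<otimes> inv g)"
      unfolding Suc using conj_mult g ac x by simp
    also have "g \<otimes> a [^] n \<otimes> inv g = a [^] n" using conj_pow[OF g(1) ac] ga by simp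
    finally show ?case using gx ac x by (simp add: m_assoc)
  qed (use g x in simp)
  have "a [^] ord g \<otimes> x = x" using it[of "ord g"] g x by simp
  then have "a [^] ord g = \<one>" using r_cancel_one[of x "a [^] ord g"] ac x by simp
  then have "a = \<one>" using coprime_pow_one[OF ac _ ap g(2)] by blast
  then show ?thesis using commutator_one_iff g x unfolding a_def by blast
qed

text \<open>Elements of order divisible by p^2 commute with g by the preceding lemma. An element x
  of order p is either a power of such an element, or P has a second subgroup of order p and the
  commutator of g and x lies in both, hence is trivial. The condition |P| \<noteq> p supplies an
  element outside \<open>cyc x\<close>.\<close>

lemma pprime_centralizes:
  assumes emb: "all_emb H" and H: "subgroup H G" and p: "prime p" and P: "normal_in H P" "card P = p ^ k"
    and np: "card P \<noteq> p" and g: "g \<in> H" "coprime (ord g) p" and x: "x \<in> P"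
  shows "g \<otimes> x = x \<otimes> g"
proof -
  have Ps: "subgroup P G" "P \<subseteq> H" using P by (auto simp: normal_in_def)
  have gc: "g \<in> carrier G" using g H subgroup.mem_carrier by metis
  have Pc: "y \<in> carrier G" if "y \<in> P" for y using that Ps subgroup.mem_carrier by metis
  have mod: "g \<otimes> y \<otimes> inv g \<otimes> inv y \<in> cyc a" if "a \<in> P" "ord a = p" "y \<in> P" for a y
    using pprime_acts_mod_order_p[OF emb H p P that(1,2) g that(3)] .
  have ord: "y = \<one> \<or> ord y = p \<or> p * p dvd ord y" if y: "y \<in> P" for y
  proof -
    obtain j where j: "ord y = p ^ j" using pgroup_dvd[OF p] ord_dvd_sub[OF Ps(1) y] P(2) by metis
    consider "j = 0" | "j = 1" | "2 \<le> j" by linarith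
    then show ?thesis
    proof cases
      case 1
      then show ?thesis using j ord_eq_1[OF Pc[OF y]] by simp
    next
      case 3
      then show ?thesis using j le_imp_power_dvd[of 2 j p] by (simp add: power2_eq_square)
    qed (use j in simp)
  qed
  have big: "g \<otimes> y = y \<otimes> g" if y: "y \<in> P" "p * p dvd ord y" for y
  proof -
    have "p dvd ord y" using y(2) by (metis dvd_mult_left)
    then have "ord (y [^] (ord y div p)) = p" using ord_pow_prime[OF Pc[OF y(1)] p] by blast
    then show ?thesis
      using pprime_commutes_order_ge_p2[OF p Pc[OF y(1)] y(2) gc g(2)] mod sub_nat_pow[OF Ps(1) y(1)] y(1) by blast
  qed
  consider "x = \<one>" | "ord x = p" | "p * p dvd ord x" using ord[OF x] by blast
  then show ?thesis
  proof cases
    case 1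
    then show ?thesis using gc by simp
  next
    case 2
    have cx: "card (cyc x) = p" "cyc x \<subseteq> P" using cyc_card[OF Pc[OF x]] 2 cyc_sub[OF Ps(1) x] by auto
    then have "cyc x \<noteq> P" using np by metis
    then obtain y where y: "y \<in> P" "y \<notin> cyc x" using cx(2) by blast
    have "y \<noteq> \<one>" using y subgroup.one_closed[OF cyc_subgroup[OF Pc[OF x]]] by blast
    have other: "g \<otimes> x = x \<otimes> g" if z: "z \<in> P" "ord z = p" "z \<notin> cyc x" for z
    proof -
      have "cyc x \<inter> cyc z = {\<one>}"
        using prime_order_cyc_Int[OF Pc[OF z(1)] _ cyc_subgroup[OF Pc[OF x]] z(3)] p z(2) by simp
      moreover have "g \<otimes> x \<otimes> inv g \<otimes> inv x \<in> cyc x \<inter> cyc z" using mod[OF x 2 x] mod[OF z(1,2) x] by blast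
      ultimately show ?thesis using commutator_one_iff[OF gc Pc[OF x]] by blast
    qed
    show ?thesis
    proof (cases "ord y = p")
      case True
      then show ?thesis using other y by blast
    next
      case False
      then have py: "p * p dvd ord y" using ord[OF y(1)] \<open>y \<noteq> \<one>\<close> by blast
      let ?z = "y [^] (ord y div p)"
      have "p dvd ord y" using py by (metis dvd_mult_left)
      then have oz: "ord ?z = p" using ord_pow_prime[OF Pc[OF y(1)] p] by blast
      have zP: "?z \<in> P" using sub_nat_pow[OF Ps(1) y(1)] .
      show ?thesis
      proof (cases "?z \<in> cyc x")
        case True
        have "?z \<noteq> \<one>" using oz p by (metis ord_id not_prime_1)
        then have "cyc ?z = cyc x" using prime_order_cyc_eq[OF Pc[OF x] _ True] 2 p by simp
        then have "x \<in> cyc ?z" using cyc_self[OF Pc[OF x]] by simp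
        moreover have "cyc ?z \<subseteq> cyc y"
          using cyc_sub[OF cyc_subgroup[OF Pc[OF y(1)]]] by (auto simp: cyc_def)
        ultimately show ?thesis using commutes_cyc[OF Pc[OF y(1)] gc big[OF y(1) py]] by blast
      next
        case False
        then show ?thesis using other[OF zP oz] by blast
      qed
    qed
  next
    case 3
    then show ?thesis using big[OF x] by blast
  qed
qed

lemma normal_psub_all_normal:
  assumes "all_emb H" "subgroup H G" "normal_in H K" "prime s" "card K = s ^ k" "subgroup A G" "A \<subseteq> K"
  shows "normal_in H A"
proof -
  have K: "subgroup K G" "K \<subseteq> H" using assms by (auto simp: normal_in_def)
  have "h \<otimes> n \<otimes> inv h \<in> A" if "h \<in> H" "n \<in> A" for h n
  proof -
    have nc: "n \<in> carrier G" using that assms subgroup.mem_carrier by metis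
    have "normal_in H (cyc n)" using normal_psub_cyc[OF assms(1-5)] that assms(7) by blast
    then show ?thesis using that cyc_self[OF nc] cyc_sub[OF assms(6) that(2)] unfolding normal_in_def by blast
  qed
  then show ?thesis using assms K by (auto simp: normal_in_def)
qed

text \<open>P need not be abelian, so the complement is taken inside the centralizer C of P: C
  contains all p'-elements, hence PC = H, and P \<inter> C, the centre of P, is an abelian normal
  Hall subgroup of C.\<close>

lemma complement_of_centralized_sylow:
  assumes H: "subgroup H G" and p: "prime p" and P: "normal_in H P" and syl: "sylow_in p H P"
    and cen: "\<And>g x. \<lbrakk>g \<in> H; coprime (ord g) p; x \<in> P\<rbrakk> \<Longrightarrow> g \<otimes> x = x \<otimes> g"
  obtains X where "subgroup X G" "X \<subseteq> H" "P \<inter> X = {\<one>}" "P <#> X = H" "\<And>u x. \<lbrakk>u \<in> P; x \<in> X\<rbrakk> \<Longrightarrow> x \<otimes> u = u \<otimes> x"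
proof -
  have Ps: "subgroup P G" "P \<subseteq> H" using P by (auto simp: normal_in_def)
  note Hc = subgroup.mem_carrier[OF H]
  have Pc: "y \<in> carrier G" if "y \<in> P" for y using that Ps subgroup.mem_carrier by metis
  let ?C = "{h \<in> H. \<forall>u\<in>P. h \<otimes> u = u \<otimes> h}"
  have C: "subgroup ?C G"
  proof (rule subgroupI)
    show "?C \<subseteq> carrier G" using Hc by auto
    show "?C \<noteq> {}" using subgroup.one_closed[OF H] Pc by force
    show "inv a \<in> ?C" if a: "a \<in> ?C" for a
      using commute_inv[of a] a Hc[of a] Pc subgroup.m_inv_closed[OF H, of a] by simp
    show "a \<otimes> b \<in> ?C" if a: "a \<in> ?C" and b: "b \<in> ?C" for a b
      using commute_mult[of a b] a b Hc[of a] Hc[of b] Pc subgroup.m_closed[OF H, of a b] by simp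
  qed
  have CH: "?C \<subseteq> H" by blast
  have sylC: "sylow_in p ?C (P \<inter> ?C)" using normal_sylow_Int[OF syl p H P C CH] .
  have "normal_in ?C (P \<inter> ?C)" using normal_in_inter_sub[OF P C CH] .
  then obtain X where X: "subgroup X G" "X \<subseteq> ?C" "(P \<inter> ?C) \<inter> X = {\<one>}" "(P \<inter> ?C) <#> X = ?C"
    using abelian_normal_hall_complement[OF C _ _ sylow_in_coprime[OF sylC p]] by blast
  obtain k where k: "card P = p ^ k" using syl by (auto simp: sylow_in_def)
  have "H \<subseteq> P <#> X"
  proof
    fix h assume h: "h \<in> H"
    let ?r = "card H div card P"
    have cop: "coprime (card P) ?r" using sylow_in_coprime[OF syl p] .
    obtain i j :: nat where ij: "h = h [^] i \<otimes> h [^] j" "(h [^] i) [^] card P = \<one>" "(h [^] j) [^] ?r = \<one>"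
      using sylow_in_split[OF syl p H h] .
    have hi: "h [^] i \<in> P" using normal_hall_eq[OF P H cop] ij(2) sub_nat_pow[OF H h] by blast
    have "ord (h [^] j) dvd ?r" using ij(3) pow_eq_id Hc[OF h] by simp
    moreover have "\<not> p dvd ?r" using syl by (simp add: sylow_in_def)
    then have "coprime ?r p" using prime_imp_coprime[OF p] coprime_commute by blast
    ultimately have "coprime (ord (h [^] j)) p" using coprime_divisors[OF _ dvd_refl] by blast
    then have "h [^] j \<in> ?C" using cen sub_nat_pow[OF H h] by blast
    then obtain u x where ux: "h [^] j = u \<otimes> x" "u \<in> P" "x \<in> X" using X(4) unfolding set_mult_def by blast
    then have "h = (h [^] i \<otimes> u) \<otimes> x"
      using ij(1) Pc[OF ux(2)] Pc[OF hi] X(1) subgroup.mem_carrier by (metis m_assoc)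
    then show "h \<in> P <#> X" using ux subgroup.m_closed[OF Ps(1) hi ux(2)] unfolding set_mult_def by blast
  qed
  moreover have "P <#> X \<subseteq> H" using join_sub[OF H Ps(2)] X(2) by blast
  moreover have "P \<inter> X = {\<one>}" using X(2,3) by blast
  ultimately show ?thesis using that[of X] X by blast
qed

text \<open>M does not centralize x, and it normalizes \<open>cyc x\<close> because D is cyclic and
  normal. So some commutator is a nontrivial element of \<open>cyc x\<close>, and prime order makes
  it a generator.\<close>

lemma prime_order_in_commutator:
  assumes scd: "split_cyclic_dedekind H D M" and H: "subgroup H G" and x: "x \<in> D" "prime (ord x)"
  obtains m where "m \<in> M" "x \<in> cyc (m \<otimes> x \<otimes> inv m \<otimes> inv x)"
proof -
  have D: "normal_in H D" "D \<subseteq> H" and M: "subgroup M G" "M \<subseteq> H"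
    using scd join_sup[of D M] unfolding split_cyclic_dedekind_def normal_in_def by auto
  have xc: "x \<in> carrier G" using x(1) D(2) subgroup.mem_carrier[OF H] by blast
  obtain d where d: "d \<in> carrier G" "D = cyc d" using scd unfolding split_cyclic_dedekind_def by blast
  have "x \<noteq> \<one>" using x(2) by (metis ord_id not_prime_1)
  then obtain m where m: "m \<in> M" "m \<otimes> x \<noteq> x \<otimes> m"
    using scd x(1) unfolding split_cyclic_dedekind_def by blast
  have mc: "m \<in> carrier G" using m(1) subgroup.mem_carrier[OF M(1)] by blast
  let ?c = "m \<otimes> x \<otimes> inv m \<otimes> inv x"
  have "m \<otimes> d \<otimes> inv m \<in> cyc d"
    using D(1) m(1) M(2) cyc_self[OF d(1)] d(2) unfolding normal_in_def by blast
  then have "m \<otimes> x \<otimes> inv m \<in> cyc x" using cyclic_normalizer[OF d(1) mc] x(1) d(2) by blast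
  then have "?c \<in> cyc x"
    using cyc_self[OF xc] cyc_subgroup[OF xc] by (meson subgroup.m_closed subgroup.m_inv_closed)
  moreover have "?c \<noteq> \<one>" using commutator_one_iff[OF mc xc] m(2) by blast
  ultimately have "x \<in> cyc ?c" using prime_order_cyc_eq[OF xc x(2)] cyc_self[OF xc] by blast
  then show ?thesis using that m(1) by blast
qed

lemma not_dvd_complement:
  assumes "isolated (a * b) q" "q dvd a" shows "\<not> q dvd b"
  using assms mult_dvd_mono[of q a q b] unfolding isolated_def power2_eq_square by blast

section \<open>The inductive step for H = P X\<close>

context
  fixes H P X D M :: "'a set" and p k :: nat
  assumes emb: "all_emb H" and H: "subgroup H G" and p: "prime p" and P: "normal_in H P" "card P = p ^ k"
    and X: "subgroup X G" "X \<subseteq> H" "P \<inter> X = {\<one>}" "P <#> X = H" and pX: "\<not> p dvd card X"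
    and scd: "split_cyclic_dedekind X D M"
begin

private lemma
  shows Ps: "subgroup P G" "P \<subseteq> H"
    and D: "normal_in X D" "subgroup D G" "D \<subseteq> X" and M: "subgroup M G" and DM: "D <#> M = X" "D \<inter> M = {\<one>}"
    and Dcyc: "\<exists>d\<in>carrier G. D = cyc d"
    and Diso: "\<And>q. prime q \<Longrightarrow> q dvd card D \<Longrightarrow> isolated (card X) q"
    and Dcen: "\<And>x. x \<in> D \<Longrightarrow> (\<And>m. m \<in> M \<Longrightarrow> m \<otimes> x = x \<otimes> m) \<Longrightarrow> x = \<one>"
    and Mded: "\<And>A. subgroup A G \<Longrightarrow> A \<subseteq> M \<Longrightarrow> normal_in M A"
  using P scd unfolding split_cyclic_dedekind_def normal_in_def by auto

private lemmas
  Hc = subgroup.mem_carrier[OF H] and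
  Pc = subgroup.mem_carrier[OF Ps(1)] and
  Xc = subgroup.mem_carrier[OF X(1)]

private lemma MX: "M \<subseteq> X"
  using join_sup[OF D(2) M] DM(1) by blast

private lemma cH: "card H = card P * card X"
  using join_card[OF Ps(1) X(1)] X(3,4) H by simp

private lemma cX: "card X = card D * card M"
  using join_card[OF D(2) M] DM X(1) by simp

private lemma Pn: "u \<in> P \<Longrightarrow> h \<in> H \<Longrightarrow> h \<otimes> u \<otimes> inv h \<in> P"
  using P(1) unfolding normal_in_def by blast

private lemma product_in_X:
  assumes u: "u \<in> P" and v: "v \<in> X" and uv: "u \<otimes> v \<in> X"
  shows "u = \<one>"
proof -
  have "u = (u \<otimes> v) \<otimes> inv v" using Pc[OF u] Xc[OF v] by (simp add: m_assoc)
  also have "\<dots> \<in> X" by (rule subgroup.m_closed[OF X(1) uv subgroup.m_inv_closed[OF X(1) v]])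
  finally show ?thesis using X(3) u by blast
qed

private lemma D_prime:
  assumes "prime q" "q dvd card D"
  shows "q dvd card X" "q \<noteq> p"
  using assms(2) cX pX by auto

text \<open>D is kept and M grows to the direct product of P and M. The embedding hypothesis is used
  twice: no prime of |D| may lie in the class of p, and subgroups of P must be normal.\<close>

lemma split_central_sylow:
  assumes pP: "p dvd card P" and cen: "\<And>u x. \<lbrakk>u \<in> P; x \<in> X\<rbrakk> \<Longrightarrow> x \<otimes> u = u \<otimes> x"
  shows "split_cyclic_dedekind H D (P <#> M)"
proof -
  let ?M = "P <#> M"
  have Ms: "subgroup ?M G" using join_subgroup[OF Ps(1) M] Pn MX X(2) by blast
  have MH: "?M \<subseteq> H" using join_sub[OF H Ps(2)] MX X(2) by blast
  have sup: "P \<subseteq> ?M" "M \<subseteq> ?M" using join_sup[OF Ps(1) M] by auto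
  have conjH: "h \<otimes> y \<otimes> inv h = x \<otimes> y \<otimes> inv x"
    if "h = u \<otimes> x" "u \<in> P" "x \<in> X" "y \<in> X" for h u x y
  proof -
    let ?w = "x \<otimes> y \<otimes> inv x"
    have w: "?w \<in> X" using that X(1) by (meson subgroup.m_closed subgroup.m_inv_closed)
    have "h \<otimes> y \<otimes> inv h = u \<otimes> ?w \<otimes> inv u"
      using that Pc Xc by (simp add: m_assoc inv_mult_group)
    then show ?thesis using cen[OF that(2) w] conj_eq_iff[of u ?w] Pc[OF that(2)] Xc[OF w] by simp
  qed
  have Dn: "normal_in H D"
    unfolding normal_in_def
  proof (intro conjI ballI)
    fix h n assume h: "h \<in> H" and n: "n \<in> D"
    obtain u x where ux: "h = u \<otimes> x" "u \<in> P" "x \<in> X" using h X(4) unfolding set_mult_def by blast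
    then show "h \<otimes> n \<otimes> inv h \<in> D" using conjH[OF ux] D(1,3) n unfolding normal_in_def by (metis subsetD)
  qed (use D X in auto)
  have DMH: "D <#> ?M = H"
  proof
    show "D <#> ?M \<subseteq> H" using join_sub[OF H _ MH] D(3) X(2) by blast
    show "H \<subseteq> D <#> ?M"
    proof
      fix h assume h: "h \<in> H"
      obtain u x where ux: "h = u \<otimes> x" "u \<in> P" "x \<in> X" using h X(4) unfolding set_mult_def by blast
      obtain d m where dm: "x = d \<otimes> m" "d \<in> D" "m \<in> M" using ux(3) DM(1) unfolding set_mult_def by blast
      have c: "u \<in> carrier G" "d \<in> carrier G" "m \<in> carrier G"
        using Pc[OF ux(2)] Xc dm D(3) MX by auto
      have "d \<otimes> u = u \<otimes> d" using cen[OF ux(2)] dm(2) D(3) by blast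
      then have "h = d \<otimes> (u \<otimes> m)" using ux(1) dm(1) c by (metis m_assoc)
      then show "h \<in> D <#> ?M" using ux(2) dm unfolding set_mult_def by blast
    qed
  qed
  have DMi: "D \<inter> ?M = {\<one>}"
  proof -
    have "z = \<one>" if z: "z \<in> D" "z \<in> ?M" for z
    proof -
      obtain u m where um: "z = u \<otimes> m" "u \<in> P" "m \<in> M" using z(2) unfolding set_mult_def by blast
      have mX: "m \<in> X" and zX: "z \<in> X" using um MX z D(3) by auto
      have "u = \<one>" using product_in_X[OF um(2) mX] um(1) zX by simp
      then have "z \<in> D \<inter> M" using um z(1) Xc[OF mX] by simp
      then show ?thesis using DM(2) by blast
    qed
    then show ?thesis using subgroup.one_closed[OF D(2)] subgroup.one_closed[OF Ms] by blast
  qed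
  have qfact: "\<not> q dvd card P" "\<not> q dvd card M" if q: "prime q" "q dvd card D" for q
  proof -
    show "\<not> q dvd card P" using D_prime(2)[OF q] q(1) p P(2) by (metis prime_dvd_power primes_dvd_imp_eq)
    show "\<not> q dvd card M" using not_dvd_complement Diso[OF q] q(2) unfolding cX by blast
  qed
  \<comment> \<open>If q and p shared a class, the witness N of \<open>?M\<close> would have order
    prime to q, as p divides the order of \<open>?M\<close> and q does not. But N contains m, hence
    the commutator of m and x, hence x of order q.\<close>
  have nsame: "\<not> same q p" if q: "prime q" "q dvd card D" for q
  proof
    assume s: "same q p"
    obtain x where x: "x \<in> D" "ord x = q" using cauchy[OF q(1) D(2) q(2)] .
    obtain m where m: "m \<in> M" "x \<in> cyc (m \<otimes> x \<otimes> inv m \<otimes> inv x)"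
      using prime_order_in_commutator[OF scd X(1) x(1)] x(2) q(1) by blast
    obtain N where N: "emb_via H N ?M" using emb Ms MH unfolding all_emb_def by blast
    have Nn: "normal_in H N" "subgroup N G" "?M \<subseteq> N" using N by (auto simp: emb_via_def normal_in_def)
    have "p dvd card ?M" using sub_card_dvd[OF Ps(1) Ms sup(1)] pP dvd_trans by blast
    then have "\<not> q dvd card N div card ?M" using N p q(1) same_sym[OF s] unfolding emb_via_def by blast
    moreover have "\<not> q dvd card ?M"
    proof
      assume "q dvd card ?M"
      then have "q dvd card P * card M" using join_card[OF Ps(1) M Ms] by (metis dvd_mult2)
      then show False using qfact[OF q] q(1) prime_dvd_mult_iff by blast
    qed
    ultimately have "\<not> q dvd card N"
      using idx_mult[OF Ms Nn(2,3)] q(1) prime_dvd_mult_iff by metis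
    moreover have "m \<otimes> x \<otimes> inv m \<otimes> inv x \<in> N"
      using normal_in_commutator[OF Nn(1) _ _ H] m(1) sup(2) Nn(3) x(1) D(3) X(2) by blast
    then have "x \<in> N" using cyc_sub[OF Nn(2)] m(2) by blast
    then have "q dvd card N" using ord_dvd_sub[OF Nn(2)] x(2) by blast
    ultimately show False by blast
  qed
  have iso: "isolated (card H) q" if q: "prime q" "q dvd card D" for q
    unfolding isolated_def
  proof (intro conjI allI impI)
    show "\<not> q\<^sup>2 dvd card H"
    proof
      assume "q\<^sup>2 dvd card H"
      moreover have "coprime (q\<^sup>2) (card P)" using prime_imp_coprime[OF q(1)] qfact[OF q] by simp
      ultimately have "q\<^sup>2 dvd card X" unfolding cH using coprime_dvd_mult_right_iff by blast
      then show False using Diso[OF q] by (simp add: isolated_def)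
    qed
    fix r assume r: "prime r" "r dvd card H" "same q r"
    then consider "r dvd card P" | "r dvd card X" unfolding cH using prime_dvd_mult_iff by blast
    then show "r = q"
    proof cases
      case 1
      then have "r = p" using r(1) p P(2) by (metis prime_dvd_power primes_dvd_imp_eq)
      then show ?thesis using nsame[OF q] r(3) by blast
    next
      case 2
      then show ?thesis using Diso[OF q] r unfolding isolated_def by blast
    qed
  qed
  \<comment> \<open>An element a of A is the product of its p-part and its p'-part, powers of a that
    lie in A \<inter> P and A \<inter> M. The first group is normal in H as a subgroup of P; the
    second is normal in M and centralized by P.\<close>
  have ded: "normal_in ?M A" if A: "subgroup A G" "A \<subseteq> ?M" for A
    unfolding normal_in_def
  proof (intro conjI ballI)
    fix g a assume g: "g \<in> ?M" and a: "a \<in> A"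
    have ac: "a \<in> carrier G" using a A subgroup.mem_carrier by metis
    have gc: "g \<in> carrier G" using g MH Hc by blast
    obtain v n where vn: "g = v \<otimes> n" "v \<in> P" "n \<in> M" using g unfolding set_mult_def by blast
    have pos: "card P > 0" "card X > 0" using sub_card_pos Ps X by auto
    have cop: "coprime (card P) (card X)" unfolding P(2) using prime_imp_coprime[OF p pX] by simp
    have "a [^] (card P * card X) = \<one>" unfolding cH[symmetric] using pow_card_sub[OF H] a A MH by blast
    then obtain i j :: nat where ij: "a = a [^] i \<otimes> a [^] j" "(a [^] i) [^] card P = \<one>" "(a [^] j) [^] card X = \<one>"
      using pow_split[OF ac _ cop pos] by blast
    have aA: "a [^] l \<in> A" for l :: nat using sub_nat_pow[OF A(1) a] .
    have aM: "\<exists>u m. a [^] l = u \<otimes> m \<and> u \<in> P \<and> m \<in> M" for l :: nat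
      using aA[of l] A(2) unfolding set_mult_def by blast
    have cumul: "(u \<otimes> m) [^] (l::nat) = u [^] l \<otimes> m [^] l" if "u \<in> P" "m \<in> M" for u m l
      using pow_mult_distrib[of u m l] cen[of u m] that Pc Xc MX by (metis subsetD)
    have ai: "a [^] i \<in> P"
    proof -
      obtain u m where um: "a [^] i = u \<otimes> m" "u \<in> P" "m \<in> M" using aM by blast
      have mX: "m \<in> X" using um MX by blast
      have "\<one> = m [^] card P"
        using cumul[OF um(2,3), of "card P"] um(1) ij(2) pow_card_sub[OF Ps(1) um(2)] Xc[OF mX] by simp
      then have "m [^] card P = \<one>" by (rule sym)
      then have "m = \<one>" using coprime_pow_one[OF Xc[OF mX] _ pow_card_sub[OF X(1) mX] cop] by blast
      then show ?thesis using um Pc by simp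
    qed
    have aj: "a [^] j \<in> M"
    proof -
      obtain u m where um: "a [^] j = u \<otimes> m" "u \<in> P" "m \<in> M" using aM by blast
      have mX: "m \<in> X" using um MX by blast
      have "\<one> = u [^] card X"
        using cumul[OF um(2,3), of "card X"] um(1) ij(3) pow_card_sub[OF X(1) mX] Pc[OF um(2)] by simp
      then have "u [^] card X = \<one>" by (rule sym)
      then have "u = \<one>" using coprime_pow_one[OF Pc[OF um(2)] pow_card_sub[OF Ps(1) um(2)] _ cop] by blast
      then show ?thesis using um Xc mX by simp
    qed
    have "normal_in H (A \<inter> P)"
      using normal_psub_all_normal[OF emb H P(1) p P(2)] subgroups_Inter_pair A(1) Ps(1) by blast
    then have 1: "g \<otimes> a [^] i \<otimes> inv g \<in> A" using ai aA[of i] g MH unfolding normal_in_def by blast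
    have "normal_in M (A \<inter> M)" using Mded subgroups_Inter_pair A(1) M by blast
    then have "n \<otimes> a [^] j \<otimes> inv n \<in> A" using aj aA[of j] vn(3) unfolding normal_in_def by blast
    then have 2: "g \<otimes> a [^] j \<otimes> inv g \<in> A" using conjH[OF vn(1,2)] vn(3) MX aj by (metis subsetD)
    have "g \<otimes> a \<otimes> inv g = (g \<otimes> a [^] i \<otimes> inv g) \<otimes> (g \<otimes> a [^] j \<otimes> inv g)"
      using conj_mult[OF gc, of "a [^] i" "a [^] j"] ij(1) ac by simp
    then show "g \<otimes> a \<otimes> inv g \<in> A" using subgroup.m_closed[OF A(1) 1 2] by simp
  qed (use A in auto)
  have "\<forall>x\<in>D. (\<forall>m\<in>?M. m \<otimes> x = x \<otimes> m) \<longrightarrow> x = \<one>" using Dcen sup(2) by blast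
  then show ?thesis
    unfolding split_cyclic_dedekind_def using Dn Ms DMH DMi Dcyc iso ded by blast
qed

text \<open>
  The automorphisms of the cyclic group \<open>P\<close> commute, so commutators in \<open>X\<close> centralize \<open>P\<close>; as \<open>D\<close> is
  generated by such commutators, \<open>P D\<close> is cyclic.
\<close>

lemma split_noncentral_sylow:
  assumes cP: "card P = p" and nc: "m0 \<in> X" "u0 \<in> P" "m0 \<otimes> u0 \<noteq> u0 \<otimes> m0"
  shows "split_cyclic_dedekind H (P <#> D) M"
proof -
  obtain y where y: "y \<in> P" "ord y = p" using cauchy[OF p Ps(1)] cP by auto
  note yc = Pc[OF y(1)]
  have Py: "P = cyc y"
    using sub_card_eq[OF cyc_subgroup[OF yc] Ps(1) cyc_sub[OF Ps(1) y(1)]] cyc_card[OF yc] y(2) cP by simp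
  have gen: "P = cyc u" if "u \<in> P" "u \<noteq> \<one>" for u
    using prime_order_cyc_eq[OF yc _ _ that(2)] y(2) p that(1) Py by simp
  have PC: "w \<otimes> u = u \<otimes> w" if "w \<otimes> y = y \<otimes> w" "w \<in> carrier G" "u \<in> P" for w u
    using commutes_cyc[OF yc that(2,1)] that(3) Py by blast
  \<comment> \<open>If a prime r dividing |X| lay in the class of p, the witness N of X would have
    order prime to p. Its element \<open>m0\<close> would then centralize P, against the choice of
    \<open>m0\<close> and \<open>u0\<close>.\<close>
  have isop: "isolated (card H) p"
    unfolding isolated_def
  proof (intro conjI allI impI)
    show "\<not> p\<^sup>2 dvd card H" unfolding cH cP power2_eq_square using pX p by simp
    fix r assume r: "prime r" "r dvd card H" "same p r"
    show "r = p"
    proof (rule ccontr)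
      assume "r \<noteq> p"
      then have rX: "r dvd card X" using r(1,2) p unfolding cH cP by (metis prime_dvd_mult_iff primes_dvd_imp_eq)
      obtain N where N: "emb_via H N X" using emb X unfolding all_emb_def by blast
      have Nn: "normal_in H N" "subgroup N G" "X \<subseteq> N" using N by (auto simp: emb_via_def normal_in_def)
      have "\<not> p dvd card N div card X" using N rX r(1) p same_sym[OF r(3)] unfolding emb_via_def by blast
      then have "\<not> p dvd card N" using idx_mult[OF X(1) Nn(2,3)] pX p prime_dvd_mult_iff by metis
      then have "coprime (ord y) (card N)" using prime_imp_coprime[OF p] y(2) by simp
      then have "m0 \<otimes> y = y \<otimes> m0"
        using commute_of_coprime_normal[OF Nn(1) H _ _ _, of m0 y] Nn(3) nc(1) y(1) Ps(2) Pn X(2) Py by blast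
      then show False using PC[OF _ Xc[OF nc(1)] nc(2)] nc(3) by blast
    qed
  qed
  obtain d where d: "d \<in> carrier G" "D = cyc d" using Dcyc by blast
  let ?C = "{x \<in> D. x \<otimes> y = y \<otimes> x}"
  have Cs: "subgroup ?C G"
  proof -
    have "normal_in D ?C"
      by (rule normal_in_centralizer[OF D(2) yc]) (use Pn y(1) D(3) X(2) Py in blast)
    then show ?thesis by (simp add: normal_in_def)
  qed
  have prC: "x \<in> ?C" if x: "x \<in> D" "prime (ord x)" for x
  proof -
    have xX: "x \<in> X" using x D(3) by blast
    note xc = Xc[OF xX]
    obtain m where m: "m \<in> M" "x \<in> cyc (m \<otimes> x \<otimes> inv m \<otimes> inv x)"
      using prime_order_in_commutator[OF scd X(1) x] by blast
    have mX: "m \<in> X" using m MX by blast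
    note mc = Xc[OF mX]
    let ?c = "m \<otimes> x \<otimes> inv m \<otimes> inv x"
    have cy: "h \<otimes> y \<otimes> inv h \<in> cyc y" "inv h \<otimes> y \<otimes> h \<in> cyc y" if "h \<in> X" for h
    proof -
      have hH: "h \<in> H" "inv h \<in> H" using that X(2) subgroup.m_inv_closed[OF H] by auto
      show "h \<otimes> y \<otimes> inv h \<in> cyc y" using Pn[OF y(1) hH(1)] Py by simp
      show "inv h \<otimes> y \<otimes> h \<in> cyc y" using Pn[OF y(1) hH(2)] Py Hc[OF hH(1)] by simp
    qed
    have "?c \<otimes> y = y \<otimes> ?c"
      using commutator_centralizes_cyclic[OF yc mc xc cy[OF mX] cy[OF xX]] .
    then have "y \<otimes> x = x \<otimes> y" using commutes_cyc[OF _ yc _ m(2)] mc xc by simp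
    then show ?thesis using x(1) by simp
  qed
  have "\<not> q ^ 2 dvd card D" if q: "prime q" for q
  proof
    assume a: "q ^ 2 dvd card D"
    then have "q dvd card D" by (metis dvd_mult_left power2_eq_square)
    then show False using Diso[OF q] a cX unfolding isolated_def by (metis dvd_mult2)
  qed
  then have DC: "D = ?C" by (intro all_prime_order_imp_eq[OF D(2) Cs] prC) auto
  have PD: "x \<otimes> u = u \<otimes> x" if "x \<in> D" "u \<in> P" for x u
    using PC[of x u] that DC Xc D(3) by blast
  let ?D = "P <#> D"
  have Ds: "subgroup ?D G" using join_subgroup[OF Ps(1) D(2)] Pn D(3) X(2) by blast
  have DH: "?D \<subseteq> H" using join_sub[OF H Ps(2)] D(3) X(2) by blast
  have sup: "P \<subseteq> ?D" "D \<subseteq> ?D" using join_sup[OF Ps(1) D(2)] by auto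
  have PDi: "P \<inter> D = {\<one>}" using X(3) D(3) subgroup.one_closed[OF D(2)] subgroup.one_closed[OF Ps(1)] by blast
  have cD: "card ?D = p * card D" using join_card[OF Ps(1) D(2) Ds] PDi cP by simp
  have Dn: "normal_in H ?D"
    unfolding normal_in_def
  proof (intro conjI ballI)
    fix h z assume h: "h \<in> H" and z: "z \<in> ?D"
    obtain v x where vx: "h = v \<otimes> x" "v \<in> P" "x \<in> X" using h X(4) unfolding set_mult_def by blast
    obtain u e where ue: "z = u \<otimes> e" "u \<in> P" "e \<in> D" using z unfolding set_mult_def by blast
    have c: "v \<in> carrier G" "x \<in> carrier G" "e \<in> carrier G" "u \<in> carrier G"
      using vx ue Pc Xc D(3) by auto
    have w: "x \<otimes> e \<otimes> inv x \<in> D" using D(1) vx(3) ue(3) unfolding normal_in_def by blast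
    have "h \<otimes> e \<otimes> inv h = v \<otimes> (x \<otimes> e \<otimes> inv x) \<otimes> inv v"
      unfolding vx(1) using c by (simp add: m_assoc inv_mult_group)
    also have "\<dots> = x \<otimes> e \<otimes> inv x" using PD[OF w vx(2)] conj_eq_iff[of v] c by simp
    finally have "h \<otimes> e \<otimes> inv h \<in> D" using w by simp
    moreover have "h \<otimes> z \<otimes> inv h = (h \<otimes> u \<otimes> inv h) \<otimes> (h \<otimes> e \<otimes> inv h)"
      unfolding ue(1) using conj_mult[OF Hc[OF h] c(4,3)] .
    ultimately show "h \<otimes> z \<otimes> inv h \<in> ?D" using Pn[OF ue(2) h] unfolding set_mult_def by blast
  qed (use Ds DH in auto)
  have DMH: "?D <#> M = H"
  proof -
    have "?D <#> M = P <#> (D <#> M)"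
      using set_mult_assoc[of P D M] Ps(1) D(2) M by (simp add: subgroup.subset)
    then show ?thesis using DM(1) X(4) by simp
  qed
  have uniq: "u = \<one>" if "u \<in> P" "u \<in> X" for u using that X(3) by blast
  have DMi: "?D \<inter> M = {\<one>}"
  proof -
    have "z = \<one>" if z: "z \<in> ?D" "z \<in> M" for z
    proof -
      obtain u e where ue: "z = u \<otimes> e" "u \<in> P" "e \<in> D" using z(1) unfolding set_mult_def by blast
      have eX: "e \<in> X" and zX: "z \<in> X" using ue MX z D(3) by auto
      have "u = \<one>" using product_in_X[OF ue(2) eX] ue(1) zX by simp
      then have "z \<in> D \<inter> M" using ue z(2) Xc[OF eX] by simp
      then show ?thesis using DM(2) by blast
    qed
    then show ?thesis using subgroup.one_closed[OF Ds] subgroup.one_closed[OF M] by blast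
  qed
  \<comment> \<open>y and d commute and have coprime orders, so powers of
    \<open>y \<otimes> d\<close> yield powers of y and of d alone, and Bezout recovers both.\<close>
  have cyc: "?D = cyc (y \<otimes> d)"
  proof -
    let ?z = "y \<otimes> d"
    have dD: "d \<in> D" using cyc_self[OF d(1)] d(2) by simp
    have zc: "?z \<in> carrier G" using yc d(1) by simp
    have Z: "subgroup (cyc ?z) G" using cyc_subgroup[OF zc] .
    have pw: "?z [^] n = y [^] n \<otimes> d [^] n" for n :: nat
      using pow_mult_distrib[OF _ yc d(1)] PD[OF dD y(1)] by simp
    have zn: "?z [^] n \<in> cyc ?z" for n :: nat by (auto simp: cyc_def)
    have od: "ord d = card D" using cyc_card[OF d(1)] d(2) by simp
    have cop: "coprime p (ord d)"
      using prime_imp_coprime[OF p] pX cX od by (metis dvd_mult2)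
    have "y [^] ord d \<in> cyc ?z" using zn[of "ord d"] unfolding pw using yc d(1) by simp
    moreover have "y [^] p \<in> cyc ?z" using y(2) pow_ord_eq_1[OF yc] subgroup.one_closed[OF Z] by simp
    ultimately have "y \<in> cyc ?z" using pow_coprime_in[OF Z yc _ _ cop] by blast
    moreover have "d [^] p \<in> cyc ?z" using zn[of p] y(2) pow_ord_eq_1[OF yc] unfolding pw using d(1) by simp
    moreover have "d [^] ord d \<in> cyc ?z" using d(1) subgroup.one_closed[OF Z] by simp
    ultimately have "y \<in> cyc ?z" "d \<in> cyc ?z" using pow_coprime_in[OF Z d(1) _ _ cop] by blast+
    then have "?D \<subseteq> cyc ?z" using join_sub[OF Z] cyc_sub[OF Z] Py d(2) by blast
    moreover have "?z \<in> ?D" using y(1) dD unfolding set_mult_def by blast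
    then have "cyc ?z \<subseteq> ?D" using cyc_sub[OF Ds] by blast
    ultimately show ?thesis by blast
  qed
  have iso: "isolated (card H) q" if q: "prime q" "q dvd card ?D" for q
  proof (cases "q = p")
    case True
    then show ?thesis using isop by simp
  next
    case False
    then have qD: "q dvd card D" using q p unfolding cD by (metis prime_dvd_mult_iff primes_dvd_imp_eq)
    note qf = Diso[OF q(1) qD]
    show ?thesis
      unfolding isolated_def
    proof (intro conjI allI impI)
      have "\<not> q dvd p" using False q(1) p primes_dvd_imp_eq by blast
      then have "coprime (q\<^sup>2) p" using prime_imp_coprime[OF q(1)] by simp
      then show "\<not> q\<^sup>2 dvd card H"
        unfolding cH cP using qf coprime_dvd_mult_right_iff unfolding isolated_def by blast
      fix r assume r: "prime r" "r dvd card H" "same q r"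
      then consider "r = p" | "r dvd card X" unfolding cH cP using prime_dvd_mult_iff p primes_dvd_imp_eq by blast
      then show "r = q"
      proof cases
        case 1
        have "q dvd card H" using D_prime(1)[OF q(1) qD] cH by simp
        then show ?thesis using isop r(3) 1 same_sym q(1) unfolding isolated_def by blast
      next
        case 2
        then show ?thesis using qf r unfolding isolated_def by blast
      qed
    qed
  qed
  \<comment> \<open>Conjugation by m in M preserves P and D, so by uniqueness of the decomposition
    of z it fixes u and e separately. Then e = 1 by the hypothesis on X, and a nontrivial u would
    generate P and make \<open>m0\<close> commute with \<open>u0\<close>.\<close>
  have cen: "z = \<one>" if z: "z \<in> ?D" and zM: "\<forall>m\<in>M. m \<otimes> z = z \<otimes> m" for z
  proof -
    obtain u e where ue: "z = u \<otimes> e" "u \<in> P" "e \<in> D" using z unfolding set_mult_def by blast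
    have c: "u \<in> carrier G" "e \<in> carrier G" using ue Pc Xc D(3) by auto
    have both: "m \<otimes> u = u \<otimes> m" "m \<otimes> e = e \<otimes> m" if m: "m \<in> M" for m
    proof -
      have mX: "m \<in> X" and mH: "m \<in> H" using m MX X(2) by auto
      note mc = Xc[OF mX]
      let ?u = "m \<otimes> u \<otimes> inv m" and ?e = "m \<otimes> e \<otimes> inv m"
      have uP: "?u \<in> P" using Pn[OF ue(2) mH] .
      have eD: "?e \<in> D" using D(1) mX ue(3) unfolding normal_in_def by blast
      have "?u \<otimes> ?e = m \<otimes> z \<otimes> inv m" unfolding ue(1) using conj_mult[OF mc c] by simp
      also have "\<dots> = z" using zM m conj_eq_iff[OF mc m_closed[OF c]] unfolding ue(1) by blast
      finally have e1: "?u \<otimes> ?e = u \<otimes> e" using ue(1) by simp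
      have eX: "e \<in> X" "?e \<in> X" using ue(3) eD D(3) by auto
      have "inv u \<otimes> ?u = e \<otimes> inv ?e"
        using e1 c mc Xc[OF eX(2)] Pc[OF uP] by (metis inv_closed inv_solve_left inv_solve_right m_assoc m_closed)
      moreover have "inv u \<otimes> ?u \<in> P" using uP ue(2) Ps(1) by (meson subgroup.m_closed subgroup.m_inv_closed)
      moreover have "e \<otimes> inv ?e \<in> X" using eX X(1) by (meson subgroup.m_closed subgroup.m_inv_closed)
      ultimately have 1: "inv u \<otimes> ?u = \<one>" using uniq by metis
      then have "?u = u" using c Pc[OF uP] by (metis inv_equality inv_inv inv_closed inv_comm)
      then show "m \<otimes> u = u \<otimes> m" using conj_eq_iff[OF mc c(1)] by simp
      have "?e = e" using e1 \<open>?u = u\<close> c Xc[OF eX(2)] by simp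
      then show "m \<otimes> e = e \<otimes> m" using conj_eq_iff[OF mc c(2)] by simp
    qed
    have e1: "e = \<one>" using Dcen[OF ue(3)] both(2) by blast
    have "u = \<one>"
    proof (rule ccontr)
      assume "u \<noteq> \<one>"
      then have "u0 \<in> cyc u" using gen[OF ue(2)] nc(2) by blast
      moreover obtain e' m where em: "m0 = e' \<otimes> m" "e' \<in> D" "m \<in> M" using nc(1) DM(1) unfolding set_mult_def by blast
      have "m0 \<otimes> u = u \<otimes> m0"
        unfolding em(1) using commute_mult[of e' m u] PD[OF em(2) ue(2)] both(1)[OF em(3)] c em D(3) MX Xc by blast
      ultimately show False using commutes_cyc[OF c(1) Xc[OF nc(1)]] nc(3) by blast
    qed
    then show ?thesis using e1 ue(1) by simp
  qed
  have "y \<otimes> d \<in> carrier G" using yc d(1) by simp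
  then show ?thesis
    unfolding split_cyclic_dedekind_def using Dn M DMH DMi cyc iso cen Mded by blast
qed

end

theorem all_emb_split:
  assumes "all_emb H" "subgroup H G"
  shows "\<exists>D M. split_cyclic_dedekind H D M"
  using assms
proof (induction "card H" arbitrary: H rule: less_induct)
  case less
  note emb = less.prems(1) and H = less.prems(2)
  note Hc = subgroup.mem_carrier[OF H]
  show ?case
  proof (cases "card H = 1")
    case True
    then have H1: "H = {\<one>}" using sub_card_one[OF H] by blast
    have "split_cyclic_dedekind H {\<one>} {\<one>}"
      unfolding split_cyclic_dedekind_def H1
      using normal_in_one[OF triv_subgroup] triv_subgroup subgroup.one_closed
      by (auto simp: set_mult_def subset_singleton_iff intro: bexI[of _ \<one>])
    then show ?thesis by blast
  next
    case False
    then obtain p where p: "prime p" "p dvd card H" and pmax: "\<And>r. prime r \<Longrightarrow> r dvd card H \<Longrightarrow> r \<le> p"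
      using greatest_prime_divisor[of "card H"] sub_card_pos[OF H] by auto
    obtain P where syl: "sylow_in p H P" using sylow_in_exists[OF p(1) H] .
    have P: "normal_in H P" using sylow_largest_normal[OF emb H p(1) pmax syl] .
    have Ps: "subgroup P G" "P \<subseteq> H" using P by (auto simp: normal_in_def)
    obtain k where k: "card P = p ^ k" using syl by (auto simp: sylow_in_def)
    have pi: "\<not> p dvd card H div card P" using syl by (simp add: sylow_in_def)
    have pP: "p dvd card P" using p pi idx_mult[OF Ps(1) H Ps(2)] by (metis prime_dvd_mult_iff)
    have Xfacts: "\<not> p dvd card X" "card X < card H"
      if X: "subgroup X G" "P \<inter> X = {\<one>}" "P <#> X = H" for X
    proof -
      have cH: "card H = card P * card X" using join_card[OF Ps(1) X(1)] X(2,3) H by simp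
      have P0: "card P > 0" using sub_card_pos[OF Ps(1)] .
      have X0: "card X > 0" using sub_card_pos[OF X(1)] .
      show "\<not> p dvd card X" using pi unfolding cH using P0 by simp
      have "1 < card P" using pP P0 p(1) by (metis dvd_imp_le less_le_trans prime_gt_1_nat)
      then show "card X < card H" unfolding cH using X0 by simp
    qed
    show ?thesis
    proof (cases "\<forall>g x. g \<in> H \<longrightarrow> coprime (ord g) p \<longrightarrow> x \<in> P \<longrightarrow> g \<otimes> x = x \<otimes> g")
      case True
      then obtain X where X: "subgroup X G" "X \<subseteq> H" "P \<inter> X = {\<one>}" "P <#> X = H"
        "\<And>u x. \<lbrakk>u \<in> P; x \<in> X\<rbrakk> \<Longrightarrow> x \<otimes> u = u \<otimes> x"
        using complement_of_centralized_sylow[OF H p(1) P syl] by blast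
      note Xf = Xfacts[OF X(1,3,4)]
      obtain D M where "split_cyclic_dedekind X D M"
        using less.hyps[OF Xf(2) all_emb_sub[OF emb X(1,2)] X(1)] by blast
      then show ?thesis using split_central_sylow[OF emb H p(1) P k X(1-4) Xf(1) _ pP X(5)] by blast
    next
      case False
      then obtain g x where gx: "g \<in> H" "coprime (ord g) p" "x \<in> P" "g \<otimes> x \<noteq> x \<otimes> g" by blast
      \<comment> \<open>A nontrivial action of a p'-element leaves only |P| = p; P is then abelian
        and has a complement in H.\<close>
      have cP: "card P = p" using pprime_centralizes[OF emb H p(1) P k _ gx(1-3)] gx(4) by blast
      obtain y where y: "y \<in> P" "ord y = p" using cauchy[OF p(1) Ps(1) pP] .
      have yc: "y \<in> carrier G" using y Ps Hc by blast
      have Py: "P = cyc y"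
        using sub_card_eq[OF cyc_subgroup[OF yc] Ps(1) cyc_sub[OF Ps(1) y(1)]] cyc_card[OF yc] y(2) cP by simp
      have ab: "\<And>u v. u \<in> P \<Longrightarrow> v \<in> P \<Longrightarrow> u \<otimes> v = v \<otimes> u" using cyc_comm[OF yc] Py by blast
      obtain X where X: "subgroup X G" "X \<subseteq> H" "P \<inter> X = {\<one>}" "P <#> X = H"
        using abelian_normal_hall_complement[OF H P ab sylow_in_coprime[OF syl p(1)]] by blast
      note Xf = Xfacts[OF X(1,3,4)]
      obtain D M where scd: "split_cyclic_dedekind X D M"
        using less.hyps[OF Xf(2) all_emb_sub[OF emb X(1,2)] X(1)] by blast
      obtain v m where vm: "g = v \<otimes> m" "v \<in> P" "m \<in> X" using gx(1) X(4) unfolding set_mult_def by blast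
      have c: "v \<in> carrier G" "m \<in> carrier G" "x \<in> carrier G" using vm gx(3) X(2) Ps Hc by auto
      \<comment> \<open>P is abelian, so it is the factor m in X that prevents g from commuting with
        x.\<close>
      have "m \<otimes> x \<noteq> x \<otimes> m"
      proof
        assume "m \<otimes> x = x \<otimes> m"
        then have "g \<otimes> x = x \<otimes> g" unfolding vm(1) using commute_mult[OF c ab[OF vm(2) gx(3)]] by blast
        then show False using gx(4) by blast
      qed
      then show ?thesis using split_noncentral_sylow[OF emb H p(1) P k X Xf(1) scd cP vm(3) gx(3)] by blast
    qed
  qed
qed

end

section \<open>Dedekind groups are sigma-nilpotent\<close>

context fin_group
begin

text \<open>
  The projection of a Dedekind group to its Sylow subgroup \<open>P\<close> is \<open>x \<mapsto> x\<^sup>e\<close>, where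
  \<open>e\<close> is 1 modulo \<open>|P|\<close> and 0 modulo \<open>|G : P|\<close>.
\<close>

lemma dedekind_sigma_nilpotent:
  assumes ded: "dedekind_group G" and \<sigma>: "prime_partition \<sigma>"
  shows "sigma_nilpotent \<sigma> G"
proof -
  let ?n = "order G"
  have G: "subgroup (carrier G) G" by (rule subgroup_self)
  have n: "card (carrier G) = ?n" by (simp add: order_def)
  have n0: "?n \<noteq> 0" using sub_card_pos[OF G] by (simp add: order_def)
  have nor: "normal_in (carrier G) A" if "subgroup A G" for A
    using ded that subgroup.subset unfolding dedekind_group_def normal_in_def normal_inv_iff by blast
  define P where "P q = (SOME P. subgroup P G \<and> card P = q ^ multiplicity q ?n)" for q
  have P: "subgroup (P q) G" "card (P q) = q ^ multiplicity q ?n" if "prime q" for q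
  proof -
    have "\<exists>P. subgroup P G \<and> card P = q ^ multiplicity q ?n"
      using sylow_exists[OF that G] n by metis
    then show "subgroup (P q) G" "card (P q) = q ^ multiplicity q ?n"
      unfolding P_def by (metis (mono_tags, lifting) someI_ex)+
  qed
  let ?m = "\<lambda>q. q ^ multiplicity q ?n" and ?r = "\<lambda>q. ?n div q ^ multiplicity q ?n"
  have mr: "?m q * ?r q = ?n" for q by (simp add: multiplicity_dvd)
  have pos: "?m q > 0" "?r q > 0" for q using mr[of q] n0 by (metis nat_0_less_mult_iff not_gr_zero)+
  have nr: "\<not> q dvd ?r q" if "prime q" for q
    using multiplicity_decompose[OF n0] prime_gt_1_nat[OF that] by simp
  have cop: "coprime (?m q) (?r q)" if "prime q" for q
    using prime_imp_coprime[OF that nr[OF that]] by simp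
  \<comment> \<open>Both cyclic subgroups are normal, so the commutator lies in each of them, and
    their orders are coprime.\<close>
  have coprime_commute': "u \<otimes> v = v \<otimes> u" if "u \<in> carrier G" "v \<in> carrier G" "coprime (ord u) (ord v)" for u v
  proof -
    have "normal_in (carrier G) (cyc v)" "normal_in (carrier G) (cyc u)"
      using nor cyc_subgroup that by auto
    then show ?thesis
      using commute_of_coprime_normal[OF _ G cyc_self[OF that(2)] that(1)] that cyc_self[OF that(1)] cyc_card[OF that(2)]
      unfolding normal_in_def by metis
  qed
  have ord_mult: "coprime (ord (u \<otimes> v)) q"
    if c: "u \<in> carrier G" "v \<in> carrier G" "coprime (ord u) q" "coprime (ord v) q" for u v q
  proof -
    have J: "subgroup (cyc u <#> cyc v) G"
      using join_subgroup[OF cyc_subgroup[OF c(1)] cyc_subgroup[OF c(2)]] nor[OF cyc_subgroup[OF c(1)]]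
        subgroup.mem_carrier[OF cyc_subgroup[OF c(2)]] unfolding normal_in_def by blast
    have "u \<otimes> v \<in> cyc u <#> cyc v" using cyc_self c unfolding set_mult_def by blast
    then have "ord (u \<otimes> v) dvd card (cyc u <#> cyc v)" using ord_dvd_sub[OF J] by blast
    moreover have "card (cyc u <#> cyc v) dvd ord u * ord v"
      using join_card[OF cyc_subgroup[OF c(1)] cyc_subgroup[OF c(2)] J] cyc_card c by (metis dvd_triv_left)
    ultimately have "ord (u \<otimes> v) dvd ord u * ord v" by (rule dvd_trans)
    moreover have "coprime (ord u * ord v) q" using c by simp
    ultimately show ?thesis using coprime_divisors[OF _ dvd_refl] by blast
  qed
  have "\<exists>e b. e = ?m q * b + 1 \<and> ?r q dvd e" if q: "prime q" for q
  proof -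
    obtain a b where "?r q * a = ?m q * b + 1"
      using bezout_nat[of "?r q" "?m q"] pos[of q] cop[OF q] by (auto simp: gcd.commute)
    then show ?thesis by (metis dvd_triv_left)
  qed
  then obtain e b where e: "\<And>q. prime q \<Longrightarrow> e q = ?m q * b q + 1" "\<And>q. prime q \<Longrightarrow> ?r q dvd e q"
    by metis
  have proj: "(w \<otimes> z) [^] e q = w" if q: "prime q" and w: "w \<in> P q" and z: "z \<in> carrier G" "z [^] ?r q = \<one>" for q w z
  proof -
    have wc: "w \<in> carrier G" using w P[OF q] subgroup.mem_carrier by metis
    have w1: "w [^] ?m q = \<one>" using pow_card_sub[OF P(1)[OF q] w] P(2)[OF q] by simp
    have "coprime (ord w) (ord z)"
      using cop[OF q] w1 z pow_eq_id wc coprime_divisors by metis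
    then have "w \<otimes> z = z \<otimes> w" using coprime_commute' wc z by blast
    then have "(w \<otimes> z) [^] e q = w [^] e q \<otimes> z [^] e q" using pow_mult_distrib wc z by blast
    moreover have "z [^] e q = \<one>" using z e(2)[OF q] pow_eq_id dvd_trans by metis
    moreover have "w [^] e q = (w [^] ?m q) [^] b q \<otimes> w" unfolding e(1)[OF q] nat_pow_pow[OF wc] by simp
    ultimately show ?thesis using w1 wc by simp
  qed
  have dec: "\<exists>w z. x = w \<otimes> z \<and> w \<in> P q \<and> z \<in> carrier G \<and> z [^] ?r q = \<one>"
    if q: "prime q" and x: "x \<in> carrier G" for q x
  proof -
    have "x [^] (?m q * ?r q) = \<one>" unfolding mr using pow_order_eq_1[OF x] .
    then obtain i j :: nat where ij: "x = x [^] i \<otimes> x [^] j" "(x [^] i) [^] ?m q = \<one>" "(x [^] j) [^] ?r q = \<one>"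
      using pow_split[OF x _ cop[OF q] pos] by blast
    have "P q = {x \<in> carrier G. x [^] ?m q = \<one>}"
      using normal_hall_eq[OF nor[OF P(1)[OF q]] G] P(2)[OF q] cop[OF q] n by simp
    then have "x [^] i \<in> P q" using ij(2) x by simp
    then show ?thesis using ij x by blast
  qed
  have eP: "x [^] e q \<in> P q" if "prime q" "x \<in> carrier G" for q x
    using dec[OF that] proj[OF that(1)] by metis
  \<comment> \<open>With x = w z and y = w' z' split into q-parts and q'-parts, z and w' commute
    because their orders are coprime, and z z' is again a q'-element. So \<open>proj\<close> reads
    off w w' from the product.\<close>
  have hom: "(x \<otimes> y) [^] e q = x [^] e q \<otimes> y [^] e q"
    if q: "prime q" and x: "x \<in> carrier G" and y: "y \<in> carrier G" for q x y
  proof -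
    obtain w z where wz: "x = w \<otimes> z" "w \<in> P q" "z \<in> carrier G" "z [^] ?r q = \<one>" using dec[OF q x] by blast
    obtain w' z' where wz': "y = w' \<otimes> z'" "w' \<in> P q" "z' \<in> carrier G" "z' [^] ?r q = \<one>" using dec[OF q y] by blast
    have c: "w \<in> carrier G" "w' \<in> carrier G" using wz(2) wz'(2) P(1)[OF q] subgroup.mem_carrier by metis+
    have cz: "coprime (ord z) q" if "z \<in> carrier G" "z [^] ?r q = \<one>" for z
    proof -
      have "ord z dvd ?r q" using pow_eq_id that by blast
      moreover have "coprime (?r q) q" using prime_imp_coprime[OF q nr[OF q]] coprime_commute by blast
      ultimately show ?thesis using coprime_divisors[OF _ dvd_refl] by blast
    qed
    have "w' [^] ?m q = \<one>" using pow_card_sub[OF P(1)[OF q] wz'(2)] P(2)[OF q] by simp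
    then have "coprime (ord z) (ord w')"
      using cop[OF q] wz(3,4) pow_eq_id c coprime_divisors coprime_commute by metis
    then have "z \<otimes> w' = w' \<otimes> z" using coprime_commute' wz(3) c by blast
    then have "x \<otimes> y = (w \<otimes> w') \<otimes> (z \<otimes> z')"
      unfolding wz(1) wz'(1) using c wz(3) wz'(3) by (metis m_assoc m_closed)
    moreover have "(z \<otimes> z') [^] ?r q = \<one>"
    proof -
      have zz: "z \<otimes> z' \<in> carrier G" using wz(3) wz'(3) by simp
      have "coprime (ord (z \<otimes> z')) q" using ord_mult cz wz(3,4) wz'(3,4) by blast
      then have "coprime (ord (z \<otimes> z')) (?m q)" by simp
      moreover have "ord (z \<otimes> z') dvd ?m q * ?r q" unfolding mr using ord_dvd_group_order[OF zz] .
      ultimately have "ord (z \<otimes> z') dvd ?r q" using coprime_dvd_mult_right_iff by blast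
      then show ?thesis using pow_eq_id[OF zz] by blast
    qed
    ultimately have "(x \<otimes> y) [^] e q = w \<otimes> w'"
      using proj[OF q subgroup.m_closed[OF P(1)[OF q] wz(2) wz'(2)]] wz(3) wz'(3) by simp
    moreover have "x [^] e q = w" "y [^] e q = w'"
      unfolding wz(1) wz'(1) using proj[OF q] wz wz' by auto
    ultimately show ?thesis by simp
  qed
  let ?I = "prime_factors ?n"
  \<comment> \<open>The factors are rebuilt as plain monoids because \<open>sigma_nilpotent\<close>
    quantifies over \<open>'a monoid\<close>, without the record extension of G.\<close>
  define F where "F q = \<lparr>carrier = P q, monoid.mult = (\<otimes>), one = \<one>\<rparr>" for q
  have I: "prime q" if "q \<in> ?I" for q using that by (rule in_prime_factors_imp_prime)
  have Fg: "group (F q)" if "q \<in> ?I" for q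
  proof -
    have s: "subgroup (P q) G" using P I that by blast
    show ?thesis
    proof (rule groupI)
      show "\<exists>y\<in>carrier (F q). y \<otimes>\<^bsub>F q\<^esub> x = \<one>\<^bsub>F q\<^esub>" if "x \<in> carrier (F q)" for x
        using that subgroup.m_inv_closed[OF s] subgroup.mem_carrier[OF s] by (auto simp: F_def intro!: bexI[of _ "inv x"])
    qed (use subgroup.m_closed[OF s] subgroup.one_closed[OF s] subgroup.mem_carrier[OF s] m_assoc in \<open>auto simp: F_def\<close>)
  qed
  have Fs: "sigma_primary \<sigma> (F q)" if q: "q \<in> ?I" for q
  proof -
    obtain S where S: "S \<in> \<sigma>" "q \<in> S"
      using \<sigma> I[OF q] unfolding prime_partition_def partition_on_def by blast
    have "prime_factors (order (F q)) \<subseteq> S"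
    proof
      fix r assume "r \<in> prime_factors (order (F q))"
      then have "prime r" "r dvd q ^ multiplicity q ?n"
        using P(2)[OF I[OF q]] by (auto simp: order_def F_def in_prime_factors_iff)
      then have "r = q" using I[OF q] prime_dvd_power primes_dvd_imp_eq by blast
      then show "r \<in> S" using S by simp
    qed
    then show ?thesis using S unfolding sigma_primary_def by blast
  qed
  define h where "h x = (\<lambda>q\<in>?I. x [^] e q)" for x
  have "h \<in> hom G (product_group ?I F)"
    unfolding hom_def h_def using eP hom I by (auto simp: F_def intro!: restrict_ext)
  moreover have "bij_betw h (carrier G) (carrier (product_group ?I F))"
  proof -
    interpret pg: group "product_group ?I F" using Fg by simp
    interpret h: group_hom G "product_group ?I F" h
      using calculation by (intro group_hom.intro group_hom_axioms.intro is_group pg.is_group)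
    \<comment> \<open>If a prime q divides the order of x and \<open>x [^] e q\<close> is one, then
      q divides \<open>e q\<close>, which is 1 modulo q.\<close>
    have "x = \<one>" if x: "x \<in> carrier G" and hx: "h x = \<one>\<^bsub>product_group ?I F\<^esub>" for x
    proof (rule ccontr)
      assume "x \<noteq> \<one>"
      then have "ord x \<noteq> 1" using ord_eq_1 x by blast
      then obtain q where q: "prime q" "q dvd ord x" using prime_factor_nat by blast
      then have qn: "q dvd ?n" using ord_dvd_group_order[OF x] dvd_trans by blast
      then have qI: "q \<in> ?I" using q n0 by (simp add: in_prime_factors_iff)
      then have "x [^] e q = \<one>" using fun_cong[OF hx, of q] by (simp add: h_def F_def)
      then have "q dvd e q" using q pow_eq_id[OF x] dvd_trans by blast
      moreover have "multiplicity q ?n > 0" using q(1) qn n0 by (simp add: prime_multiplicity_gt_zero_iff)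
      then have "q dvd ?m q" by (simp add: dvd_power)
      ultimately have "q dvd 1" unfolding e(1)[OF q(1)] by (metis dvd_add_right_iff dvd_mult2)
      then show False using q(1) by simp
    qed
    then have inj: "inj_on h (carrier G)" using h.inj_on_one_iff by blast
    have sub: "h ` carrier G \<subseteq> carrier (product_group ?I F)" using h.hom_closed by blast
    \<comment> \<open>Surjectivity follows from injectivity by counting.\<close>
    have "card (carrier (product_group ?I F)) = (\<Prod>q\<in>?I. card (P q))"
      by (simp add: card_PiE F_def)
    also have "\<dots> = (\<Prod>q\<in>?I. q ^ multiplicity q ?n)" using P(2) I by (intro prod.cong) auto
    also have "\<dots> = ?n" using prod_prime_factors[OF n0] by simp
    finally have card: "card (carrier (product_group ?I F)) = ?n" .
    then have "finite (carrier (product_group ?I F))" using n0 by (metis card.infinite)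
    then have "h ` carrier G = carrier (product_group ?I F)"
      using card_subset_eq[OF _ sub] card_image[OF inj] card n by simp
    then show ?thesis using inj by (simp add: bij_betw_def)
  qed
  ultimately have "G \<cong> product_group ?I F" unfolding is_iso_def iso_def by blast
  then show ?thesis unfolding sigma_nilpotent_def using Fg Fs by blast
qed

end

section \<open>The classes of a partition\<close>

definition sigma_same :: "nat set set \<Rightarrow> nat \<Rightarrow> nat \<Rightarrow> bool" where
  "sigma_same \<sigma> p q \<longleftrightarrow> (\<exists>S\<in>\<sigma>. p \<in> S \<and> q \<in> S)"

lemma prime_partition_disjoint:
  "\<lbrakk>prime_partition \<sigma>; S \<in> \<sigma>; T \<in> \<sigma>; p \<in> S; p \<in> T\<rbrakk> \<Longrightarrow> S = T"
  unfolding prime_partition_def partition_on_def disjoint_def by blast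

lemma sigma_of_disjoint_iff:
  fixes a b :: nat
  assumes "prime_partition \<sigma>" "a \<noteq> 0" "b \<noteq> 0"
  shows "sigma_of \<sigma> a \<inter> sigma_of \<sigma> b = {} \<longleftrightarrow>
    (\<forall>p q. prime p \<longrightarrow> prime q \<longrightarrow> p dvd a \<longrightarrow> q dvd b \<longrightarrow> \<not> sigma_same \<sigma> p q)"
proof -
  have "sigma_of \<sigma> a \<inter> sigma_of \<sigma> b = {} \<longleftrightarrow>
      (\<forall>p\<in>prime_factors a. \<forall>q\<in>prime_factors b. \<not> sigma_same \<sigma> p q)"
    unfolding sigma_of_def sigma_same_def by blast
  then show ?thesis using assms(2,3) by (simp add: in_prime_factors_iff Ball_def) blast
qed

text \<open>\<open>sigma_of \<sigma> n\<close> is the image of the prime factors under the map from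
  a prime to its class, so equal cardinality means that this map is injective on them.\<close>

lemma card_sigma_of_iff:
  assumes \<sigma>: "prime_partition \<sigma>" and n: "n \<noteq> 0"
  shows "card (sigma_of \<sigma> n) = card (prime_factors n) \<longleftrightarrow>
    (\<forall>p q. prime p \<longrightarrow> prime q \<longrightarrow> p dvd n \<longrightarrow> q dvd n \<longrightarrow> sigma_same \<sigma> p q \<longrightarrow> p = q)"
proof -
  define c where "c p = (THE S. S \<in> \<sigma> \<and> p \<in> S)" for p
  have c: "c p = S" if "S \<in> \<sigma>" "p \<in> S" for p S
    unfolding c_def using that prime_partition_disjoint[OF \<sigma>] by (intro the_equality) auto
  have ex: "\<exists>S\<in>\<sigma>. p \<in> S" if "prime p" for p
    using \<sigma> that unfolding prime_partition_def partition_on_def by blast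
  have same: "sigma_same \<sigma> p q \<longleftrightarrow> c p = c q" if "prime p" "prime q" for p q
    using ex[OF that(1)] ex[OF that(2)] c unfolding sigma_same_def by metis
  have "sigma_of \<sigma> n = c ` prime_factors n"
  proof
    show "sigma_of \<sigma> n \<subseteq> c ` prime_factors n"
      using c unfolding sigma_of_def by (auto simp: image_iff)
    show "c ` prime_factors n \<subseteq> sigma_of \<sigma> n"
    proof
      fix S assume "S \<in> c ` prime_factors n"
      then obtain p where p: "p \<in> prime_factors n" "S = c p" by blast
      then obtain T where "T \<in> \<sigma>" "p \<in> T" using ex by blast
      then show "S \<in> sigma_of \<sigma> n" using p c unfolding sigma_of_def by blast
    qed
  qed
  then have "card (sigma_of \<sigma> n) = card (prime_factors n) \<longleftrightarrow> inj_on c (prime_factors n)"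
    using eq_card_imp_inj_on[of "prime_factors n" c] card_image[of c "prime_factors n"] by auto
  also have "\<dots> \<longleftrightarrow> (\<forall>p q. prime p \<longrightarrow> prime q \<longrightarrow> p dvd n \<longrightarrow> q dvd n \<longrightarrow> sigma_same \<sigma> p q \<longrightarrow> p = q)"
    using n same unfolding inj_on_def by (auto simp: in_prime_factors_iff)
  finally show ?thesis .
qed

lemma squarefree_nat_iff:
  "(n::nat) \<noteq> 0 \<Longrightarrow> squarefree n \<longleftrightarrow> (\<forall>p. prime p \<longrightarrow> \<not> p ^ 2 dvd n)"
  using squarefree_factorial_semiring[of n] by auto

section \<open>Translation to the definitions on subgroup records\<close>

lemma (in fin_group) normal_iff: "N \<lhd> G \<longleftrightarrow> normal_in (carrier G) N"
  unfolding normal_inv_iff normal_in_def using subgroup.subset by blast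

lemma (in fin_group) normal_restrict_iff:
  assumes "subgroup H G"
  shows "N \<lhd> G\<lparr>carrier := H\<rparr> \<longleftrightarrow> normal_in H N"
proof -
  interpret K: group "G\<lparr>carrier := H\<rparr>" by (rule subgroup_imp_group[OF assms])
  have "subgroup N (G\<lparr>carrier := H\<rparr>) \<longleftrightarrow> subgroup N G \<and> N \<subseteq> H"
    using subgroup_incl[OF _ assms] incl_subgroup[OF assms] subgroup.subset[of N "G\<lparr>carrier := H\<rparr>"] by auto
  then show ?thesis
    unfolding K.normal_inv_iff normal_in_def by (auto simp: m_inv_consistent[OF assms])
qed

lemma (in fin_group) card_rcosets_restrict:
  assumes "subgroup H G" "subgroup S G" "S \<subseteq> H"
  shows "card (rcosets\<^bsub>G\<lparr>carrier := H\<rparr>\<^esub> S) = card H div card S"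
proof -
  have "rcosets\<^bsub>G\<lparr>carrier := H\<rparr>\<^esub> S = (\<lambda>c. S #> c) ` H"
    by (auto simp: RCOSETS_def r_coset_def)
  then show ?thesis using idx_eq[OF assms] by simp
qed

lemma (in fin_group) dedekind_restrict_iff:
  assumes "subgroup M G"
  shows "dedekind_group (G\<lparr>carrier := M\<rparr>) \<longleftrightarrow> (\<forall>A. subgroup A G \<longrightarrow> A \<subseteq> M \<longrightarrow> normal_in M A)"
proof -
  have "subgroup A (G\<lparr>carrier := M\<rparr>) \<longleftrightarrow> subgroup A G \<and> A \<subseteq> M" for A
    using subgroup_incl[OF _ assms] incl_subgroup[OF assms] subgroup.subset[of A "G\<lparr>carrier := M\<rparr>"] by auto
  then show ?thesis
    unfolding dedekind_group_def normal_restrict_iff[OF assms]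
    using subgroup_imp_group[OF assms] by auto
qed

lemma (in fin_group) cyclic_restrict:
  assumes "d \<in> carrier G"
  shows "cyclic_group (G\<lparr>carrier := cyc d\<rparr>)"
proof -
  have D: "subgroup (cyc d) G" using cyc_subgroup assms .
  interpret K: group "G\<lparr>carrier := cyc d\<rparr>" by (rule subgroup_imp_group[OF D])
  have "cyc d = range (\<lambda>n::int. d [^] n)"
    unfolding cyc_eq[OF assms] generate_pow[OF assms] by blast
  then show ?thesis
    unfolding K.cyclic_group using cyc_self[OF assms] int_pow_consistent[OF D cyc_self[OF assms]] by auto
qed

locale sigma_partition_group = fin_group +
  fixes \<sigma> :: "nat set set"
  assumes part: "prime_partition \<sigma>"
begin

sublocale sigma_group G "sigma_same \<sigma>"
proof
  show "sigma_same \<sigma> p p" if "prime p" for p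
    using part that unfolding sigma_same_def prime_partition_def partition_on_def by blast
  show "sigma_same \<sigma> q p" if "sigma_same \<sigma> p q" for p q
    using that unfolding sigma_same_def by blast
  show "sigma_same \<sigma> p r" if "sigma_same \<sigma> p q" "sigma_same \<sigma> q r" for p q r
    using that prime_partition_disjoint[OF part] unfolding sigma_same_def by metis
qed

lemma carrier_sub: "subgroup (carrier G) G" by (rule subgroup_self)

lemma emb_iff:
  assumes "subgroup A G"
  shows "H_sigma_normally_embedded \<sigma> G A \<longleftrightarrow> (\<exists>N. emb_via (carrier G) N A)"
proof -
  have "N \<lhd> G \<and> sigma_hall \<sigma> (G\<lparr>carrier := N\<rparr>) A \<longleftrightarrow> emb_via (carrier G) N A" for N
  proof (cases "N \<lhd> G")
    case True
    then have N: "subgroup N G" by (rule normal_imp_subgroup)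
    have s: "subgroup A (G\<lparr>carrier := N\<rparr>) \<longleftrightarrow> A \<subseteq> N"
      using subgroup_incl[OF assms N] subgroup.subset[of A "G\<lparr>carrier := N\<rparr>"] by auto
    have "sigma_of \<sigma> (card A) \<inter> sigma_of \<sigma> (card (rcosets\<^bsub>G\<lparr>carrier := N\<rparr>\<^esub> A)) = {} \<longleftrightarrow>
      (\<forall>p q. prime p \<longrightarrow> prime q \<longrightarrow> p dvd card A \<longrightarrow> q dvd card N div card A \<longrightarrow> \<not> sigma_same \<sigma> p q)"
      if AN: "A \<subseteq> N"
    proof -
      have "card A \<noteq> 0" "card N div card A \<noteq> 0"
        using sub_card_pos[OF assms] sub_card_pos[OF N] idx_mult[OF assms N AN] by (metis less_irrefl mult_0_right)+
      then show ?thesis unfolding card_rcosets_restrict[OF N assms AN] by (rule sigma_of_disjoint_iff[OF part])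
    qed
    then show ?thesis using True s unfolding sigma_hall_def emb_via_def normal_iff by blast
  qed (simp add: emb_via_def normal_iff)
  then show ?thesis unfolding H_sigma_normally_embedded_def by blast
qed

lemma all_emb_iff:
  "all_emb (carrier G) \<longleftrightarrow> (\<forall>A. subgroup A G \<longrightarrow> H_sigma_normally_embedded \<sigma> G A)"
  unfolding all_emb_def using emb_iff subgroup.subset by blast

text \<open>The Hall condition separates the classes of |D| from those of |G : D|, squarefreeness
  excludes squares within |D|, and the cardinality condition separates the primes of |D|.
  Conversely, a prime common to |D| and |G : D| would have its square dividing |G|.\<close>

lemma isolated_iff:
  assumes D: "subgroup D G"
  shows "sigma_hall \<sigma> G D \<and> squarefree (card D) \<and> card (sigma_of \<sigma> (card D)) = card (prime_factors (card D))
    \<longleftrightarrow> (\<forall>q. prime q \<longrightarrow> q dvd card D \<longrightarrow> isolated (order G) q)" (is "?L \<longleftrightarrow> ?R")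
proof -
  let ?i = "card (carrier G) div card D"
  have DG: "D \<subseteq> carrier G" using subgroup.subset[OF D] .
  have mult: "card D * ?i = order G" using idx_mult[OF D carrier_sub DG] by (simp add: order_def)
  have pos: "card D \<noteq> 0" "?i \<noteq> 0"
    using mult sub_card_pos[OF carrier_sub] unfolding order_def by (metis less_irrefl mult_0 mult_0_right)+
  have hall: "sigma_hall \<sigma> G D \<longleftrightarrow>
      (\<forall>p q. prime p \<longrightarrow> prime q \<longrightarrow> p dvd card D \<longrightarrow> q dvd ?i \<longrightarrow> \<not> sigma_same \<sigma> p q)"
    using card_rcosets_restrict[OF carrier_sub D DG] sigma_of_disjoint_iff[OF part pos] D
    unfolding sigma_hall_def by simp
  show ?thesis
    unfolding hall squarefree_nat_iff[OF pos(1)] card_sigma_of_iff[OF part pos(1)]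
  proof (intro iffI conjI allI impI)
    fix q assume L: "(\<forall>p q. prime p \<longrightarrow> prime q \<longrightarrow> p dvd card D \<longrightarrow> q dvd ?i \<longrightarrow> \<not> sigma_same \<sigma> p q) \<and>
      (\<forall>p. prime p \<longrightarrow> \<not> p\<^sup>2 dvd card D) \<and>
      (\<forall>p q. prime p \<longrightarrow> prime q \<longrightarrow> p dvd card D \<longrightarrow> q dvd card D \<longrightarrow> sigma_same \<sigma> p q \<longrightarrow> p = q)"
      and q: "prime q" "q dvd card D"
    show "isolated (order G) q"
      unfolding isolated_def mult[symmetric]
    proof (intro conjI allI impI)
      have "\<not> q dvd ?i" using L q same_refl by blast
      then have "coprime (q\<^sup>2) ?i" using prime_imp_coprime[OF q(1)] by simp
      then show "\<not> q\<^sup>2 dvd card D * ?i" using L q(1) coprime_dvd_mult_left_iff by blast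
      fix r assume "prime r" "r dvd card D * ?i" "sigma_same \<sigma> q r"
      then show "r = q" using L q prime_dvd_mult_iff by blast
    qed
  next
    fix p q :: nat assume R: ?R and a: "prime p" "prime q" "p dvd card D" "q dvd ?i"
    show "\<not> sigma_same \<sigma> p q"
    proof
      assume "sigma_same \<sigma> p q"
      moreover have "q dvd order G" unfolding mult[symmetric] using a(4) by simp
      ultimately have "q = p" using R a unfolding isolated_def by blast
      then have "p * p dvd card D * ?i" using a by (intro mult_dvd_mono) auto
      then show False using R a(1,3) mult unfolding isolated_def power2_eq_square by metis
    qed
  next
    fix p :: nat assume R: ?R and p: "prime p"
    show "\<not> p\<^sup>2 dvd card D"
    proof
      assume a: "p\<^sup>2 dvd card D"
      then have "p dvd card D" unfolding power2_eq_square by (rule dvd_mult_left)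
      moreover have "p\<^sup>2 dvd order G" unfolding mult[symmetric] using a by simp
      ultimately show False using R p unfolding isolated_def by blast
    qed
  next
    fix p q :: nat assume R: ?R and a: "prime p" "prime q" "p dvd card D" "q dvd card D" "sigma_same \<sigma> p q"
    have "q dvd order G" unfolding mult[symmetric] using a(4) by simp
    then show "p = q" using R a unfolding isolated_def by blast
  qed
qed

text \<open>DA = D (M \<inter> DA), since D lies in DA and DM is the whole group. The second factor
  is normal in M, and conjugation by elements of D stays inside DA.\<close>

lemma normal_join_dedekind:
  assumes sd: "internal_semidirect G D M" and ded: "dedekind_group (G\<lparr>carrier := M\<rparr>)" and A: "subgroup A G"
  shows "normal_in (carrier G) (D <#> A)"
proof -
  have Dn: "normal_in (carrier G) D" and M: "subgroup M G" and DM: "D <#> M = carrier G"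
    using sd unfolding internal_semidirect_def normal_iff by auto
  have D: "subgroup D G" using Dn by (simp add: normal_in_def)
  note Dc = subgroup.mem_carrier[OF D] and Mc = subgroup.mem_carrier[OF M] and Ac = subgroup.mem_carrier[OF A]
  have J: "subgroup (D <#> A) G"
    using join_subgroup[OF D A] Dn Ac unfolding normal_in_def by blast
  note Jc = subgroup.mem_carrier[OF J]
  have sup: "D \<subseteq> D <#> A" using join_sup[OF D A] by blast
  let ?B = "M \<inter> (D <#> A)"
  have "subgroup ?B G" using subgroups_Inter_pair M J by blast
  then have Bn: "normal_in M ?B" using ded dedekind_restrict_iff[OF M] by blast
  have "g \<otimes> z \<otimes> inv g \<in> D <#> A" if g: "g \<in> carrier G" and z: "z \<in> D <#> A" for g z
  proof -
    obtain d m where dm: "g = d \<otimes> m" "d \<in> D" "m \<in> M" using g DM unfolding set_mult_def by blast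
    obtain e b where eb: "z = e \<otimes> b" "e \<in> D" "b \<in> M" using Jc[OF z] DM unfolding set_mult_def by blast
    note c = Dc[OF dm(2)] Mc[OF dm(3)] Dc[OF eb(2)] Mc[OF eb(3)]
    have "b = inv e \<otimes> z" using eb c by (simp add: inv_cancel)
    moreover have "inv e \<in> D <#> A" using eb(2) sup subgroup.m_inv_closed[OF D] by blast
    ultimately have "b \<in> ?B" using eb(3) z subgroup.m_closed[OF J] by blast
    then have w: "m \<otimes> b \<otimes> inv m \<in> D <#> A" using Bn dm(3) unfolding normal_in_def by blast
    have dJ: "d \<in> D <#> A" "inv d \<in> D <#> A" using dm(2) sup subgroup.m_inv_closed[OF D] by auto
    have "g \<otimes> b \<otimes> inv g = d \<otimes> (m \<otimes> b \<otimes> inv m) \<otimes> inv d"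
      unfolding dm(1) using c by (simp add: m_assoc inv_mult_group)
    then have 1: "g \<otimes> b \<otimes> inv g \<in> D <#> A" using subgroup.m_closed[OF J] dJ w by metis
    have 2: "g \<otimes> e \<otimes> inv g \<in> D <#> A" using Dn g eb(2) sup unfolding normal_in_def by blast
    show ?thesis unfolding eb(1) using conj_mult[OF g c(3,4)] subgroup.m_closed[OF J 2 1] by simp
  qed
  then show ?thesis using J Jc unfolding normal_in_def by blast
qed

text \<open>|DA : A| = |D : D \<inter> A|, so a prime dividing it divides |D| and is isolated. It
  can share its class with a prime of |A| only by dividing |A| itself, and then its square divides
  |G|.\<close>

lemma semidirect_imp_embedded:
  assumes sd: "internal_semidirect G D M" and ded: "dedekind_group (G\<lparr>carrier := M\<rparr>)"
    and iso: "\<And>q. prime q \<Longrightarrow> q dvd card D \<Longrightarrow> isolated (order G) q"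
    and A: "subgroup A G"
  shows "emb_via (carrier G) (D <#> A) A"
proof -
  have D: "subgroup D G" using sd normal_imp_subgroup unfolding internal_semidirect_def by blast
  have n: "normal_in (carrier G) (D <#> A)" using normal_join_dedekind[OF sd ded A] .
  then have J: "subgroup (D <#> A) G" by (simp add: normal_in_def)
  have I: "subgroup (D \<inter> A) G" using subgroups_Inter_pair D A by blast
  have AJ: "A \<subseteq> D <#> A" using join_sup[OF D A] by blast
  let ?i = "card (D <#> A) div card A"
  have "card A * ?i = card (D <#> A)" using idx_mult[OF A J AJ] .
  moreover have "card (D <#> A) * card (D \<inter> A) = card D * card A" using join_card[OF D A J] .
  ultimately have "card A * (?i * card (D \<inter> A)) = card A * card D" by (metis mult.assoc mult.commute)
  then have iD: "?i * card (D \<inter> A) = card D" using sub_card_pos[OF A] by simp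
  have "\<not> sigma_same \<sigma> p q" if a: "prime p" "prime q" "p dvd card A" "q dvd ?i" for p q
  proof
    assume s: "sigma_same \<sigma> p q"
    have "q dvd card D" unfolding iD[symmetric] using a(4) by simp
    then have iq: "isolated (order G) q" using iso a(2) by blast
    have dvdG: "card A dvd order G" "card (D <#> A) dvd order G"
      using sub_card_dvd[OF A carrier_sub] sub_card_dvd[OF J carrier_sub] subgroup.subset A J by (auto simp: order_def)
    have "p dvd order G" using a(3) dvdG(1) by (rule dvd_trans)
    then have "p = q" using iq a(1) same_sym[OF s] unfolding isolated_def by blast
    then have "q * q dvd card A * ?i" using a by (intro mult_dvd_mono) auto
    then have "q * q dvd order G" using idx_mult[OF A J AJ] dvdG(2) dvd_trans by metis
    then show False using iq by (simp add: isolated_def power2_eq_square)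
  qed
  then show ?thesis using n AJ unfolding emb_via_def by blast
qed

end

section \<open>Sylow towers and sections\<close>

lemma prime_order_comm:
  assumes "group F" "prime (order F)" "x \<in> carrier F" "y \<in> carrier F"
  shows "x \<otimes>\<^bsub>F\<^esub> y = y \<otimes>\<^bsub>F\<^esub> x"
proof -
  have "finite (carrier F)" using assms(2) unfolding order_def by (metis card.infinite not_prime_0)
  then interpret F: fin_group F using assms(1) by (simp add: fin_group_def fin_group_axioms_def)
  show ?thesis
  proof (cases "x = \<one>\<^bsub>F\<^esub>")
    case True
    then show ?thesis using assms by simp
  next
    case False
    have "F.ord x dvd order F" using F.ord_dvd_group_order assms(3) .
    moreover have "F.ord x \<noteq> 1" using F.ord_eq_1 assms(3) False by blast
    ultimately have "F.ord x = order F" using assms(2) by (metis prime_nat_iff)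
    then have "F.cyc x = carrier F"
      using F.sub_card_eq[OF F.cyc_subgroup[OF assms(3)] F.subgroup_self] F.cyc_card[OF assms(3)]
        subgroup.subset[OF F.cyc_subgroup[OF assms(3)]] by (simp add: order_def)
    then show ?thesis using F.cyc_comm[OF assms(3) F.cyc_self[OF assms(3)]] assms(4) by blast
  qed
qed

context fin_group
begin

text \<open>This is the subgroup of order k of a cyclic group. Both descriptions are used later: the
  equation for inclusions, the generator for the order.\<close>

lemma cyc_roots_eq:
  assumes d: "d \<in> carrier G" and k: "k dvd ord d"
  shows "{x \<in> cyc d. x [^] (k::nat) = \<one>} = cyc (d [^] (ord d div k))"
    and "card {x \<in> cyc d. x [^] k = \<one>} = k"
proof -
  let ?l = "ord d div k"
  have lk: "?l * k = ord d" using k by simp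
  have k0: "k \<noteq> 0" using k ord_pos[OF d] by auto
  have l0: "?l \<noteq> 0" using lk ord_pos[OF d] by (metis less_irrefl mult_0)
  have dl: "d [^] ?l \<in> carrier G" using d by simp
  have dk: "(d [^] ?l) [^] k = \<one>" unfolding nat_pow_pow[OF d] lk using d by simp
  show eq: "{x \<in> cyc d. x [^] k = \<one>} = cyc (d [^] ?l)"
  proof
    show "cyc (d [^] ?l) \<subseteq> {x \<in> cyc d. x [^] k = \<one>}"
    proof
      fix x assume "x \<in> cyc (d [^] ?l)"
      then obtain i :: nat where i: "x = (d [^] ?l) [^] i" by (auto simp: cyc_def)
      have "x [^] k = ((d [^] ?l) [^] k) [^] i" unfolding i nat_pow_pow[OF dl] mult.commute[of i] ..
      then have "x [^] k = \<one>" using dk by simp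
      then show "x \<in> {x \<in> cyc d. x [^] k = \<one>}" using i by (auto simp: cyc_def nat_pow_pow[OF d])
    qed
    show "{x \<in> cyc d. x [^] k = \<one>} \<subseteq> cyc (d [^] ?l)"
    proof
      fix x assume "x \<in> {x \<in> cyc d. x [^] k = \<one>}"
      then obtain i :: nat where i: "x = d [^] i" "x [^] k = \<one>" by (auto simp: cyc_def)
      then have "?l * k dvd i * k" unfolding lk using pow_eq_id[OF d, of "i * k"] d by (simp add: nat_pow_pow)
      then have "?l dvd i" using k0 by simp
      then obtain j where "i = ?l * j" by blast
      then have "x = (d [^] ?l) [^] j" unfolding i(1) nat_pow_pow[OF d] by simp
      then show "x \<in> cyc (d [^] ?l)" by (auto simp: cyc_def)
    qed
  qed
  have "ord (d [^] ?l) = ord d div ?l" using ord_pow[OF d _ l0] lk by (metis dvd_triv_left)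
  also have "\<dots> = k" using lk l0 by (metis nonzero_mult_div_cancel_left)
  finally show "card {x \<in> cyc d. x [^] k = \<one>} = k" unfolding eq cyc_card[OF dl] .
qed

lemma conj_set: "X \<subseteq> carrier G \<Longrightarrow> g \<in> carrier G \<Longrightarrow> g <# X #> inv g = (\<lambda>x. g \<otimes> x \<otimes> inv g) ` X"
  by (auto simp: l_coset_def r_coset_def)

text \<open>The terms of the tower are the solution sets of x^k = 1, with k the product of the first
  i primes of |cyc d|; squarefreeness makes every step have the order of a Sylow subgroup.\<close>

lemma cyclic_squarefree_has_sylow_tower:
  assumes d: "d \<in> carrier G" and sf: "\<And>q. prime q \<Longrightarrow> \<not> q ^ 2 dvd card (cyc d)"
  shows "has_sylow_tower (G\<lparr>carrier := cyc d\<rparr>)"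
proof -
  let ?D = "cyc d"
  let ?n = "card ?D"
  have D: "subgroup ?D G" using cyc_subgroup[OF d] .
  have od: "ord d = ?n" using cyc_card[OF d] by simp
  have n0: "?n \<noteq> 0" using sub_card_pos[OF D] by simp
  have m1: "multiplicity p ?n = 1" if "prime p" "p dvd ?n" for p
    using multiplicity_eqI[of p 1 ?n] sf[OF that(1)] that(2) by (simp add: power2_eq_square)
  define ps where "ps = sorted_list_of_set (prime_factors ?n)"
  have ps: "set ps = prime_factors ?n" "distinct ps" by (auto simp: ps_def)
  have pr: "prime p" "p dvd ?n" if "p \<in> set ps" for p using that ps(1) by (auto simp: in_prime_factors_iff)
  define k where "k i = prod_list (take i ps)" for i
  have kS: "k (Suc i) = k i * ps ! i" if "i < length ps" for i
    using that by (simp add: k_def take_Suc_conv_app_nth)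
  have kt: "k (length ps) = ?n"
  proof -
    have "k (length ps) = (\<Prod>p\<in>prime_factors ?n. p)"
      using prod.distinct_set_conv_list[OF ps(2), of "\<lambda>p. p"] ps(1) by (simp add: k_def)
    also have "\<dots> = (\<Prod>p\<in>prime_factors ?n. p ^ multiplicity p ?n)"
      using m1 by (intro prod.cong) (auto simp: in_prime_factors_iff)
    also have "\<dots> = ?n" using prod_prime_factors[OF n0] by simp
    finally show ?thesis .
  qed
  have kd: "k i dvd ?n" for i
  proof -
    have "prod_list (take i ps) * prod_list (drop i ps) = ?n"
      using kt prod_list.append[of "take i ps" "drop i ps"] by (simp add: k_def)
    then show ?thesis unfolding k_def by (metis dvd_triv_left)
  qed
  define N where "N i = {x \<in> ?D. x [^] k i = \<one>}" for i
  have Nc: "N i = cyc (d [^] (?n div k i))" "card (N i) = k i" for i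
    using cyc_roots_eq[OF d, of "k i"] kd od unfolding N_def by auto
  have roots: "subgroup {x \<in> ?D. x [^] p = \<one>} G" if "p dvd ?n" for p
    using cyc_roots_eq(1)[OF d, of p] cyc_subgroup[of "d [^] (ord d div p)"] that od d by simp
  have Ns: "subgroup (N i) G" for i unfolding N_def using roots kd .
  have N0: "N 0 = {\<one>}" using sub_card_one[OF Ns] Nc(2)[of 0] by (simp add: k_def)
  have Nt: "N (length ps) = ?D" using sub_card_eq[OF Ns D, of "length ps"] Nc(2)[of "length ps"] kt by (auto simp: N_def)
  have Dc: "x \<in> carrier G" if "x \<in> ?D" for x using subgroup.mem_carrier[OF D that] .
  have Nn: "N i \<lhd> G\<lparr>carrier := ?D\<rparr>" for i
    unfolding normal_restrict_iff[OF D] normal_in_def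
  proof (intro conjI ballI)
    fix h n assume h: "h \<in> ?D" and n: "n \<in> N i"
    then have nD: "n \<in> ?D" by (simp add: N_def)
    have "h \<otimes> n \<otimes> inv h = n" using cyc_comm[OF d h nD] conj_eq_iff[OF Dc[OF h] Dc[OF nD]] by blast
    then show "h \<otimes> n \<otimes> inv h \<in> N i" using n by simp
  qed (use Ns in \<open>auto simp: N_def\<close>)
  have step: "N i \<subset> N (Suc i) \<and> (\<exists>p P. sylow_subgroup p (G\<lparr>carrier := ?D\<rparr>) P
      \<and> order ((G\<lparr>carrier := ?D\<rparr>)\<lparr>carrier := N (Suc i)\<rparr> Mod N i) = card P)"
    if i: "i < length ps" for i
  proof -
    let ?p = "ps ! i"
    have p: "prime ?p" "?p dvd ?n" using pr i by auto
    have k0: "k i \<noteq> 0" using kd[of i] n0 by auto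
    have sub: "N i \<subseteq> N (Suc i)"
    proof
      fix x assume x: "x \<in> N i"
      then have xc: "x \<in> carrier G" using Dc by (simp add: N_def)
      have "x [^] k (Suc i) = (x [^] k i) [^] ?p" unfolding kS[OF i] nat_pow_pow[OF xc] ..
      then show "x \<in> N (Suc i)" using x by (simp add: N_def)
    qed
    moreover have "N i \<noteq> N (Suc i)"
    proof
      assume "N i = N (Suc i)"
      then have "k (Suc i) = k i" using Nc(2)[of i] Nc(2)[of "Suc i"] by metis
      then have "?p = 1" using kS[OF i] k0 by simp
      then show False using p(1) by (metis not_prime_1)
    qed
    moreover have "order ((G\<lparr>carrier := ?D\<rparr>)\<lparr>carrier := N (Suc i)\<rparr> Mod N i) = ?p"
      using card_rcosets_restrict[OF Ns Ns sub] Nc(2)[of i] Nc(2)[of "Suc i"] kS[OF i] k0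
      by (simp add: order_def FactGroup_def)
    moreover have "sylow_subgroup ?p (G\<lparr>carrier := ?D\<rparr>) {x \<in> ?D. x [^] ?p = \<one>}"
      unfolding sylow_subgroup_def
      using p(1) subgroup_incl[OF roots[OF p(2)] D] cyc_roots_eq(2)[OF d, of ?p] p(2) od m1[OF p]
      by (auto simp: order_def)
    moreover have "card {x \<in> ?D. x [^] ?p = \<one>} = ?p" using cyc_roots_eq(2)[OF d, of ?p] p(2) od by simp
    ultimately show ?thesis by (metis psubsetI)
  qed
  show ?thesis
    unfolding has_sylow_tower_def
  proof (intro exI conjI)
    show "N 0 = {\<one>\<^bsub>G\<lparr>carrier := ?D\<rparr>\<^esub>}" using N0 by simp
    show "N (length ps) = carrier (G\<lparr>carrier := ?D\<rparr>)" using Nt by simp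
    show "\<forall>i\<le>length ps. N i \<lhd> G\<lparr>carrier := ?D\<rparr>" using Nn by blast
    show "\<forall>i<length ps. N i \<subset> N (Suc i) \<and> (\<exists>p P. sylow_subgroup p (G\<lparr>carrier := ?D\<rparr>) P
      \<and> order ((G\<lparr>carrier := ?D\<rparr>)\<lparr>carrier := N (Suc i)\<rparr> Mod N i) = card P)" using step by blast
  qed
qed

lemma fin_group_FactGroup:
  assumes "N \<lhd> G" shows "fin_group (G Mod N)"
proof -
  have "finite (rcosets N)"
    using fin rcosets_subset_PowG[OF normal_imp_subgroup[OF assms]] by (meson finite_Pow_iff finite_subset)
  then show ?thesis
    using normal.factorgroup_is_group[OF assms] by (simp add: fin_group_def fin_group_axioms_def FactGroup_def)
qed

lemma order_FactGroup_dvd: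
  assumes "N \<lhd> G" shows "order (G Mod N) dvd order G"
  using lagrange[OF normal_imp_subgroup[OF assms]] by (metis FactGroup_def dvd_triv_left order_def partial_object.select_convs(1))

text \<open>Every coset of D has a representative in M. A subgroup K of the quotient is pulled back
  to a subgroup of M, which is normal there.\<close>

lemma dedekind_FactGroup:
  assumes sd: "internal_semidirect G D M" and ded: "dedekind_group (G\<lparr>carrier := M\<rparr>)"
  shows "dedekind_group (G Mod D)"
proof -
  have D: "D \<lhd> G" and M: "subgroup M G" and DM: "D <#> M = carrier G"
    using sd by (auto simp: internal_semidirect_def)
  interpret D: normal D G by (rule D)
  let ?Q = "G Mod D"
  interpret Q: group ?Q by (rule D.factorgroup_is_group)
  let ?h = "\<lambda>a. D #> a"
  interpret h: group_hom G ?Q ?h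
    by (intro group_hom.intro group_hom_axioms.intro is_group Q.is_group D.r_coset_hom_Mod)
  note Mc = subgroup.mem_carrier[OF M]
  have surj: "\<exists>m\<in>M. x = ?h m" if x: "x \<in> carrier ?Q" for x
  proof -
    obtain g where g: "g \<in> carrier G" "x = ?h g" using x by (auto simp: FactGroup_def RCOSETS_def)
    obtain d m where dm: "g = d \<otimes> m" "d \<in> D" "m \<in> M" using g(1) DM unfolding set_mult_def by blast
    have "d \<in> carrier G" using dm(2) D.subset by blast
    then have "?h g = ?h m"
      using rcos_eq_iff[OF D.subgroup_axioms g(1) Mc[OF dm(3)]] dm Mc[OF dm(3)] by (simp add: m_assoc)
    then show ?thesis using g dm by blast
  qed
  have "K \<lhd> ?Q" if K: "subgroup K ?Q" for K
    unfolding Q.normal_inv_iff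
  proof (intro conjI ballI K)
    fix x k assume x: "x \<in> carrier ?Q" and k: "k \<in> K"
    obtain m where m: "m \<in> M" "x = ?h m" using surj[OF x] by blast
    obtain a where a: "a \<in> M" "k = ?h a" using surj[OF subgroup.mem_carrier[OF K k]] by blast
    let ?A = "{m \<in> M. ?h m \<in> K}"
    have "subgroup ?A G"
    proof (rule subgroupI)
      show "?A \<subseteq> carrier G" using Mc by blast
      have "?h \<one> \<in> K" using h.hom_one subgroup.one_closed[OF K] by simp
      then show "?A \<noteq> {}" using subgroup.one_closed[OF M] by blast
      show "inv u \<in> ?A" if "u \<in> ?A" for u
        using that h.hom_inv[OF Mc, of u] subgroup.m_inv_closed[OF K] subgroup.m_inv_closed[OF M] by simp
      show "u \<otimes> v \<in> ?A" if "u \<in> ?A" "v \<in> ?A" for u v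
        using that h.hom_mult[OF Mc Mc, of u v] subgroup.m_closed[OF K] subgroup.m_closed[OF M] by simp
    qed
    then have "normal_in M ?A" using ded dedekind_restrict_iff[OF M] by blast
    then have "m \<otimes> a \<otimes> inv m \<in> ?A" using m(1) a k unfolding normal_in_def by blast
    then have "?h (m \<otimes> a \<otimes> inv m) \<in> K" by blast
    then show "x \<otimes>\<^bsub>?Q\<^esub> k \<otimes>\<^bsub>?Q\<^esub> inv\<^bsub>?Q\<^esub> x \<in> K"
      using h.hom_mult h.hom_inv m a Mc by simp
  qed
  then show ?thesis using Q.is_group unfolding dedekind_group_def by blast
qed

lemma subgroup_centralizer_section:
  assumes H: "subgroup H G" "normal_in (carrier G) H" and K: "subgroup K G" "K \<subseteq> H"
  shows "subgroup (centralizer_section G H K) G"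
proof -
  let ?S = "carrier ((G\<lparr>carrier := H\<rparr>) Mod K)"
  let ?C = "centralizer_section G H K"
  have sub: "X \<subseteq> carrier G" if "X \<in> ?S" for X
    using that subgroup.mem_carrier[OF H(1)] subgroup.mem_carrier[OF K(1)]
    by (auto simp: FactGroup_def RCOSETS_def r_coset_def)
  have C: "g \<in> ?C \<longleftrightarrow> g \<in> carrier G \<and> (\<forall>X\<in>?S. (\<lambda>x. g \<otimes> x \<otimes> inv g) ` X = X)" for g
    by (simp add: centralizer_section_def conj_set[OF sub] cong: conj_cong)
  show ?thesis
  proof (rule subgroupI)
    show "?C \<subseteq> carrier G" using C by blast
    have "(\<lambda>x. \<one> \<otimes> x \<otimes> inv \<one>) ` X = X" if "X \<in> ?S" for X
    proof -
      have "(\<lambda>x. \<one> \<otimes> x \<otimes> inv \<one>) ` X = (\<lambda>x. x) ` X" using sub[OF that] by (intro image_cong) auto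
      then show ?thesis by simp
    qed
    then have "\<one> \<in> ?C" by (intro C[THEN iffD2] conjI ballI one_closed)
    then show "?C \<noteq> {}" by blast
    show "a \<otimes> b \<in> ?C" if ab: "a \<in> ?C" "b \<in> ?C" for a b
    proof -
      have c: "a \<in> carrier G" "b \<in> carrier G" using ab C by auto
      have "(\<lambda>x. (a \<otimes> b) \<otimes> x \<otimes> inv (a \<otimes> b)) ` X = X" if X: "X \<in> ?S" for X
      proof -
        have "(\<lambda>x. (a \<otimes> b) \<otimes> x \<otimes> inv (a \<otimes> b)) ` X = (\<lambda>x. a \<otimes> x \<otimes> inv a) ` (\<lambda>x. b \<otimes> x \<otimes> inv b) ` X"
          unfolding image_image using sub[OF X] c
          by (intro image_cong refl) (auto simp: m_assoc inv_mult_group dest!: subsetD)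
        then show ?thesis using ab C X by simp
      qed
      then show ?thesis using c C by simp
    qed
    show "inv a \<in> ?C" if a: "a \<in> ?C" for a
    proof -
      have c: "a \<in> carrier G" using a C by auto
      have "(\<lambda>x. inv a \<otimes> x \<otimes> inv (inv a)) ` X = X" if X: "X \<in> ?S" for X
      proof -
        have "(\<lambda>x. inv a \<otimes> x \<otimes> inv (inv a)) ` (\<lambda>x. a \<otimes> x \<otimes> inv a) ` X = X"
        proof -
          have "inv a \<otimes> (a \<otimes> x \<otimes> inv a) \<otimes> inv (inv a) = x" if "x \<in> X" for x
            using subsetD[OF sub[OF X] that] c by (simp add: m_assoc inv_cancel)
          then show ?thesis unfolding image_image by simp
        qed
        then show ?thesis using a C X by metis
      qed
      then show ?thesis using c C by simp
    qed
  qed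
qed

end

section \<open>The residual, the chief factors and the Sylow subgroups of D\<close>

context sigma_partition_group
begin

context
  fixes D M
  assumes scd: "split_cyclic_dedekind (carrier G) D M"
begin

private lemma Dn: "normal_in (carrier G) D" and Ds: "subgroup D G" and Ms: "subgroup M G"
  and DM: "D <#> M = carrier G" "D \<inter> M = {\<one>}"
  and D_cyc: "\<exists>d\<in>carrier G. D = cyc d"
  and D_iso: "prime q \<Longrightarrow> q dvd card D \<Longrightarrow> isolated (order G) q"
  and M_ded: "dedekind_group (G\<lparr>carrier := M\<rparr>)"
  using scd dedekind_restrict_iff[of M] unfolding split_cyclic_dedekind_def normal_in_def order_def by auto

private lemma semidirect: "internal_semidirect G D M"
  using Dn Ms DM unfolding internal_semidirect_def normal_iff by blast

private lemma D_props: "sigma_hall \<sigma> G D" "squarefree (card D)"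
  "card (sigma_of \<sigma> (card D)) = card (prime_factors (card D))"
  using isolated_iff[OF Ds] D_iso by auto

private lemma D_dvd: "card D dvd order G"
  using sub_card_dvd[OF Ds carrier_sub] subgroup.subset[OF Ds] by (simp add: order_def)

private lemma D_sf: "prime q \<Longrightarrow> \<not> q ^ 2 dvd card D"
proof
  assume q: "prime q" and a: "q ^ 2 dvd card D"
  then have "q dvd card D" unfolding power2_eq_square by (metis dvd_mult_left)
  then show False using D_iso[OF q] a D_dvd dvd_trans unfolding isolated_def by blast
qed

text \<open>
  A \<open>\<sigma>\<close>-primary direct factor of \<open>G/N\<close> in which the image of \<open>x\<close> is nontrivial has
  order \<open>q = ord x\<close>, as \<open>q\<close> is alone in its class; hence the image of \<open>x\<close> is central.
\<close>

lemma split_subset_of_sigma_nilpotent_quotient: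
  assumes N: "N \<lhd> G" and nil: "sigma_nilpotent \<sigma> (G Mod N)"
  shows "D \<subseteq> N"
proof -
  interpret N: normal N G by (rule N)
  let ?Q = "G Mod N"
  interpret Q: fin_group ?Q by (rule fin_group_FactGroup[OF N])
  obtain I and F :: "nat \<Rightarrow> 'a set monoid" and f where IF: "finite (I :: nat set)" "\<And>i. i \<in> I \<Longrightarrow> group (F i)"
    "\<And>i. i \<in> I \<Longrightarrow> sigma_primary \<sigma> (F i)" and f: "f \<in> iso ?Q (product_group I F)"
    using nil unfolding sigma_nilpotent_def is_iso_def ex_in_conv[symmetric] by blast
  have "card (carrier ?Q) = card (carrier (product_group I F))"
    using f unfolding iso_def by (auto intro: bij_betw_same_card)
  then have oQ: "order ?Q = (\<Prod>i\<in>I. order (F i))" by (simp add: order_def card_PiE IF(1))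
  have oF: "order (F i) dvd order G" "order (F i) \<noteq> 0" if i: "i \<in> I" for i
  proof -
    have "order (F i) dvd order ?Q" unfolding oQ using i IF(1) by (rule dvd_prodI[rotated])
    then show "order (F i) dvd order G" using order_FactGroup_dvd[OF N] dvd_trans by blast
    have "order G \<noteq> 0" using sub_card_pos[OF carrier_sub] by (simp add: order_def)
    then show "order (F i) \<noteq> 0" using \<open>order (F i) dvd order G\<close> by auto
  qed
  let ?h = "\<lambda>i a. f (N #> a) i"
  have h: "group_hom G (F i) (?h i)" if i: "i \<in> I" for i
  proof -
    have c: "N #> a \<in> carrier ?Q" if "a \<in> carrier G" for a
      using that by (auto simp: FactGroup_def RCOSETS_def)
    have "f \<in> hom ?Q (product_group I F)" using f by (simp add: iso_def)
    then have "f x i \<in> carrier (F i)" if "x \<in> carrier ?Q" for x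
      using that i by (auto simp: hom_def PiE_def Pi_def)
    moreover have "f (x \<otimes>\<^bsub>?Q\<^esub> y) i = f x i \<otimes>\<^bsub>F i\<^esub> f y i"
      if "x \<in> carrier ?Q" "y \<in> carrier ?Q" for x y
      using \<open>f \<in> hom ?Q (product_group I F)\<close> that i by (auto simp: hom_def)
    moreover have "N #> (a \<otimes> b) = (N #> a) \<otimes>\<^bsub>?Q\<^esub> (N #> b)" if "a \<in> carrier G" "b \<in> carrier G" for a b
      using N.r_coset_hom_Mod that unfolding hom_def by blast
    ultimately have "?h i \<in> hom G (F i)" using c unfolding hom_def by auto
    then show ?thesis using IF(2)[OF i] is_group by (simp add: group_hom_def group_hom_axioms_def)
  qed
  have comm: "m \<otimes> x \<otimes> inv m \<otimes> inv x \<in> N" if x: "x \<in> D" "prime (ord x)" and m: "m \<in> carrier G" for x m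
  proof -
    have xc: "x \<in> carrier G" using x(1) subgroup.mem_carrier[OF Ds] by blast
    let ?q = "ord x"
    let ?c = "m \<otimes> x \<otimes> inv m \<otimes> inv x"
    have cc: "?c \<in> carrier G" using m xc by simp
    have iq: "isolated (order G) ?q" using D_iso[OF x(2)] ord_dvd_sub[OF Ds x(1)] by blast
    have hc: "?h i ?c = \<one>\<^bsub>F i\<^esub>" if i: "i \<in> I" for i
    proof -
      interpret h: group_hom G "F i" "?h i" by (rule h[OF i])
      have hx: "?h i x \<in> carrier (F i)" and hm: "?h i m \<in> carrier (F i)" using xc m by auto
      have "?h i x \<otimes>\<^bsub>F i\<^esub> ?h i m = ?h i m \<otimes>\<^bsub>F i\<^esub> ?h i x"
      proof (cases "?h i x = \<one>\<^bsub>F i\<^esub>")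
        case True
        then show ?thesis using hm by simp
      next
        case False
        have "?h i x [^]\<^bsub>F i\<^esub> ?q = \<one>\<^bsub>F i\<^esub>"
          using h.hom_nat_pow[OF xc, of ?q] pow_ord_eq_1[OF xc] h.hom_one by simp
        then have "h.H.ord (?h i x) dvd ?q" using h.H.pow_eq_id[OF hx] by blast
        moreover have "h.H.ord (?h i x) \<noteq> 1" using h.H.ord_eq_1[OF hx] False by blast
        ultimately have "h.H.ord (?h i x) = ?q" using x(2) by (metis prime_nat_iff)
        then have qF: "?q dvd order (F i)" using h.H.ord_dvd_group_order[OF hx] by simp
        obtain S where S: "S \<in> \<sigma>" "prime_factors (order (F i)) \<subseteq> S"
          using IF(3)[OF i] unfolding sigma_primary_def by blast
        have "?q \<in> S" using S(2) qF x(2) oF(2)[OF i] by (auto simp: in_prime_factors_iff)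
        have only: "r = ?q" if r: "prime r" "r dvd order (F i)" for r
        proof -
          have "r \<in> S" using S(2) r oF(2)[OF i] by (auto simp: in_prime_factors_iff)
          then have "sigma_same \<sigma> ?q r" using S(1) \<open>?q \<in> S\<close> unfolding sigma_same_def by blast
          moreover have "r dvd order G" using r(2) oF(1)[OF i] by (rule dvd_trans)
          ultimately show ?thesis using iq r(1) unfolding isolated_def by blast
        qed
        obtain l where l: "order (F i) = ?q * l" using qF by blast
        have "l = 1"
        proof (rule ccontr)
          assume "l \<noteq> 1"
          then obtain r where r: "prime r" "r dvd l" using prime_factor_nat by blast
          then have "r = ?q" using only l by simp
          then have "?q * ?q dvd order (F i)" using r(2) unfolding l by (intro mult_dvd_mono) auto
          then have "?q * ?q dvd order G" using oF(1)[OF i] by (rule dvd_trans)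
          then show False using iq by (simp add: isolated_def power2_eq_square)
        qed
        then have "prime (order (F i))" using l x(2) by simp
        then show ?thesis using prime_order_comm[OF IF(2)[OF i] _ hx hm] by blast
      qed
      then have "?h i m \<otimes>\<^bsub>F i\<^esub> ?h i x \<otimes>\<^bsub>F i\<^esub> inv\<^bsub>F i\<^esub> ?h i m \<otimes>\<^bsub>F i\<^esub> inv\<^bsub>F i\<^esub> ?h i x = \<one>\<^bsub>F i\<^esub>"
        using hx hm by (metis h.H.inv_solve_right h.H.m_closed h.H.l_one h.H.inv_closed h.H.m_assoc h.H.r_inv h.H.r_one)
      then show ?thesis using m xc by simp
    qed
    have Nc: "N #> ?c \<in> carrier ?Q" using cc by (auto simp: FactGroup_def RCOSETS_def)
    have fh: "f \<in> hom ?Q (product_group I F)" using f by (simp add: iso_def)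
    interpret pg: group "product_group I F" using IF(2) by simp
    interpret fg: group_hom ?Q "product_group I F" f
      using fh by (intro group_hom.intro group_hom_axioms.intro Q.is_group pg.is_group)
    have "f (N #> ?c) \<in> (\<Pi>\<^sub>E i\<in>I. carrier (F i))" using fg.hom_closed[OF Nc] by simp
    then have "f (N #> ?c) = \<one>\<^bsub>product_group I F\<^esub>"
      using hc by (auto simp: fun_eq_iff PiE_def extensional_def)
    then have "f (N #> ?c) = f \<one>\<^bsub>?Q\<^esub>" using fg.hom_one by simp
    moreover have "inj_on f (carrier ?Q)" using f by (simp add: iso_def bij_betw_def)
    ultimately have "N #> ?c = \<one>\<^bsub>?Q\<^esub>" using Nc Q.one_closed by (metis inj_onD)
    then have "N #> ?c = N" by (simp add: FactGroup_def)
    then show ?thesis using rcos_self[OF cc N.subgroup_axioms] by simp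
  qed
  have "x \<in> N" if x: "x \<in> D" "prime (ord x)" for x
  proof -
    obtain m where m: "m \<in> M" "x \<in> cyc (m \<otimes> x \<otimes> inv m \<otimes> inv x)"
      using prime_order_in_commutator[OF scd carrier_sub x] by blast
    have "m \<otimes> x \<otimes> inv m \<otimes> inv x \<in> N" using comm[OF x] m(1) subgroup.mem_carrier[OF Ms] by blast
    then show ?thesis using cyc_sub[OF N.subgroup_axioms] m(2) by blast
  qed
  then have "D = D \<inter> N"
    using all_prime_order_imp_eq[OF Ds subgroups_Inter_pair[OF Ds N.subgroup_axioms]] D_sf by blast
  then show ?thesis by blast
qed

text \<open>D lies in every normal N with sigma-nilpotent quotient by the preceding lemma, and D is
  itself such an N because G/D is Dedekind.\<close>

lemma split_eq_residual: "D = sigma_nilpotent_residual \<sigma> G"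
proof
  show "D \<subseteq> sigma_nilpotent_residual \<sigma> G"
    unfolding sigma_nilpotent_residual_def using split_subset_of_sigma_nilpotent_quotient by blast
  have D: "D \<lhd> G" using semidirect by (simp add: internal_semidirect_def)
  interpret Q: fin_group "G Mod D" by (rule fin_group_FactGroup[OF D])
  have "sigma_nilpotent \<sigma> (G Mod D)"
    using Q.dedekind_sigma_nilpotent[OF dedekind_FactGroup[OF semidirect M_ded] part] .
  then show "sigma_nilpotent_residual \<sigma> G \<subseteq> D"
    unfolding sigma_nilpotent_residual_def using D by blast
qed

text \<open>D is abelian, so it lies in the centralizer C of H/K. If the factor were central, the
  primes of |G : C| would lie in the class of a prime q dividing |H : K|; as q is isolated and
  divides |C|, this forces C = G. But for x of order q in H some commutator with an element of M
  generates \<open>cyc x\<close>, and it would lie in K, which has no element of order q.\<close>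

lemma split_eccentric:
  assumes cf: "chief_factor G H K" and HD: "H \<subseteq> D"
  shows "sigma_eccentric \<sigma> G H K"
proof
  assume cen: "sigma_central \<sigma> G H K"
  have Hn: "normal_in (carrier G) H" and Kn: "normal_in (carrier G) K" and KH: "K \<subset> H"
    using cf unfolding chief_factor_def normal_iff by auto
  then have Hs: "subgroup H G" and Ks: "subgroup K G" by (auto simp: normal_in_def)
  have KH': "K \<subseteq> H" using KH by blast
  let ?C = "centralizer_section G H K"
  have Cs: "subgroup ?C G" using subgroup_centralizer_section[OF Hs Hn Ks KH'] .
  have Dc: "x \<in> carrier G" if "x \<in> D" for x using subgroup.mem_carrier[OF Ds that] .
  obtain d where d: "d \<in> carrier G" "D = cyc d" using D_cyc by blast
  have ab: "u \<otimes> v = v \<otimes> u" if "u \<in> D" "v \<in> D" for u v using cyc_comm[OF d(1)] that d(2) by blast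
  have S: "carrier ((G\<lparr>carrier := H\<rparr>) Mod K) = (\<lambda>h. K #> h) ` H"
    by (auto simp: FactGroup_def RCOSETS_def r_coset_def)
  have coset_D: "K #> h \<subseteq> D" if "h \<in> H" for h
    using that KH' HD by (auto simp: r_coset_def intro!: subgroup.m_closed[OF Ds])
  have cs: "g \<in> ?C \<longleftrightarrow> g \<in> carrier G \<and> (\<forall>h\<in>H. (\<lambda>x. g \<otimes> x \<otimes> inv g) ` (K #> h) = K #> h)" for g
  proof -
    have "K #> h \<subseteq> carrier G" if "h \<in> H" for h using coset_D[OF that] Dc by blast
    then show ?thesis unfolding centralizer_section_def S by (simp add: conj_set cong: conj_cong)
  qed
  have DC: "D \<subseteq> ?C"
  proof
    fix u assume u: "u \<in> D"
    have "(\<lambda>x. u \<otimes> x \<otimes> inv u) ` (K #> h) = K #> h" if h: "h \<in> H" for h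
    proof -
      have "u \<otimes> x \<otimes> inv u = x" if "x \<in> K #> h" for x
        using coset_D[OF h] that ab[OF u] conj_eq_iff[OF Dc[OF u]] Dc by blast
      then show ?thesis by simp
    qed
    then show "u \<in> ?C" using cs Dc[OF u] by blast
  qed
  let ?i = "card H div card K"
  have Ki: "card K * ?i = card H" using idx_mult[OF Ks Hs KH'] .
  have HG: "card H dvd order G" and CG: "?C \<subseteq> carrier G"
    using sub_card_dvd[OF Hs carrier_sub] subgroup.subset[OF Hs] subgroup.subset[OF Cs] by (auto simp: order_def)
  have "?i \<noteq> 1" using Ki sub_card_eq[OF Ks Hs KH'] KH by auto
  then obtain q where q: "prime q" "q dvd ?i" using prime_factor_nat by blast
  have "q dvd card K * ?i" using q(2) by simp
  then have qH: "q dvd card H" using Ki by simp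
  then have qD: "q dvd card D" using sub_card_dvd[OF Hs Ds HD] dvd_trans by blast
  have iq: "isolated (order G) q" using D_iso[OF q(1) qD] .
  have oC: "card ?C * card (rcosets ?C) = order G" using lagrange[OF Cs] by (simp add: mult.commute)
  have oG: "order G \<noteq> 0" using sub_card_pos[OF carrier_sub] by (simp add: order_def)
  have order_sd: "order (semidirect_product ((G\<lparr>carrier := H\<rparr>) Mod K) (G Mod ?C) (section_conj G))
      = ?i * card (rcosets ?C)"
    using card_rcosets_restrict[OF Hs Ks KH']
    by (simp add: order_def semidirect_product_def FactGroup_def card_cartesian_product)
  have i0: "?i * card (rcosets ?C) \<noteq> 0"
    using Ki oC oG sub_card_pos[OF Hs] by (metis less_irrefl mult_0_right mult_eq_0_iff)
  obtain T where T: "T \<in> \<sigma>" "prime_factors (?i * card (rcosets ?C)) \<subseteq> T"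
    using cen unfolding sigma_central_def sigma_primary_def order_sd by blast
  have inT: "r \<in> T" if "prime r" "r dvd ?i * card (rcosets ?C)" for r
    using T(2) that i0 by (auto simp: in_prime_factors_iff)
  have qT: "q \<in> T" using inT q by simp
  have "card (rcosets ?C) = 1"
  proof (rule ccontr)
    assume "card (rcosets ?C) \<noteq> 1"
    then obtain r where r: "prime r" "r dvd card (rcosets ?C)" using prime_factor_nat by blast
    have "r \<in> T" using inT r by simp
    then have "sigma_same \<sigma> q r" using T(1) qT unfolding sigma_same_def by blast
    moreover have "r dvd order G" unfolding oC[symmetric] using r(2) by simp
    ultimately have "r = q" using iq r(1) unfolding isolated_def by blast
    moreover have "q dvd card ?C" using qD sub_card_dvd[OF Ds Cs DC] dvd_trans by blast
    ultimately have "q * q dvd card ?C * card (rcosets ?C)" using r(2) by (intro mult_dvd_mono) auto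
    then show False using iq oC by (simp add: isolated_def power2_eq_square)
  qed
  then have CG: "?C = carrier G" using oC sub_card_eq[OF Cs carrier_sub CG] by (simp add: order_def)
  obtain x where x: "x \<in> H" "ord x = q" using cauchy[OF q(1) Hs qH] .
  have xD: "x \<in> D" using x(1) HD by blast
  note xc = Dc[OF xD]
  have "x \<notin> K"
  proof
    assume "x \<in> K"
    then have "q dvd card K" using ord_dvd_sub[OF Ks] x(2) by blast
    then have "q * q dvd card K * ?i" using q(2) by (rule mult_dvd_mono)
    then have "q * q dvd order G" using Ki HG dvd_trans by metis
    then show False using iq by (simp add: isolated_def power2_eq_square)
  qed
  obtain m where m: "m \<in> M" "x \<in> cyc (m \<otimes> x \<otimes> inv m \<otimes> inv x)"
    using prime_order_in_commutator[OF scd carrier_sub xD] x(2) q(1) by blast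
  have mc: "m \<in> carrier G" using m(1) subgroup.mem_carrier[OF Ms] by blast
  then have "m \<in> ?C" using CG by simp
  then have "(\<lambda>x. m \<otimes> x \<otimes> inv m) ` (K #> x) = K #> x" using cs x(1) by blast
  then have "m \<otimes> x \<otimes> inv m \<in> K #> x" using rcos_self[OF xc Ks] by blast
  then obtain k where k: "k \<in> K" "m \<otimes> x \<otimes> inv m = k \<otimes> x" by (auto simp: r_coset_def)
  have kc: "k \<in> carrier G" using subgroup.mem_carrier[OF Ks k(1)] .
  have "m \<otimes> x \<otimes> inv m \<otimes> inv x = k" unfolding k(2) using kc xc by (simp add: m_assoc)
  then have "x \<in> K" using m(2) cyc_sub[OF Ks k(1)] by auto
  then show False using \<open>x \<notin> K\<close> by blast
qed

text \<open>Squarefreeness of |D| makes P a group of prime order.\<close>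

lemma split_sylow_irreducible:
  assumes p: "p \<in> prime_factors (card D)" and P: "sylow_subgroup p (G\<lparr>carrier := D\<rparr>) P"
  shows "acts_irreducibly G M P"
proof -
  have pp: "prime p" "p dvd card D" using p by (auto simp: in_prime_factors_iff)
  have "multiplicity p (card D) = 1"
    using multiplicity_eqI[of p 1 "card D"] D_sf[OF pp(1)] pp(2) by (simp add: power2_eq_square)
  then have cP: "card P = p" and Ps: "subgroup P G"
    using P incl_subgroup[OF Ds] unfolding sylow_subgroup_def by (auto simp: order_def)
  have "P \<noteq> {\<one>}" using cP pp(1) by (metis card_1_singleton_iff not_prime_1 One_nat_def)
  moreover have "Q = {\<one>} \<or> Q = P" if Q: "subgroup Q G" "Q \<subseteq> P" for Q
  proof -
    have "card Q dvd p" using sub_card_dvd[OF Q(1) Ps Q(2)] cP by simp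
    then have "card Q = 1 \<or> card Q = p" using pp(1) by (metis prime_nat_iff)
    then show ?thesis using sub_card_one[OF Q(1)] sub_card_eq[OF Q(1) Ps Q(2)] cP by metis
  qed
  ultimately show ?thesis unfolding acts_irreducibly_def by blast
qed

lemma split_imp_H_sigma_E_group: "H_sigma_E_group \<sigma> G D M \<and> cyclic_group (G\<lparr>carrier := D\<rparr>) \<and> squarefree (card D)
    \<and> dedekind_group (G\<lparr>carrier := M\<rparr>)"
proof -
  obtain d where d: "d \<in> carrier G" "D = cyc d" using D_cyc by blast
  have "has_sylow_tower (G\<lparr>carrier := D\<rparr>)"
    unfolding d(2) by (rule cyclic_squarefree_has_sylow_tower[OF d(1)]) (use D_sf d(2) in auto)
  moreover have "cyclic_group (G\<lparr>carrier := D\<rparr>)" unfolding d(2) by (rule cyclic_restrict[OF d(1)])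
  ultimately show ?thesis
    unfolding H_sigma_E_group_def
    using semidirect split_eq_residual[symmetric] D_props split_eccentric split_sylow_irreducible M_ded by auto
qed

end

lemma embedded_imp_H_sigma_E_group:
  assumes "\<forall>A. subgroup A G \<longrightarrow> H_sigma_normally_embedded \<sigma> G A"
  shows "\<exists>D M. H_sigma_E_group \<sigma> G D M \<and> cyclic_group (G\<lparr>carrier := D\<rparr>) \<and> squarefree (card D)
    \<and> dedekind_group (G\<lparr>carrier := M\<rparr>)"
proof -
  have "all_emb (carrier G)" using assms all_emb_iff by blast
  then obtain D M where "split_cyclic_dedekind (carrier G) D M" using all_emb_split[OF _ carrier_sub] by blast
  then show ?thesis using split_imp_H_sigma_E_group by blast
qed

lemma split_imp_embedded:
  assumes "internal_semidirect G D M" "sigma_hall \<sigma> G D" "squarefree (card D)"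
    and "card (sigma_of \<sigma> (card D)) = card (prime_factors (card D))"
    and "dedekind_group (G\<lparr>carrier := M\<rparr>)" and A: "subgroup A G"
  shows "H_sigma_normally_embedded \<sigma> G A"
proof -
  have "subgroup D G" using assms(1) normal_imp_subgroup unfolding internal_semidirect_def by blast
  then have "isolated (order G) q" if "prime q" "q dvd card D" for q using isolated_iff assms that by blast
  then show ?thesis using semidirect_imp_embedded[OF assms(1,5) _ A] emb_iff[OF A] by blast
qed

end

theorem theorem1p7:
  fixes G :: "('a, 'b) monoid_scheme" and \<sigma> :: "nat set set"
  assumes "prime_partition \<sigma>"
    and "group G" and "finite (carrier G)"
    and "sigma_full \<sigma> G"
  shows "((\<forall>A. subgroup A G \<longrightarrow> H_sigma_normally_embedded \<sigma> G A)
          \<longleftrightarrow>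
          (\<exists>D M. H_sigma_E_group \<sigma> G D M
            \<and> cyclic_group (G\<lparr>carrier := D\<rparr>) \<and> squarefree (card D)
            \<and> dedekind_group (G\<lparr>carrier := M\<rparr>)))
       \<and> ((\<exists>D M. H_sigma_E_group \<sigma> G D M
            \<and> cyclic_group (G\<lparr>carrier := D\<rparr>) \<and> squarefree (card D)
            \<and> dedekind_group (G\<lparr>carrier := M\<rparr>))
          \<longleftrightarrow>
          (\<exists>D M. internal_semidirect G D M
            \<and> cyclic_group (G\<lparr>carrier := D\<rparr>) \<and> sigma_hall \<sigma> G D \<and> squarefree (card D)
            \<and> card (sigma_of \<sigma> (card D)) = card (prime_factors (card D))
            \<and> dedekind_group (G\<lparr>carrier := M\<rparr>)))"
proof -
  interpret G: sigma_partition_group G \<sigma>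
    using assms by (simp add: sigma_partition_group_def sigma_partition_group_axioms_def fin_group_def fin_group_axioms_def)
  let ?i = "\<forall>A. subgroup A G \<longrightarrow> H_sigma_normally_embedded \<sigma> G A"
  let ?ii = "\<exists>D M. H_sigma_E_group \<sigma> G D M
            \<and> cyclic_group (G\<lparr>carrier := D\<rparr>) \<and> squarefree (card D)
            \<and> dedekind_group (G\<lparr>carrier := M\<rparr>)"
  let ?iii = "\<exists>D M. internal_semidirect G D M
            \<and> cyclic_group (G\<lparr>carrier := D\<rparr>) \<and> sigma_hall \<sigma> G D \<and> squarefree (card D)
            \<and> card (sigma_of \<sigma> (card D)) = card (prime_factors (card D))
            \<and> dedekind_group (G\<lparr>carrier := M\<rparr>)"
  have "?i \<Longrightarrow> ?ii" by (rule G.embedded_imp_H_sigma_E_group)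
  moreover have "?ii \<Longrightarrow> ?iii" unfolding H_sigma_E_group_def by blast
  moreover have "?iii \<Longrightarrow> ?i" using G.split_imp_embedded by blast
  ultimately show ?thesis by blast
qed

end
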